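(* Let $0<\varepsilon<1/3$. There exist constants $c,c'>0$ depending only on $\varepsilon$ such that for all $d\ge3$, \[ \mathbb{P}\big[G_0^{h_{\mathrm{as}}(d)(1-8\varepsilon)}\big]\ge1-ce^{-c'd^\varepsilon}. \]
   Context: Under $\mathbb{P}$, $\varphi$ is the Gaussian free field on $\mathbb{Z}^d$ ($d\ge3$): centered Gaussian with covariance the Green function $g(x,y)=\sum_{n\ge0}P_x[X_n=y]$ of simple random walk; $h_{\mathrm{as}}(d)=\sqrt{2g(0,0)\log d}$ and $E_\varphi^{\ge h}=\{x:\varphi_x\ge h\}$. Identify $\mathbb{Z}^2$ with $\mathbb{Z}^2\times\{0\}^{d-2}\subset\mathbb{Z}^d$, and set $\mathbb{H}_x=2x+\{0,1\}^d$ for $x\in\mathbb{Z}^2$. For $C\subset\mathbb{H}_x$, $\overline{C}^{\mathbb{H}_x}$ is the set of points of $\mathbb{H}_x$ in $C$ or at $\ell^1$-distance $1$ from $C$. For $h\in\mathbb{R}$, $G^h_0$ is the event that for every $x'\in\mathbb{Z}^2$ with $|x'|_1\le1$, $\mathbb{H}_{x'}\cap E_\varphi^{\ge h}$ contains a nearest-neighbour connected component $C_{x'}$ with $|\overline{C_{x'}}^{\mathbb{H}_{x'}}|\ge(1-d^{-2})|\mathbb{H}_{x'}|$, and the sets $C_{x'}$, $|x'|_1\le1$, are connected to each other by nearest-neighbour paths inside $E_\varphi^{\ge h}\cap\bigcup_{|x'|_1\le1}\mathbb{H}_{x'}$. *)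

theory Defs
  imports "HOL-Probability.Probability"
begin

text \<open>Points of Z^d are functions nat => int vanishing outside {0..<d}.\<close>
definition lattice :: "nat \<Rightarrow> (nat \<Rightarrow> int) set" where
  "lattice d = {x. \<forall>i\<ge>d. x i = 0}"

definition adj :: "nat \<Rightarrow> (nat \<Rightarrow> int) \<Rightarrow> (nat \<Rightarrow> int) \<Rightarrow> bool" where
  "adj d x y \<longleftrightarrow> x \<in> lattice d \<and> y \<in> lattice d \<and> (\<Sum>i<d. \<bar>x i - y i\<bar>) = 1"

primrec srw_p :: "nat \<Rightarrow> nat \<Rightarrow> (nat \<Rightarrow> int) \<Rightarrow> (nat \<Rightarrow> int) \<Rightarrow> real" where
  "srw_p d 0 x y = (if x = y then 1 else 0)"
| "srw_p d (Suc n) x y =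
     (\<Sum>i<d. srw_p d n (x(i := x i + 1)) y + srw_p d n (x(i := x i - 1)) y) / (2 * real d)"

definition green :: "nat \<Rightarrow> (nat \<Rightarrow> int) \<Rightarrow> (nat \<Rightarrow> int) \<Rightarrow> real" where
  "green d x y = (\<Sum>n. srw_p d n x y)"

definition h_as :: "nat \<Rightarrow> real" where
  "h_as d = sqrt (2 * green d (\<lambda>_. 0) (\<lambda>_. 0) * ln (real d))"

text \<open>phi is a centered Gaussian field on Z^d with covariance g under M:
  every finite linear combination is centered Gaussian with the prescribed variance
  (characterised through its characteristic function).\<close>
definition is_GFF :: "nat \<Rightarrow> 'a measure \<Rightarrow> ((nat \<Rightarrow> int) \<Rightarrow> 'a \<Rightarrow> real) \<Rightarrow> bool" where
  "is_GFF d M \<phi> \<longleftrightarrow> prob_space M \<and> (\<forall>x\<in>lattice d. \<phi> x \<in> borel_measurable M) \<and>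
     (\<forall>S a. finite S \<and> S \<subseteq> lattice d \<longrightarrow>
        (\<forall>t::real. integral\<^sup>L M (\<lambda>\<omega>. cis (t * (\<Sum>x\<in>S. a x * \<phi> x \<omega>))) =
            complex_of_real (exp (- (t\<^sup>2 * (\<Sum>x\<in>S. \<Sum>y\<in>S. a x * a y * green d x y)) / 2))))"

definition level_set :: "nat \<Rightarrow> ((nat \<Rightarrow> int) \<Rightarrow> real) \<Rightarrow> real \<Rightarrow> (nat \<Rightarrow> int) set" where
  "level_set d f h = {x \<in> lattice d. f x \<ge> h}"

definition emb2 :: "int \<Rightarrow> int \<Rightarrow> (nat \<Rightarrow> int)" where
  "emb2 a b = (\<lambda>i. if i = 0 then a else if i = 1 then b else 0)"

definition Hbox :: "nat \<Rightarrow> (nat \<Rightarrow> int) \<Rightarrow> (nat \<Rightarrow> int) set" where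
  "Hbox d x = {y \<in> lattice d. \<forall>i<d. y i - 2 * x i \<in> {0, 1}}"

definition conn_in :: "nat \<Rightarrow> (nat \<Rightarrow> int) set \<Rightarrow> (nat \<Rightarrow> int) \<Rightarrow> (nat \<Rightarrow> int) \<Rightarrow> bool" where
  "conn_in d A u v \<longleftrightarrow> u \<in> A \<and> (\<lambda>p q. p \<in> A \<and> q \<in> A \<and> adj d p q)\<^sup>*\<^sup>* u v"

definition is_component :: "nat \<Rightarrow> (nat \<Rightarrow> int) set \<Rightarrow> (nat \<Rightarrow> int) set \<Rightarrow> bool" where
  "is_component d A C \<longleftrightarrow> C \<noteq> {} \<and> C \<subseteq> A \<and> (\<forall>u\<in>C. \<forall>v. v \<in> C \<longleftrightarrow> conn_in d A u v)"

definition closure_in :: "nat \<Rightarrow> (nat \<Rightarrow> int) set \<Rightarrow> (nat \<Rightarrow> int) set \<Rightarrow> (nat \<Rightarrow> int) set" where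
  "closure_in d H C = {y \<in> H. y \<in> C \<or> (\<exists>z\<in>C. adj d z y)}"

definition nbhd0 :: "nat \<Rightarrow> (nat \<Rightarrow> int) set" where
  "nbhd0 d = {emb2 a b | a b. \<bar>a\<bar> + \<bar>b\<bar> \<le> 1}"

definition G0 :: "nat \<Rightarrow> real \<Rightarrow> ((nat \<Rightarrow> int) \<Rightarrow> real) \<Rightarrow> bool" where
  "G0 d h f \<longleftrightarrow> (\<exists>C. (\<forall>x\<in>nbhd0 d.
        is_component d (Hbox d x \<inter> level_set d f h) (C x) \<and>
        real (card (closure_in d (Hbox d x) (C x))) \<ge> (1 - 1 / (real d)\<^sup>2) * real (card (Hbox d x))) \<and>
     (\<forall>x\<in>nbhd0 d. \<forall>x'\<in>nbhd0 d. \<exists>u\<in>C x. \<exists>v\<in>C x'.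
        conn_in d (level_set d f h \<inter> (\<Union>z\<in>nbhd0 d. Hbox d z)) u v))"

end

theory Submission
  imports Defs "HOL-Computational_Algebra.Formal_Power_Series" "HOL-Real_Asymp.Real_Asymp"
begin

text \<open>
  Conditionally on any finite set of other values, \<open>\<phi>\<^sub>x\<close> has variance at least 1, while
  \<open>g(0,0) \<le> 1 + C/d\<close>. Gram--Schmidt orthogonalisation over the \<open>5 \<cdot> 2\<^sup>d\<close> vertices
  of the boxes therefore gives \<open>\<phi>\<^sub>x = \<sigma>\<^sub>x w\<^sub>x + r\<^sub>x\<close> with independent standard normal \<open>w\<^sub>x\<close>, with \<open>\<sigma>\<^sub>x \<ge> 1\<close> and with
  \<open>Var r\<^sub>x \<le> C/d\<close>; this variance is so small that a union bound makes all \<open>r\<^sub>x\<close> negligible compared to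
  \<open>\<surd>(log d)\<close>. Hence the level set dominates Bernoulli site percolation with density at least \<open>d\<^bsup>2\<epsilon> - 1\<^esup>\<close>.

  For Bernoulli percolation, split the open set into two independent halves. In the first half each vertex of a box has,
  up to probability \<open>exp (- c d\<^sup>\<epsilon>)\<close>, a neighbour in a cluster of size at least \<open>d\<^bsup>10\<^esup>\<close>, found along a regular tree.
  So by Markov's inequality most vertices do. For every splitting of these large clusters into two
  families that both are adjacent to many vertices, canonical paths in the hypercube give about \<open>2\<^sup>d/d\<^sup>6\<close>
  disjoint edges which would join the families if opened. As there are at most \<open>2\<^sup>d/d\<^bsup>10\<^esup>\<close> large clusters, a union
  bound over all splittings shows that the second half joins almost all of them; the same argument joins adjacent boxes.
\<close>

section \<open>The Green function in high dimension\<close>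

text \<open>For large d the level \<open>h_as d * (1 - 8 * \<epsilon>)\<close> leaves an open
  density of at least d^(2\<epsilon> - 1), so a vertex has on average at least d^(2\<epsilon>) open
  neighbours in its box. A tree of fixed depth spends about d^(1 - \<epsilon>) coordinates on each
  of its d^\<epsilon> branches; a branch fails with probability exp(-c d^\<epsilon>), which is the
  source of the error in the theorem. The other two errors are at most exp(-d). For the residuals, a
  union over 5 2^d vertices competes with exp(-b d log d), and it is the 1/d in the variance that
  wins. For sprinkling, the number of splittings is at most 2 to a power of order 2^d/d^10, while
  one splitting fails with probability exp(-c 2^d/d^8), because the second density is at least 1/d
  and there are about 2^d/d^6 disjoint bridges; hence clusters of size d^10. The obstacle is that a
  component must see all but a fraction 1/d^2 of its box, so the expansion estimate has to work for
  sets of density of order 1/d^2, with some vertices seen by no large cluster at all. Counting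
  canonical paths tolerates such holes at a polynomial price.\<close>

primrec srw1 :: "nat \<Rightarrow> int \<Rightarrow> real" where
  "srw1 0 k = (if k = 0 then 1 else 0)"
| "srw1 (Suc n) k = (srw1 n (k + 1) + srw1 n (k - 1)) / 2"

text \<open>As a power series this is the modified Bessel function \<open>I_k\<close>. The
  exponential normalisation turns the interleaving of steps in different coordinates into
  multiplication.\<close>

definition srw1_egf :: "int \<Rightarrow> real fps" where
  "srw1_egf k = Abs_fps (\<lambda>n. srw1 n k / fact n)"

lemma srw1_nonneg: "srw1 n k \<ge> 0"
  by (induction n arbitrary: k) auto

lemma srw1_minus: "srw1 n (- k) = srw1 n k"
proof (induction n arbitrary: k)
  case (Suc n)
  have "srw1 n (- k + 1) = srw1 n (k - 1)" "srw1 n (- k - 1) = srw1 n (k + 1)"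
    using Suc[of "k - 1"] Suc[of "k + 1"] by (simp_all add: uminus_add_conv_diff)
  then show ?case by simp
qed auto

lemma srw1_odd: "odd (int n + k) \<Longrightarrow> srw1 n k = 0"
  by (induction n arbitrary: k) auto

lemma srw1_below: "k < - int n \<Longrightarrow> srw1 n k = 0"
  by (induction n arbitrary: k) auto

lemma srw1_binomial: "srw1 n (2 * int j - int n) = real (n choose j) / 2 ^ n"
proof (induction n arbitrary: j)
  case 0
  then show ?case by (cases j) auto
next
  case (Suc n)
  show ?case
  proof (cases j)
    case 0
    have "srw1 n (- 1 - int n - 1) = 0" by (rule srw1_below) auto
    moreover have "srw1 n (- int n) = 1 / 2 ^ n" using Suc[of 0] by simp
    ultimately show ?thesis using 0 by simp
  next
    case (Suc i)
    have "srw1 n (2 * int j - int (Suc n) + 1) = real (n choose j) / 2 ^ n"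
      using Suc.IH[of j] by (simp add: algebra_simps)
    moreover have "srw1 n (2 * int j - int (Suc n) - 1) = real (n choose i) / 2 ^ n"
      using Suc.IH[of i] Suc by (simp add: algebra_simps)
    ultimately show ?thesis using Suc by (simp add: add_divide_distrib)
  qed
qed

section \<open>Central binomial coefficients and the local bound in one dimension\<close>

text \<open>The central coefficient grows by the factor \<open>2(2j+1)/(j+1)\<close>, and the
  induction closes because \<open>(2j+1)(2j+3) \<le> (2j+2)^2\<close>.\<close>

lemma central_binomial_sq_bound: "(real ((2 * j) choose j))\<^sup>2 * (2 * real j + 1) \<le> (4 ^ j)\<^sup>2"
proof (induction j)
  case (Suc j)
  have "real (Suc j) * real ((2 * Suc j) choose (Suc j)) = 2 * (2 * real j + 1) * real ((2 * j) choose j)"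
  proof -
    have "real (Suc j) * real ((2 * Suc j) choose (Suc j)) = real ((Suc j) * (Suc (2*j+1) choose (Suc j)))"
      by (simp del: binomial_Suc_Suc add: algebra_simps)
    also have "\<dots> = real ((2 * j + 2) * ((2*j+1) choose j))"
      by (subst Suc_times_binomial) simp
    also have "(2*j+1) choose j = (2*j+1) choose (Suc j)"
      by (subst binomial_symmetric) (auto simp: numeral_2_eq_2)
    finally have 1: "real (Suc j) * real ((2 * Suc j) choose (Suc j))
        = (2 * real j + 2) * real ((2*j+1) choose (Suc j))"
      by (simp only: of_nat_mult) simp
    have "real (Suc j) * real (Suc (2*j) choose (Suc j)) = real (Suc (2*j)) * real ((2*j) choose j)"
      by (metis Suc_times_binomial_eq mult.commute of_nat_mult)
    then show ?thesis using 1 by (simp add: algebra_simps del: binomial_Suc_Suc)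
  qed
  then have e: "real ((2 * Suc j) choose (Suc j)) = 2 * (2 * real j + 1) / (real j + 1) * real ((2 * j) choose j)"
    by (simp add: field_simps)
  define c where "c = real ((2 * j) choose j)"
  have "(real ((2 * Suc j) choose (Suc j)))\<^sup>2 * (2 * real (Suc j) + 1)
     = (c\<^sup>2 * (2 * real j + 1)) * (4 * (2 * real j + 1) * (2 * real j + 3) / (real j + 1)\<^sup>2)"
    unfolding e c_def[symmetric] by (simp add: power2_eq_square field_simps)
  also have "\<dots> \<le> (4 ^ j)\<^sup>2 * 16"
  proof (rule mult_mono)
    show "c\<^sup>2 * (2 * real j + 1) \<le> (4 ^ j)\<^sup>2" using Suc c_def by simp
    show "4 * (2 * real j + 1) * (2 * real j + 3) / (real j + 1)\<^sup>2 \<le> 16"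
      by (simp add: power2_eq_square divide_simps) (simp add: algebra_simps)
  qed auto
  also have "\<dots> = (4 ^ Suc j)\<^sup>2" by (simp add: power2_eq_square)
  finally show ?case .
qed auto

text \<open>The middle coefficient is the largest. For odd \<open>n\<close> it is half of the next
  central coefficient, so that only \<open>n + 2\<close> has to be replaced by
  \<open>n + 1\<close>.\<close>

lemma binomial_sqrt_bound: "real (n choose j) / 2 ^ n \<le> 1 / sqrt (real n + 1)"
proof -
  have ev: "real ((2 * i) choose i) / 4 ^ i \<le> 1 / sqrt (2 * real i + 1)" for i
  proof -
    have "sqrt ((real ((2 * i) choose i))\<^sup>2 * (2 * real i + 1)) \<le> sqrt ((4 ^ i)\<^sup>2)"
      using central_binomial_sq_bound[of i] by (rule real_sqrt_le_mono)
    then have "real ((2 * i) choose i) * sqrt (2 * real i + 1) \<le> 4 ^ i"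
      by (simp add: real_sqrt_mult)
    then show ?thesis by (simp add: field_simps)
  qed
  have "real (n choose j) / 2 ^ n \<le> real (n choose (n div 2)) / 2 ^ n"
    by (intro divide_right_mono) (auto intro: binomial_maximum)
  also have "\<dots> \<le> 1 / sqrt (real n + 1)"
  proof (cases "even n")
    case True
    then obtain i where "n = 2 * i" by blast
    then show ?thesis using ev[of i] by (simp add: power_mult)
  next
    case False
    then obtain i where i: "n = 2 * i + 1" by (metis oddE)
    have "(2*i+1) choose i = (2*i+1) choose (Suc i)"
      by (subst binomial_symmetric) (auto simp: numeral_2_eq_2)
    then have "real ((2 * Suc i) choose (Suc i)) = 2 * real (n choose i)"
      using i by simp
    then have "real (n choose (n div 2)) / 2 ^ n = real ((2 * Suc i) choose (Suc i)) / 4 ^ (Suc i)"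
      using i by (simp add: power_mult)
    also have "\<dots> \<le> 1 / sqrt (2 * real (Suc i) + 1)" by (rule ev)
    also have "\<dots> \<le> 1 / sqrt (real n + 1)" using i by (auto intro!: divide_left_mono)
    finally show ?thesis .
  qed
  finally show ?thesis .
qed

lemma srw1_le: "srw1 n k \<le> 1 / sqrt (real n + 1)"
proof (cases "odd (int n + k) \<or> k < - int n")
  case True
  then show ?thesis using srw1_odd srw1_below by fastforce
next
  case False
  then obtain j where "int n + k = 2 * j" by blast
  with False have "k = 2 * int (nat j) - int n" by auto
  then show ?thesis using srw1_binomial[of n "nat j"] binomial_sqrt_bound[of n "nat j"] by simp
qed

lemma srw1_zero_even: "srw1 (2 * j) 0 / fact (2 * j) = (1 / 4) ^ j / (fact j * fact j)"
proof -
  have "srw1 (2 * j) 0 = real ((2 * j) choose j) / 4 ^ j"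
    using srw1_binomial[of "2 * j" j] by (simp add: power_mult)
  moreover have "real ((2 * j) choose j) = fact (2 * j) / (fact j * fact j)"
    by (subst binomial_fact) (auto simp: mult_2)
  ultimately show ?thesis by (simp add: power_one_over)
qed

section \<open>Exponential generating functions of the walk\<close>

lemma fps_deriv_srw1_egf:
  "fps_deriv (srw1_egf k) = fps_const (1 / 2) * (srw1_egf (k + 1) + srw1_egf (k - 1))"
proof (rule fps_ext)
  fix n
  have "(real n + 1) * (c / ((real n + 1) * f)) = c / f" for c f :: real
    by simp
  from this[of "(srw1 n (k + 1) + srw1 n (k - 1)) / 2" "fact n"] show "fps_nth (fps_deriv (srw1_egf k)) n
      = fps_nth (fps_const (1 / 2) * (srw1_egf (k + 1) + srw1_egf (k - 1))) n"
    by (simp add: srw1_egf_def add_divide_distrib add.commute)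
qed

lemma fps_deriv_prod_lessThan:
  fixes f :: "nat \<Rightarrow> real fps"
  shows "fps_deriv (\<Prod>i<d. f i) = (\<Sum>i<d. fps_deriv (f i) * (\<Prod>j\<in>{..<d} - {i}. f j))"
proof (induction d)
  case (Suc d)
  have "(\<Prod>j\<in>{..<Suc d} - {i}. f j) = f d * (\<Prod>j\<in>{..<d} - {i}. f j)" if "i < d" for i
  proof -
    have "{..<Suc d} - {i} = insert d ({..<d} - {i})" using that by auto
    then show ?thesis by simp
  qed
  moreover have "{..<Suc d} - {d} = {..<d}" by auto
  ultimately show ?case using Suc
    by (simp add: sum_distrib_left sum_distrib_right algebra_simps)
qed simp

text \<open>Poissonisation: in exponential generating functions the coordinates of the walk decouple.\<close>

lemma srw_p_eq_fps_nth:
  assumes "y \<in> lattice d"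
  shows "x \<in> lattice d \<Longrightarrow> srw_p d n x y = fact n / real d ^ n * fps_nth (\<Prod>i<d. srw1_egf (x i - y i)) n"
proof (induction n arbitrary: x)
  case 0
  have "fps_nth (\<Prod>i<d. srw1_egf (x i - y i)) 0 = (\<Prod>i<d. if x i = y i then 1 else 0)"
    by (induction d) (auto simp: srw1_egf_def)
  also have "\<dots> = (if x = y then 1 else 0)"
  proof (cases "x = y")
    case False
    then obtain i where i: "x i \<noteq> y i" by blast
    then have "i < d" using 0 assms unfolding lattice_def by (metis (mono_tags) mem_Collect_eq not_le)
    then show ?thesis using i False by (auto intro!: prod_zero)
  qed auto
  finally show ?case by simp
next
  case (Suc n)
  define P where "P z = (\<Prod>i<d. srw1_egf (z i - y i))" for z
  have split: "P (x(i := a)) = srw1_egf (a - y i) * (\<Prod>j\<in>{..<d} - {i}. srw1_egf (x j - y j))"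
    if "i < d" for i a
    unfolding P_def using that by (subst prod.remove[of _ i]) (auto intro!: prod.cong)
  have IH: "srw_p d n (x(i := a)) y = fact n / real d ^ n * fps_nth (P (x(i := a))) n" if "i < d" for i a
    unfolding P_def by (rule Suc.IH) (use Suc.prems that in \<open>auto simp: lattice_def\<close>)
  \<comment> \<open>Leibniz rule: differentiating the factor of coordinate \<open>i\<close> averages
    its two shifts, which is one step of the walk in that coordinate.\<close>
  have "fps_deriv (P x) = (\<Sum>i<d. fps_const (1/2) * (P (x(i := x i + 1)) + P (x(i := x i - 1))))"
    unfolding P_def[of x] fps_deriv_prod_lessThan
    by (intro sum.cong refl) (simp add: fps_deriv_srw1_egf split algebra_simps)
  then have "fps_nth (fps_deriv (P x)) n
      = (\<Sum>i<d. (fps_nth (P (x(i := x i + 1))) n + fps_nth (P (x(i := x i - 1))) n) / 2)"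
    by (simp add: fps_sum_nth)
  then have "(real n + 1) * fps_nth (P x) (Suc n)
      = (\<Sum>i<d. fps_nth (P (x(i := x i + 1))) n + fps_nth (P (x(i := x i - 1))) n) / 2"
    by (simp add: sum_divide_distrib add.commute)
  then have S: "(\<Sum>i<d. fps_nth (P (x(i := x i + 1))) n + fps_nth (P (x(i := x i - 1))) n)
      = 2 * (real n + 1) * fps_nth (P x) (Suc n)" by (simp add: algebra_simps)
  have "srw_p d (Suc n) x y
      = (\<Sum>i<d. fact n / real d ^ n * (fps_nth (P (x(i := x i + 1))) n + fps_nth (P (x(i := x i - 1))) n)) / (2 * real d)"
    by (simp add: IH algebra_simps)
  also have "\<dots> = fact n / real d ^ n * (2 * (real n + 1) * fps_nth (P x) (Suc n)) / (2 * real d)"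
    by (simp only: sum_distrib_left[symmetric] S)
  also have "\<dots> = fact (Suc n) / real d ^ Suc n * fps_nth (P x) (Suc n)"
  proof -
    have "f / D * (2 * m * g) / (2 * c) = m * f / (c * D) * g" for f D m g c :: real
      by (simp add: mult_ac)
    moreover have "fact (Suc n) / real d ^ Suc n = (real n + 1) * fact n / (real d * real d ^ n)"
      by (simp add: add.commute)
    ultimately show ?thesis by presburger
  qed
  finally show ?case by (simp add: P_def)
qed

lemma srw_p_nonneg: "srw_p d n x y \<ge> 0"
  by (induction n arbitrary: x) (auto intro!: divide_nonneg_nonneg sum_nonneg add_nonneg_nonneg)

lemma srw_p_sym:
  assumes "x \<in> lattice d" "y \<in> lattice d"
  shows "srw_p d n x y = srw_p d n y x"
proof -
  have "srw1_egf (x i - y i) = srw1_egf (y i - x i)" for i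
    unfolding srw1_egf_def using srw1_minus[of _ "x i - y i"] by simp
  then show ?thesis using assms by (simp add: srw_p_eq_fps_nth)
qed

section \<open>Coefficient bounds for products of nonnegative power series\<close>

text \<open>The triangle of index pairs in a truncated Cauchy product lies in a square, so truncated
  sums with nonnegative terms are submultiplicative. Working with truncations evaluated at
  \<open>t\<close> replaces a discussion of convergence.\<close>

lemma fps_prod_partial_sum_le:
  fixes f :: "nat \<Rightarrow> real fps" and t c :: real
  assumes "\<And>i n. fps_nth (f i) n \<ge> 0" and "t \<ge> 0"
    and "\<And>i N. (\<Sum>n\<le>N. fps_nth (f i) n * t ^ n) \<le> c"
  shows "(\<forall>n. fps_nth (\<Prod>i<d. f i) n \<ge> 0) \<and> (\<forall>N. (\<Sum>n\<le>N. fps_nth (\<Prod>i<d. f i) n * t ^ n) \<le> c ^ d)"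
proof (induction d)
  case 0
  have "(\<Sum>n\<le>N. fps_nth 1 n * t ^ n) \<le> 1" for N
  proof -
    have "(\<Sum>n\<le>N. fps_nth 1 n * t ^ n) = (\<Sum>n\<le>N. if n = 0 then 1 else 0)"
      by (intro sum.cong) auto
    then show ?thesis by simp
  qed
  then show ?case by simp
next
  case (Suc d)
  define g where "g = (\<Prod>i<d. f i)"
  have g: "fps_nth g n \<ge> 0" "(\<Sum>n\<le>N. fps_nth g n * t ^ n) \<le> c ^ d" for n N
    using Suc by (auto simp: g_def)
  have c: "c \<ge> 0"
    using assms(3)[where N = 0] assms(1)[of undefined 0] by (auto intro: order_trans)
  have "(\<Sum>n\<le>N. fps_nth (g * f d) n * t ^ n) \<le> c ^ Suc d" for N
  proof -
    let ?a = "\<lambda>i j. (fps_nth g i * t ^ i) * (fps_nth (f d) j * t ^ j)"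
    have "(\<Sum>n\<le>N. fps_nth (g * f d) n * t ^ n) = (\<Sum>n\<le>N. \<Sum>i\<le>n. ?a i (n - i))"
      by (intro sum.cong refl)
        (auto simp: fps_mult_nth sum_distrib_right atLeast0AtMost power_add[symmetric] mult.assoc mult.left_commute
          intro!: sum.cong)
    also have "\<dots> = (\<Sum>(i, j)\<in>{(i, j). i + j \<le> N}. ?a i j)"
      by (rule sum.triangle_reindex_eq[symmetric])
    also have "\<dots> \<le> (\<Sum>(i, j)\<in>{..N} \<times> {..N}. ?a i j)"
      by (rule sum_mono2) (use g assms in \<open>auto intro!: mult_nonneg_nonneg\<close>)
    also have "\<dots> = (\<Sum>i\<le>N. fps_nth g i * t ^ i) * (\<Sum>j\<le>N. fps_nth (f d) j * t ^ j)"
      by (simp add: sum_product sum.cartesian_product)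
    also have "\<dots> \<le> c ^ d * c"
      by (intro mult_mono g assms c zero_le_power sum_nonneg mult_nonneg_nonneg)
    finally show ?thesis by (simp add: mult.commute)
  qed
  moreover have "fps_nth (g * f d) n \<ge> 0" for n
    by (auto simp: fps_mult_nth intro!: sum_nonneg mult_nonneg_nonneg g assms)
  ultimately show ?case by (simp add: g_def[symmetric])
qed

text \<open>The saddle-point bound \<open>[x^n] F \<le> F(t) / t^n\<close>. The two time regimes of
  the walk differ in the choice of \<open>t\<close> and in the bound used for each factor.\<close>

lemma fps_prod_nth_le:
  fixes f :: "nat \<Rightarrow> real fps" and t c :: real
  assumes "\<And>i n. fps_nth (f i) n \<ge> 0" and "t \<ge> 0"
    and "\<And>i N. (\<Sum>n\<le>N. fps_nth (f i) n * t ^ n) \<le> c"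
  shows "fps_nth (\<Prod>i<d. f i) n * t ^ n \<le> c ^ d"
proof -
  note * = fps_prod_partial_sum_le[of f t c d, OF assms]
  have "fps_nth (\<Prod>i<d. f i) n * t ^ n \<le> (\<Sum>n\<le>n. fps_nth (\<Prod>i<d. f i) n * t ^ n)"
    by (rule member_le_sum) (use * assms(2) in auto)
  also have "\<dots> \<le> c ^ d" using * by blast
  finally show ?thesis .
qed

lemma exp_partial_sum_le:
  fixes x :: real
  assumes "x \<ge> 0"
  shows "(\<Sum>n\<le>N. x ^ n / fact n) \<le> exp x"
proof -
  have s: "(\<lambda>n. x ^ n / fact n) sums exp x"
    using exp_converges[of x] by (simp add: field_simps)
  have "(\<Sum>n\<in>{..N}. x ^ n / fact n) \<le> (\<Sum>n. x ^ n / fact n)"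
    by (rule sum_le_suminf) (use s assms in \<open>auto simp: sums_iff\<close>)
  then show ?thesis using s by (simp add: sums_iff)
qed

text \<open>The right-hand side has the order of \<open>I_0(t)\<close> for large \<open>t\<close>.
  The coefficient bound \<open>1 / sqrt (n + 1)\<close> is linearised by the arithmetic-geometric
  mean inequality, after which \<open>1 / (n + 1)\<close> merges into the factorial.\<close>

lemma srw1_egf_partial_sum_le:
  assumes "t > 0"
  shows "(\<Sum>n\<le>N. fps_nth (srw1_egf k) n * t ^ n) \<le> exp t / sqrt t"
proof -
  \<comment> \<open>Under the weights \<open>t^n / n!\<close> the index \<open>n\<close>
    concentrates around \<open>t\<close>, so this is the balanced parameter of the
    inequality.\<close>
  define a where "a = 1 / sqrt t"
  have a: "a > 0" using assms by (simp add: a_def)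
  have amgm: "1 / sqrt (real n + 1) \<le> (a + 1 / (a * (real n + 1))) / 2" for n
  proof -
    define b where "b = sqrt (real n + 1)"
    have b: "b > 0" "b\<^sup>2 = real n + 1" by (auto simp: b_def)
    have "2 * (a * b) \<le> (a * b)\<^sup>2 + 1" using sum_squares_bound[of "a * b" 1] by simp
    then have "2 * (a * b) / (a * b\<^sup>2) \<le> ((a * b)\<^sup>2 + 1) / (a * b\<^sup>2)"
      using a b by (intro divide_right_mono) auto
    moreover have "2 * (a * b) / (a * b\<^sup>2) = 2 / b" using a b(1) by (simp add: power2_eq_square)
    moreover have "((a * b)\<^sup>2 + 1) / (a * b\<^sup>2) = a + 1 / (a * b\<^sup>2)"
      using a b(1) by (simp add: power2_eq_square add_divide_distrib)
    ultimately have "2 / b \<le> a + 1 / (a * b\<^sup>2)" by simp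
    then show ?thesis using b by (simp add: b_def)
  qed
  have "(\<Sum>n\<le>N. fps_nth (srw1_egf k) n * t ^ n) \<le> (\<Sum>n\<le>N. ((a + 1 / (a * (real n + 1))) / 2) / fact n * t ^ n)"
    unfolding srw1_egf_def using assms
    by (intro sum_mono mult_right_mono)
      (auto simp del: divide_divide_eq_left intro!: divide_right_mono order_trans[OF srw1_le amgm])
  also have "\<dots> = a / 2 * (\<Sum>n\<le>N. t ^ n / fact n) + 1 / (2 * a * t) * (\<Sum>n\<le>N. t ^ Suc n / fact (Suc n))"
    unfolding sum_distrib_left sum.distrib[symmetric]
  proof (intro sum.cong refl)
    fix n
    have "(a + 1 / (a * m)) / 2 / f * u = a / 2 * (u / f) + 1 / (2 * a * t) * (t * u / (m * f))" for m f u
      using a assms by (simp add: add_divide_distrib distrib_right)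
    from this[of "real n + 1" "fact n" "t ^ n"]
    show "(a + 1 / (a * (real n + 1))) / 2 / fact n * t ^ n
        = a / 2 * (t ^ n / fact n) + 1 / (2 * a * t) * (t ^ Suc n / fact (Suc n))"
      by (simp add: algebra_simps)
  qed
  also have "\<dots> \<le> a / 2 * exp t + 1 / (2 * a * t) * exp t"
  proof (intro add_mono mult_left_mono exp_partial_sum_le)
    have "(\<Sum>n\<le>N. t ^ Suc n / fact (Suc n)) \<le> (\<Sum>n\<le>Suc N. t ^ n / fact n)"
      by (subst sum.atMost_Suc_shift) auto
    also have "\<dots> \<le> exp t" using assms by (intro exp_partial_sum_le) auto
    finally show "(\<Sum>n\<le>N. t ^ Suc n / fact (Suc n)) \<le> exp t" .
  qed (use a assms in auto)
  also have "\<dots> = exp t / sqrt t"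
    using assms by (simp add: a_def field_simps)
  finally show ?thesis .
qed

text \<open>For small \<open>t\<close> the bound \<open>e^t / sqrt t\<close> is too weak. Here the
  even coefficients contribute \<open>(t^2/4)^j / (j!)^2\<close>, and dropping one factorial leaves
  a bound that tends to 1 with \<open>t\<close> tending to 0.\<close>

lemma srw1_egf_zero_partial_sum_le:
  assumes "t \<ge> 0"
  shows "(\<Sum>n\<le>N. fps_nth (srw1_egf 0) n * t ^ n) \<le> exp (t\<^sup>2 / 4)"
proof -
  have "(\<Sum>n\<le>N. fps_nth (srw1_egf 0) n * t ^ n) \<le> (\<Sum>n\<le>2 * N + 1. fps_nth (srw1_egf 0) n * t ^ n)"
    by (rule sum_mono2) (use assms srw1_nonneg in \<open>auto simp: srw1_egf_def\<close>)
  also have "\<dots> = (\<Sum>j\<le>N. fps_nth (srw1_egf 0) (2 * j) * t ^ (2 * j))"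
  proof (induction N)
    case (Suc N)
    have "srw1 (Suc (Suc (Suc (2 * N)))) 0 = 0" by (rule srw1_odd) auto
    then show ?case using Suc by (simp add: srw1_egf_def del: srw1.simps)
  qed (auto simp: srw1_egf_def)
  also have "\<dots> \<le> (\<Sum>j\<le>N. (t\<^sup>2 / 4) ^ j / fact j)"
  proof (rule sum_mono)
    fix j
    have "fps_nth (srw1_egf 0) (2 * j) * t ^ (2 * j) = (t\<^sup>2 / 4) ^ j / fact j * (1 / fact j)"
      using srw1_zero_even[of j] unfolding srw1_egf_def
      by (simp add: power_mult power_divide)
    also have "\<dots> \<le> (t\<^sup>2 / 4) ^ j / fact j * 1"
      by (intro mult_left_mono) (auto simp: fact_ge_1)
    finally show "fps_nth (srw1_egf 0) (2 * j) * t ^ (2 * j) \<le> (t\<^sup>2 / 4) ^ j / fact j" by simp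
  qed
  also have "\<dots> \<le> exp (t\<^sup>2 / 4)" by (intro exp_partial_sum_le) auto
  finally show ?thesis .
qed

text \<open>Stirling's upper bound \<open>n! \<le> e n (n/e)^n\<close>; the induction step is
  \<open>(1 + 1/n)^(n+1) \<ge> e\<close>.\<close>

lemma fact_exp_le: "n \<ge> 1 \<Longrightarrow> fact n * exp (real n) \<le> exp 1 * real n ^ (n + 1)"
proof (induction n rule: dec_induct)
  case (step n)
  have n: "real n > 0" using step by simp
  have "1 / (real n + 1) \<le> ln (1 + 1 / real n)"
    using ln_le_minus_one[of "real n / (real n + 1)"] n
    by (simp add: ln_div field_simps)
  then have "1 \<le> (real n + 1) * ln (1 + 1 / real n)" by (simp add: field_simps)
  then have "exp 1 \<le> exp ((real n + 1) * ln (1 + 1 / real n))" by simp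
  also have "\<dots> = (1 + 1 / real n) ^ (n + 1)"
    using n by (subst exp_of_nat_mult[of "n+1", simplified of_nat_add of_nat_1]) (auto simp: add_pos_pos)
  also have "1 + 1 / real n = (real n + 1) / real n" using n by (simp add: field_simps)
  also have "\<dots> ^ (n + 1) = (real n + 1) ^ (n + 1) / real n ^ (n + 1)" by (rule power_divide)
  finally have e: "exp 1 * real n ^ (n + 1) \<le> (real n + 1) ^ (n + 1)"
    using n by (simp add: pos_le_divide_eq)
  have "fact (Suc n) * exp (real (Suc n)) = (real n + 1) * exp 1 * (fact n * exp (real n))"
    by (simp add: exp_add algebra_simps)
  also have "\<dots> \<le> (real n + 1) * exp 1 * (exp 1 * real n ^ (n + 1))"
    using step by (intro mult_left_mono) auto
  also have "\<dots> \<le> (real n + 1) * exp 1 * ((real n + 1) ^ (n + 1))"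
    using e by (intro mult_left_mono) auto
  also have "\<dots> = exp 1 * real (Suc n) ^ (Suc n + 1)" by (simp add: algebra_simps)
  finally show ?case .
qed simp

section \<open>Transition probabilities at long and at short times\<close>

text \<open>The choice \<open>t = n / d\<close> cancels \<open>e^n\<close> against Stirling's
  formula. The decay \<open>(d/n)^(d/2)\<close> is effective for times beyond a multiple of
  \<open>d\<close>.\<close>

lemma srw_p_le:
  assumes "x \<in> lattice d" "y \<in> lattice d" "d \<ge> 1" "n \<ge> 1"
  shows "srw_p d n x y \<le> exp 1 * real n * sqrt (real d / real n) ^ d"
proof -
  define t where "t = real n / real d"
  have t: "t > 0" using assms by (simp add: t_def)
  have "fps_nth (\<Prod>i<d. srw1_egf (x i - y i)) n * t ^ n \<le> (exp t / sqrt t) ^ d"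
    using t srw1_nonneg
    by (intro fps_prod_nth_le srw1_egf_partial_sum_le) (auto simp: srw1_egf_def)
  also have "\<dots> = exp (real n) * sqrt (real d / real n) ^ d"
    using assms by (simp add: power_divide exp_of_nat_mult[symmetric] t_def real_sqrt_divide field_simps)
  finally have "fact n / real n ^ n * (fps_nth (\<Prod>i<d. srw1_egf (x i - y i)) n * t ^ n)
      \<le> fact n / real n ^ n * (exp (real n) * sqrt (real d / real n) ^ d)"
    by (intro mult_left_mono) auto
  moreover have "srw_p d n x y = fact n / real n ^ n * (fps_nth (\<Prod>i<d. srw1_egf (x i - y i)) n * t ^ n)"
    using assms by (simp add: srw_p_eq_fps_nth t_def power_divide field_simps)
  moreover have "fact n / real n ^ n * (exp (real n) * sqrt (real d / real n) ^ d)
     \<le> exp 1 * real n * sqrt (real d / real n) ^ d"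
  proof -
    have "fact n * exp (real n) / real n ^ n \<le> exp 1 * real n"
      using fact_exp_le[OF assms(4)] assms by (simp add: field_simps)
    then have "fact n * exp (real n) / real n ^ n * sqrt (real d / real n) ^ d
        \<le> exp 1 * real n * sqrt (real d / real n) ^ d"
      by (intro mult_right_mono) auto
    then show ?thesis by simp
  qed
  ultimately show ?thesis by linarith
qed

text \<open>The choice \<open>t = sqrt (2n/d)\<close> minimises
  \<open>exp (d t^2 / 4) / t^n\<close>. The base \<open>n / (2 e d)\<close> is at most
  \<open>1/e\<close> up to time \<open>2d\<close>, which complements
  \<open>srw_p_le\<close>.\<close>

lemma srw_p_diag_le:
  assumes "x \<in> lattice d" "d \<ge> 1" "n \<ge> 1"
  shows "srw_p d n x x \<le> exp 1 * real n * sqrt (real n / (2 * exp 1 * real d)) ^ n"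
proof -
  define t where "t = sqrt (2 * real n / real d)"
  have t: "t > 0" "t\<^sup>2 = 2 * real n / real d" using assms by (auto simp: t_def)
  have "fps_nth (\<Prod>i<d. srw1_egf (x i - x i)) n * t ^ n \<le> exp (t\<^sup>2 / 4) ^ d"
    using t srw1_nonneg srw1_egf_zero_partial_sum_le[of t]
    by (intro fps_prod_nth_le) (auto simp: srw1_egf_def)
  also have "\<dots> = exp (real n / 2)"
    using assms by (simp add: exp_of_nat_mult[symmetric] t)
  also have "\<dots> = exp (1/2) ^ n" by (simp add: exp_of_nat_mult[symmetric])
  finally have 1: "fact n / real d ^ n * fps_nth (\<Prod>i<d. srw1_egf (x i - x i)) n \<le> fact n / real d ^ n * (exp (1/2) / t) ^ n"
    using t by (intro mult_left_mono) (auto simp: field_simps)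
  have "fact n \<le> exp 1 * real n * (real n / exp 1) ^ n"
    using fact_exp_le[OF assms(3)] by (simp add: power_divide exp_of_nat_mult[symmetric] field_simps)
  then have 2: "fact n / real d ^ n * (exp (1/2) / t) ^ n \<le> exp 1 * real n * (real n / exp 1) ^ n / real d ^ n * (exp (1/2) / t) ^ n"
    using t by (intro mult_right_mono divide_right_mono) auto
  have "real n / exp 1 / real d * (exp (1/2) / t) = sqrt (real n / (2 * exp 1 * real d))"
  proof (rule real_sqrt_unique[symmetric])
    have "(exp (1/2) :: real)\<^sup>2 = exp 1" by (simp add: exp_double[symmetric])
    then show "(real n / exp 1 / real d * (exp (1/2) / t))\<^sup>2 = real n / (2 * exp 1 * real d)"
      using assms t(1) unfolding power_mult_distrib power_divide t(2)
      by (simp add: power2_eq_square field_simps)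
  qed (use t in auto)
  then have "(real n / exp 1) ^ n / real d ^ n * (exp (1/2) / t) ^ n = sqrt (real n / (2 * exp 1 * real d)) ^ n"
    by (simp add: power_divide[symmetric] power_mult_distrib[symmetric])
  then have "exp 1 * real n * (real n / exp 1) ^ n / real d ^ n * (exp (1/2) / t) ^ n
      = exp 1 * real n * sqrt (real n / (2 * exp 1 * real d)) ^ n"
    by (metis (no_types, lifting) mult.assoc times_divide_eq_right)
  then show ?thesis using 1 2 srw_p_eq_fps_nth[OF assms(1) assms(1), of n] by linarith
qed

text \<open>Six of the \<open>d\<close> factors \<open>sqrt (d/n)\<close> turn the prefactor
  \<open>n\<close> into the summable \<open>1 / n^2\<close>; each of the other \<open>d - 6\<close>
  is at most \<open>1 / sqrt 2\<close>. This is the origin of the condition \<open>d \<ge> 6\<close>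
  wherever the Green series has to converge.\<close>

lemma srw_p_le_inverse_square:
  assumes "x \<in> lattice d" "y \<in> lattice d" "d \<ge> 6" "n \<ge> 2 * d"
  shows "srw_p d n x y \<le> 8 * exp 1 * real d ^ 3 * (1 / sqrt 2) ^ d * (1 / real n ^ 2)"
proof -
  define r where "r = sqrt (real d / real n)"
  have n: "real n > 0" "real n \<ge> 2 * real d" using assms by auto
  have r: "0 \<le> r" "r \<le> 1 / sqrt 2" "r ^ 2 = real d / real n"
  proof -
    have "real d / real n \<le> 1 / 2" using n by (simp add: field_simps)
    then have "r \<le> sqrt (1 / 2)" unfolding r_def by (rule real_sqrt_le_mono)
    then show "r \<le> 1 / sqrt 2" by (simp add: real_sqrt_divide)
  qed (auto simp: r_def)
  have "r ^ d = (r ^ 2) ^ 3 * r ^ (d - 6)"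
    using assms by (simp flip: power_mult power_add)
  also have "\<dots> \<le> (real d / real n) ^ 3 * (1 / sqrt 2) ^ (d - 6)"
    using r by (intro mult_mono power_mono) auto
  also have "(1 / sqrt 2) ^ (d - 6) = 8 * (1 / sqrt 2) ^ d"
  proof -
    have "(sqrt 2) ^ 6 = ((sqrt 2) ^ 2) ^ 3" by (subst power_mult[symmetric]) simp
    then have "(1 / sqrt 2) ^ 6 = (1 / 8 :: real)" by (simp add: power_one_over)
    moreover have "(1 / sqrt 2) ^ d = (1 / sqrt 2) ^ (d - 6) * (1 / sqrt 2) ^ 6"
      using assms by (simp flip: power_add)
    ultimately show ?thesis by simp
  qed
  finally have "exp 1 * real n * r ^ d \<le> exp 1 * real n * ((real d / real n) ^ 3 * (8 * (1 / sqrt 2) ^ d))"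
    by (intro mult_left_mono) auto
  also have "\<dots> = 8 * exp 1 * real d ^ 3 * (1 / sqrt 2) ^ d * (1 / real n ^ 2)"
    using n by (simp add: power_divide power3_eq_cube power2_eq_square mult_ac)
  finally show ?thesis
    using srw_p_le[of x d y n] assms unfolding r_def by auto
qed

lemma summable_srw_p:
  assumes "x \<in> lattice d" "y \<in> lattice d" "d \<ge> 6"
  shows "summable (\<lambda>n. srw_p d n x y)"
proof (rule summable_comparison_test_ev)
  show "\<forall>\<^sub>F n in sequentially. norm (srw_p d n x y) \<le> 8 * exp 1 * real d ^ 3 * (1 / sqrt 2) ^ d * (1 / real n ^ 2)"
    using eventually_ge_at_top[of "2 * d"]
    by eventually_elim (use assms srw_p_le_inverse_square srw_p_nonneg in auto)
  show "summable (\<lambda>n. 8 * exp 1 * real d ^ 3 * (1 / sqrt 2) ^ d * (1 / real n ^ 2))"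
    using inverse_power_summable[of 2, where 'a = real]
    by (intro summable_mult) (simp add: inverse_eq_divide power_one_over)
qed

section \<open>Symmetry, harmonicity and diagonal of the Green function\<close>

lemma green_sym:
  assumes "x \<in> lattice d" "y \<in> lattice d"
  shows "green d x y = green d y x"
  unfolding green_def using assms by (simp add: srw_p_sym)

lemma green_harmonic:
  assumes "x \<in> lattice d" "y \<in> lattice d" "d \<ge> 6"
  shows "green d x y = (if x = y then 1 else 0)
     + (\<Sum>i<d. green d (x(i := x i + 1)) y + green d (x(i := x i - 1)) y) / (2 * real d)"
proof -
  have L: "x(i := a) \<in> lattice d" if "i < d" for i a
    using assms that by (auto simp: lattice_def)
  note S = summable_srw_p[OF L assms(2,3)]
  have "green d x y = srw_p d 0 x y + (\<Sum>n. srw_p d (Suc n) x y)"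
    unfolding green_def using summable_srw_p[OF assms] by (subst suminf_split_head) auto
  also have "(\<Sum>n. srw_p d (Suc n) x y)
    = (\<Sum>n. (\<Sum>i<d. srw_p d n (x(i := x i + 1)) y + srw_p d n (x(i := x i - 1)) y) / (2 * real d))"
    by simp
  also have "\<dots> = (\<Sum>i<d. green d (x(i := x i + 1)) y + green d (x(i := x i - 1)) y) / (2 * real d)"
    unfolding green_def
    by (subst suminf_divide, intro summable_sum summable_add S, simp_all)
      (subst suminf_sum, auto intro!: summable_add S simp: suminf_add S)
  finally show ?thesis by simp
qed

lemma srw_p_diag_one: "x \<in> lattice d \<Longrightarrow> srw_p d 1 x x = 0"
  by (auto intro!: sum.neutral simp: fun_eq_iff fun_upd_def)

text \<open>Two of the \<open>n\<close> factors supply \<open>1/d\<close>, the others are at most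
  \<open>exp (-1/2)\<close> each. A single factor would give only \<open>1 / sqrt d\<close>, so time
  1 is treated apart: the walk cannot return then.\<close>

lemma srw_p_diag_le_decay:
  assumes "x \<in> lattice d" "1 \<le> n" "n \<le> 2 * d"
  shows "srw_p d n x x \<le> 1 / (2 * real d) * (real n ^ 2 * exp (1 - real n / 2))"
proof (cases "n = 1")
  case True
  then show ?thesis using srw_p_diag_one[OF assms(1)] by (simp del: srw_p.simps)
next
  case False
  have n: "n \<ge> 2" and d: "real d > 0" "d \<ge> 1" using assms False by auto
  define r where "r = sqrt (real n / (2 * exp 1 * real d))"
  have r: "0 \<le> r" "r \<le> exp (- 1 / 2)" "r ^ 2 = real n / (2 * exp 1 * real d)"
  proof -
    have "(exp (- 1 / 2) :: real)\<^sup>2 = exp (- 1)" by (simp add: exp_double[symmetric])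
    moreover have "real n / (2 * exp 1 * real d) \<le> exp (- 1)"
      using d assms by (simp add: exp_minus field_simps)
    ultimately show "r \<le> exp (- 1 / 2)" unfolding r_def by (intro real_le_lsqrt) auto
  qed (use d in \<open>auto simp: r_def\<close>)
  have "r ^ n = r ^ 2 * r ^ (n - 2)" using n by (metis le_add_diff_inverse power_add)
  also have "\<dots> \<le> real n / (2 * exp 1 * real d) * exp (- 1 / 2) ^ (n - 2)"
    using r by (intro mult_mono power_mono) auto
  also have "exp (- 1 / 2) ^ (n - 2) = exp (1 - real n / 2)"
    using n by (simp add: exp_of_nat_mult[symmetric] of_nat_diff) (simp add: field_simps)
  finally have "exp 1 * real n * r ^ n \<le> exp 1 * real n * (real n / (2 * exp 1 * real d) * exp (1 - real n / 2))"
    by (intro mult_left_mono) auto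
  also have "\<dots> = 1 / (2 * real d) * (real n ^ 2 * exp (1 - real n / 2))"
    using d by (simp add: power2_eq_square)
  finally show ?thesis
    using srw_p_diag_le[OF assms(1) d(2) assms(2)] unfolding r_def by linarith
qed

text \<open>Time 0 contributes exactly 1, times up to \<open>2d\<close> a convergent series divided
  by \<open>d\<close>, and later times a power of \<open>d\<close> times
  \<open>2^(-d/2)\<close>.\<close>

lemma green_diag_bound:
  "\<exists>C > 0. \<forall>\<^sub>F d in sequentially. \<forall>x \<in> lattice d. green d x x \<le> 1 + C / real d"
proof -
  define a where "a n = real n ^ 2 * exp (1 - real n / 2)" for n :: nat
  define b where "b n = 1 / real n ^ 2" for n :: nat
  have b: "summable b"
    unfolding b_def using inverse_power_summable[of 2, where 'a = real]
    by (simp add: inverse_eq_divide power_one_over)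
  have a: "summable a"
  proof (rule summable_comparison_test_ev[OF _ b])
    have "\<forall>\<^sub>F n::nat in sequentially. real n ^ 2 * exp (1 - real n / 2) \<le> 1 / real n ^ 2" by real_asymp
    then show "\<forall>\<^sub>F n in sequentially. norm (a n) \<le> b n"
      unfolding a_def b_def by eventually_elim simp
  qed
  have pos: "suminf a \<ge> 0" "suminf b \<ge> 0"
    by (auto intro!: suminf_nonneg a b simp: a_def b_def)
  define K where "K d = 8 * exp 1 * real d ^ 3 * (1 / sqrt 2) ^ d" for d :: nat
  define B where "B = suminf b + 1"
  have "((\<lambda>d::nat. real d * (8 * exp 1 * real d ^ 3 * (1 / sqrt 2) ^ d)) \<longlongrightarrow> 0) sequentially"
    by real_asymp
  then have "\<forall>\<^sub>F d in sequentially. real d * K d < 1 / B"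
    unfolding K_def using pos by (intro order_tendstoD(2)) (auto simp: B_def)
  then have "\<forall>\<^sub>F d in sequentially. \<forall>x \<in> lattice d. green d x x \<le> 1 + (suminf a / 2 + 1) / real d"
    using eventually_ge_at_top[of 6]
  proof eventually_elim
    case (elim d)
    have K: "K d * suminf b \<le> 1 / real d"
    proof -
      have "K d * suminf b \<le> K d * B" unfolding K_def B_def by (intro mult_left_mono) auto
      also have "\<dots> \<le> 1 / real d" using elim pos by (simp add: B_def field_simps)
      finally show ?thesis .
    qed
    show ?case
    proof
      fix x assume x: "x \<in> lattice d"
      define e where "e n = (if n = 0 then 1 else 0 :: real)" for n :: nat
      have e: "e sums 1" unfolding e_def using sums_single[of 0 "\<lambda>_. 1::real"] by simp
      have le: "srw_p d n x x \<le> e n + 1 / (2 * real d) * a n + K d * b n" for n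
      proof -
        consider "n = 0" | "1 \<le> n" "n \<le> 2 * d" | "n \<ge> 2 * d" by linarith
        then show ?thesis
        proof cases
          case 2
          then have "srw_p d n x x \<le> 1 / (2 * real d) * a n"
            using srw_p_diag_le_decay[OF x] by (auto simp: a_def)
          moreover have "e n + K d * b n \<ge> 0" by (auto simp: e_def K_def b_def)
          ultimately show ?thesis by linarith
        next
          case 3
          then have "srw_p d n x x \<le> K d * b n"
            using srw_p_le_inverse_square[OF x x] elim by (auto simp: K_def b_def)
          moreover have "e n + 1 / (2 * real d) * a n \<ge> 0" by (auto simp: e_def a_def)
          ultimately show ?thesis by linarith
        qed (auto simp: e_def a_def b_def)
      qed
      have "(\<lambda>n. e n + 1 / (2 * real d) * a n + K d * b n) sums (1 + 1 / (2 * real d) * suminf a + K d * suminf b)"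
        by (intro sums_add sums_mult e summable_sums a b)
      then have "green d x x \<le> 1 + 1 / (2 * real d) * suminf a + K d * suminf b"
        unfolding green_def using le elim
        by (intro sums_le[OF _ summable_sums[OF summable_srw_p[OF x x]]]) auto
      also have "\<dots> \<le> 1 + 1 / (2 * real d) * suminf a + 1 / real d" using K by simp
      also have "\<dots> = 1 + (suminf a / 2 + 1) / real d" by (simp add: add_divide_distrib)
      finally show "green d x x \<le> 1 + (suminf a / 2 + 1) / real d" .
    qed
  qed
  moreover have "suminf a / 2 + 1 > 0" using pos by linarith
  ultimately show ?thesis by blast
qed

section \<open>Gaussian vectors from characteristic functions\<close>

lemma (in prob_space) distr_eq_std_normal:
  assumes X: "X \<in> borel_measurable M"
    and cf: "\<And>t::real. integral\<^sup>L M (\<lambda>\<omega>. cis (t * X \<omega>)) = complex_of_real (exp (- t\<^sup>2 / 2))"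
  shows "distr M borel X = std_normal_distribution"
proof (rule Levy_uniqueness)
  show "real_distribution (distr M borel X)" using X by (rule real_distribution_distr)
  show "real_distribution std_normal_distribution" by (rule real_dist_normal_dist)
  show "char (distr M borel X) = char std_normal_distribution"
  proof
    fix t
    have "char (distr M borel X) t = integral\<^sup>L M (\<lambda>\<omega>. cis (t * X \<omega>))"
      unfolding char_def using X by (subst integral_distr) (auto simp: cis_conv_exp)
    then show "char (distr M borel X) t = char std_normal_distribution t"
      by (simp add: cf char_std_normal_distribution)
  qed
qed

text \<open>\<open>f\<close> is an unnormalised density whose mass is read off at
  \<open>t = 0\<close>. If \<open>c = 0\<close> the weight vanishes almost surely; otherwise
  \<open>X\<close> is standard normal under the measure with density \<open>f / c\<close>.\<close>

lemma (in prob_space) weighted_std_normal: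
  fixes f :: "'a \<Rightarrow> real"
  assumes X [measurable]: "X \<in> borel_measurable M" and f [measurable]: "f \<in> borel_measurable M"
    and f0: "\<And>\<omega>. 0 \<le> f \<omega>" and fK: "\<And>\<omega>. f \<omega> \<le> K"
    and cf: "\<And>t::real. integral\<^sup>L M (\<lambda>\<omega>. f \<omega> *\<^sub>R cis (t * X \<omega>)) = complex_of_real (c * exp (- t\<^sup>2 / 2))"
    and A [measurable]: "A \<in> sets borel"
  shows "integral\<^sup>L M (\<lambda>\<omega>. f \<omega> * indicator A (X \<omega>)) = c * measure std_normal_distribution A"
proof -
  have int: "integrable M f"
    by (rule integrable_const_bound[where B = K]) (use f0 fK in \<open>auto simp: abs_of_nonneg\<close>)
  have "complex_of_real (integral\<^sup>L M f) = integral\<^sup>L M (\<lambda>\<omega>. f \<omega> *\<^sub>R cis (0 * X \<omega>))"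
    by (simp add: scaleR_conv_of_real)
  also have "\<dots> = complex_of_real c" using cf[of 0] by simp
  finally have c: "integral\<^sup>L M f = c" by (simp only: of_real_eq_iff)
  have c0: "c \<ge> 0" using c f0 by (metis integral_nonneg_AE AE_I2)
  show ?thesis
  proof (cases "c = 0")
    case True
    then have "AE \<omega> in M. f \<omega> = 0"
      using c int f0 by (simp add: integral_nonneg_eq_0_iff_AE)
    then have "integral\<^sup>L M (\<lambda>\<omega>. f \<omega> * indicator A (X \<omega>)) = integral\<^sup>L M (\<lambda>\<omega>. 0)"
      by (intro integral_cong_AE) auto
    then show ?thesis using True by simp
  next
    case False
    then have c: "c > 0" "integral\<^sup>L M f = c" using c0 c by auto
    define N where "N = density M (\<lambda>\<omega>. ennreal (f \<omega> / c))"
    have "emeasure N (space N) = (\<integral>\<^sup>+\<omega>. ennreal (f \<omega> / c) \<partial>M)"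
      unfolding N_def by (simp add: emeasure_density cong: nn_integral_cong)
    also have "\<dots> = ennreal (integral\<^sup>L M (\<lambda>\<omega>. f \<omega> / c))"
      by (rule nn_integral_eq_integral) (use int f0 c in auto)
    also have "\<dots> = 1" using c by simp
    finally interpret N: prob_space N by (rule prob_spaceI)
    have XN: "X \<in> borel_measurable N" by (simp add: N_def)
    have "integral\<^sup>L N (\<lambda>\<omega>. cis (t * X \<omega>)) = complex_of_real (exp (- t\<^sup>2 / 2))" for t
    proof -
      have "integral\<^sup>L N (\<lambda>\<omega>. cis (t * X \<omega>)) = integral\<^sup>L M (\<lambda>\<omega>. (f \<omega> / c) *\<^sub>R cis (t * X \<omega>))"
        unfolding N_def by (subst integral_density) (use f0 c in \<open>auto simp: cis_conv_exp\<close>)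
      also have "\<dots> = integral\<^sup>L M (\<lambda>\<omega>. (1 / c) *\<^sub>R (f \<omega> *\<^sub>R cis (t * X \<omega>)))" by simp
      also have "\<dots> = (1 / c) *\<^sub>R complex_of_real (c * exp (- t\<^sup>2 / 2))"
        by (simp only: integral_scaleR_right cf)
      finally show ?thesis using c by (simp add: scaleR_conv_of_real)
    qed
    from N.distr_eq_std_normal[OF XN this]
    have "measure std_normal_distribution A = measure (distr N borel X) A" by simp
    also have "\<dots> = integral\<^sup>L N (\<lambda>\<omega>. indicator A (X \<omega>))"
      using XN A by (subst Bochner_Integration.integral_distr[symmetric, where M = N and N = borel]) auto
    also have "\<dots> = integral\<^sup>L M (\<lambda>\<omega>. (f \<omega> / c) *\<^sub>R indicator A (X \<omega>))"
      unfolding N_def by (subst integral_density) (use f0 c in auto)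
    also have "\<dots> = integral\<^sup>L M (\<lambda>\<omega>. f \<omega> * indicator A (X \<omega>)) / c" by simp
    finally show ?thesis using c by simp
  qed
qed

lemma (in prob_space) integrable_scaleR_cis:
  assumes [measurable]: "e \<in> borel_measurable M" "Z \<in> borel_measurable M" and "\<And>\<omega>. \<bar>e \<omega>\<bar> \<le> (1::real)"
  shows "integrable M (\<lambda>\<omega>. e \<omega> *\<^sub>R cis (Z \<omega>))"
  by (rule integrable_const_bound[where B = 1]) (use assms in \<open>auto simp: cis_conv_exp\<close>)

text \<open>Coordinates are turned into indicators one at a time. For the remaining part \<open>Y\<close> of the phase,
  \<open>1 + cos Y\<close> and \<open>1 + sin Y\<close> are nonnegative densities, so that the
  one-dimensional uniqueness theorem applies.\<close>

lemma (in prob_space) joint_std_normal_step: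
  fixes e X Y :: "'a \<Rightarrow> real"
  assumes e [measurable]: "e \<in> borel_measurable M" and X [measurable]: "X \<in> borel_measurable M"
    and Y [measurable]: "Y \<in> borel_measurable M"
    and e01: "\<And>\<omega>. 0 \<le> e \<omega>" "\<And>\<omega>. e \<omega> \<le> 1"
    and A [measurable]: "A \<in> sets borel"
    and 0: "\<And>s. integral\<^sup>L M (\<lambda>\<omega>. e \<omega> *\<^sub>R cis (s * X \<omega>)) = complex_of_real (c * exp (- s\<^sup>2 / 2))"
    and p: "\<And>s. integral\<^sup>L M (\<lambda>\<omega>. e \<omega> *\<^sub>R cis (s * X \<omega> + Y \<omega>)) = complex_of_real (c * exp (- s\<^sup>2 / 2) * k)"
    and m: "\<And>s. integral\<^sup>L M (\<lambda>\<omega>. e \<omega> *\<^sub>R cis (s * X \<omega> - Y \<omega>)) = complex_of_real (c * exp (- s\<^sup>2 / 2) * k)"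
  shows "integral\<^sup>L M (\<lambda>\<omega>. (e \<omega> * indicator A (X \<omega>)) *\<^sub>R cis (Y \<omega>))
     = complex_of_real (c * measure std_normal_distribution A * k)"
proof -
  define n where "n = measure std_normal_distribution A"
  have I: "integrable M (\<lambda>\<omega>. e \<omega> *\<^sub>R cis (s * X \<omega>))"
     "integrable M (\<lambda>\<omega>. e \<omega> *\<^sub>R cis (s * X \<omega> + Y \<omega>))"
     "integrable M (\<lambda>\<omega>. e \<omega> *\<^sub>R cis (s * X \<omega> - Y \<omega>))" for s
    using e01 by (auto intro!: integrable_scaleR_cis simp: abs_of_nonneg)
  have J: "integrable M (\<lambda>\<omega>. e \<omega> * indicator A (X \<omega>))"
    "integrable M (\<lambda>\<omega>. e \<omega> * indicator A (X \<omega>) * cos (Y \<omega>))"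
    "integrable M (\<lambda>\<omega>. e \<omega> * indicator A (X \<omega>) * sin (Y \<omega>))"
    using e01 by (auto intro!: integrable_const_bound[where B = 1] mult_le_one AE_I2
        simp: abs_mult abs_of_nonneg indicator_def)
  have "integral\<^sup>L M (\<lambda>\<omega>. e \<omega> * indicator A (X \<omega>)) = c * n"
    unfolding n_def by (rule weighted_std_normal[where K = 1]) (use e01 0 in auto)
  moreover have "integral\<^sup>L M (\<lambda>\<omega>. (e \<omega> * (1 + cos (Y \<omega>))) * indicator A (X \<omega>)) = (c * (1 + k)) * n"
    unfolding n_def
  proof (rule weighted_std_normal[where K = 2])
    fix t
    \<comment> \<open>Product-to-sum formula: \<open>cos Y\<close> times \<open>cis (tX)\<close> is
      the mean of \<open>cis (tX + Y)\<close> and \<open>cis (tX - Y)\<close>, whose weighted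
      integrals are given by \<open>p\<close> and \<open>m\<close>.\<close>
    have "(e \<omega> * (1 + cos (Y \<omega>))) *\<^sub>R cis (t * X \<omega>) = e \<omega> *\<^sub>R cis (t * X \<omega>)
       + (1/2) *\<^sub>R (e \<omega> *\<^sub>R cis (t * X \<omega> + Y \<omega>) + e \<omega> *\<^sub>R cis (t * X \<omega> - Y \<omega>))" for \<omega>
      by (simp add: complex_eq_iff cos_add cos_diff sin_add sin_diff algebra_simps)
    then have "integral\<^sup>L M (\<lambda>\<omega>. (e \<omega> * (1 + cos (Y \<omega>))) *\<^sub>R cis (t * X \<omega>))
      = complex_of_real (c * exp (- t\<^sup>2 / 2))
        + (1/2) *\<^sub>R (complex_of_real (c * exp (- t\<^sup>2 / 2) * k) + complex_of_real (c * exp (- t\<^sup>2 / 2) * k))"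
      by (simp only: Bochner_Integration.integral_add integral_scaleR_right
          Bochner_Integration.integrable_add integrable_scaleR_right I 0 p m)
    then show "integral\<^sup>L M (\<lambda>\<omega>. (e \<omega> * (1 + cos (Y \<omega>))) *\<^sub>R cis (t * X \<omega>))
      = complex_of_real ((c * (1 + k)) * exp (- t\<^sup>2 / 2))"
      by (simp add: scaleR_conv_of_real algebra_simps)
  next
    fix \<omega>
    show "0 \<le> e \<omega> * (1 + cos (Y \<omega>))"
      using e01(1)[of \<omega>] cos_ge_minus_one[of "Y \<omega>"] by (intro mult_nonneg_nonneg) linarith+
    have "e \<omega> * (1 + cos (Y \<omega>)) \<le> 1 * 2"
      using e01[of \<omega>] cos_ge_minus_one[of "Y \<omega>"] cos_le_one[of "Y \<omega>"] by (intro mult_mono) linarith+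
    then show "e \<omega> * (1 + cos (Y \<omega>)) \<le> 2" by simp
  qed auto
  moreover have "integral\<^sup>L M (\<lambda>\<omega>. (e \<omega> * (1 + sin (Y \<omega>))) * indicator A (X \<omega>)) = c * n"
    unfolding n_def
  proof (rule weighted_std_normal[where K = 2])
    fix t
    \<comment> \<open>The sine produces a difference instead, and since \<open>p\<close> and
      \<open>m\<close> have the same right-hand side it integrates to 0.\<close>
    have "(e \<omega> * (1 + sin (Y \<omega>))) *\<^sub>R cis (t * X \<omega>) = e \<omega> *\<^sub>R cis (t * X \<omega>)
       + (- \<i> / 2) * (e \<omega> *\<^sub>R cis (t * X \<omega> + Y \<omega>) - e \<omega> *\<^sub>R cis (t * X \<omega> - Y \<omega>))" for \<omega>
      by (simp add: complex_eq_iff cos_add cos_diff sin_add sin_diff field_simps)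
    then have "integral\<^sup>L M (\<lambda>\<omega>. (e \<omega> * (1 + sin (Y \<omega>))) *\<^sub>R cis (t * X \<omega>))
      = complex_of_real (c * exp (- t\<^sup>2 / 2))
        + (- \<i> / 2) * (complex_of_real (c * exp (- t\<^sup>2 / 2) * k) - complex_of_real (c * exp (- t\<^sup>2 / 2) * k))"
      by (simp only: Bochner_Integration.integral_add Bochner_Integration.integral_diff integral_mult_right_zero
          Bochner_Integration.integrable_add Bochner_Integration.integrable_diff integrable_mult_right I 0 p m)
    then show "integral\<^sup>L M (\<lambda>\<omega>. (e \<omega> * (1 + sin (Y \<omega>))) *\<^sub>R cis (t * X \<omega>))
      = complex_of_real (c * exp (- t\<^sup>2 / 2))" by simp
  next
    fix \<omega>
    show "0 \<le> e \<omega> * (1 + sin (Y \<omega>))"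
      using e01(1)[of \<omega>] sin_ge_minus_one[of "Y \<omega>"] by (intro mult_nonneg_nonneg) linarith+
    have "e \<omega> * (1 + sin (Y \<omega>)) \<le> 1 * 2"
      using e01[of \<omega>] sin_ge_minus_one[of "Y \<omega>"] sin_le_one[of "Y \<omega>"] by (intro mult_mono) linarith+
    then show "e \<omega> * (1 + sin (Y \<omega>)) \<le> 2" by simp
  qed auto
  moreover have "(e \<omega> * (1 + u)) * i = e \<omega> * i + e \<omega> * i * u" for \<omega> u i
    by (simp add: algebra_simps)
  ultimately have E: "integral\<^sup>L M (\<lambda>\<omega>. e \<omega> * indicator A (X \<omega>) * cos (Y \<omega>)) = c * n * k"
    "integral\<^sup>L M (\<lambda>\<omega>. e \<omega> * indicator A (X \<omega>) * sin (Y \<omega>)) = 0"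
    using J by (simp_all add: algebra_simps)
  have "(e \<omega> * indicator A (X \<omega>)) *\<^sub>R cis (Y \<omega>)
     = complex_of_real (e \<omega> * indicator A (X \<omega>) * cos (Y \<omega>))
       + \<i> * complex_of_real (e \<omega> * indicator A (X \<omega>) * sin (Y \<omega>))" for \<omega>
    by (simp add: complex_eq_iff)
  then have "integral\<^sup>L M (\<lambda>\<omega>. (e \<omega> * indicator A (X \<omega>)) *\<^sub>R cis (Y \<omega>))
     = complex_of_real (c * n * k) + \<i> * complex_of_real 0"
    using J by (simp only: Bochner_Integration.integral_add integral_mult_right_zero integral_complex_of_real
       integrable_of_real integrable_mult_right E)
  then show ?thesis by (simp add: n_def)
qed

text \<open>The coordinates in \<open>J\<close> already enter through indicators, the others still
  through the characteristic function: \<open>J = {}\<close> is the hypothesis \<open>cf\<close> and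
  \<open>J = I\<close> the product formula. The phase \<open>t\<close> stays arbitrary in the
  induction.\<close>

lemma (in prob_space) joint_std_normal_aux:
  fixes X :: "'i \<Rightarrow> 'a \<Rightarrow> real"
  assumes I: "finite I" and X [measurable]: "\<And>i. i \<in> I \<Longrightarrow> X i \<in> borel_measurable M"
    and cf: "\<And>t :: 'i \<Rightarrow> real. integral\<^sup>L M (\<lambda>\<omega>. cis (\<Sum>i\<in>I. t i * X i \<omega>)) = complex_of_real (exp (- (\<Sum>i\<in>I. (t i)\<^sup>2) / 2))"
    and A: "\<And>i. i \<in> I \<Longrightarrow> A i \<in> sets borel"
    and "finite J" and "J \<subseteq> I"
  shows "integral\<^sup>L M (\<lambda>\<omega>. (\<Prod>j\<in>J. indicator (A j) (X j \<omega>)) *\<^sub>R cis (\<Sum>i\<in>I - J. t i * X i \<omega>))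
     = complex_of_real ((\<Prod>j\<in>J. measure std_normal_distribution (A j)) * exp (- (\<Sum>i\<in>I - J. (t i)\<^sup>2) / 2))"
  using \<open>finite J\<close> \<open>J \<subseteq> I\<close>
proof (induction J arbitrary: t)
  case empty
  then show ?case using cf[of t] by simp
next
  case (insert k J)
  define e where "e \<omega> = (\<Prod>j\<in>J. indicator (A j) (X j \<omega>) :: real)" for \<omega>
  define c where "c = (\<Prod>j\<in>J. measure std_normal_distribution (A j))"
  define R where "R = I - insert k J"
  define Y where "Y \<omega> = (\<Sum>i\<in>R. t i * X i \<omega>)" for \<omega>
  define v where "v = (\<Sum>i\<in>R. (t i)\<^sup>2)"
  have IJ: "I - J = insert k R" "k \<notin> R" "finite R" "k \<in> I" "R \<subseteq> I"
    using insert I by (auto simp: R_def)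
  have e [measurable]: "e \<in> borel_measurable M"
    unfolding e_def using insert A by (intro borel_measurable_prod) auto
  have Xk [measurable]: "X k \<in> borel_measurable M" using IJ by auto
  have Y [measurable]: "Y \<in> borel_measurable M" unfolding Y_def
    by (intro borel_measurable_sum borel_measurable_times) (use IJ in auto)
  \<comment> \<open>The scale \<open>a\<close> is used for the values 0, 1 and -1, which give the
    three transforms required to convert one more coordinate.\<close>
  have IH: "integral\<^sup>L M (\<lambda>\<omega>. e \<omega> *\<^sub>R cis (s * X k \<omega> + a * Y \<omega>)) = complex_of_real (c * exp (- (s\<^sup>2 + a\<^sup>2 * v) / 2))"
    for s a
  proof -
    define t' where "t' i = (if i = k then s else a * t i)" for i
    have "(\<Sum>i\<in>I - J. t' i * X i \<omega>) = s * X k \<omega> + a * Y \<omega>" for \<omega>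
      using IJ by (auto simp: t'_def Y_def sum_distrib_left mult.assoc intro!: sum.cong)
    moreover have "(\<Sum>i\<in>I - J. (t' i)\<^sup>2) = s\<^sup>2 + a\<^sup>2 * v"
      using IJ by (auto simp: t'_def v_def sum_distrib_left power_mult_distrib intro!: sum.cong)
    ultimately show ?thesis using insert.IH[of t'] insert.prems by (simp add: e_def c_def)
  qed
  have ex: "c * exp (- (s\<^sup>2 + v) / 2) = c * exp (- s\<^sup>2 / 2) * exp (- v / 2)" for s
    by (simp add: mult.assoc exp_add[symmetric] add_divide_distrib diff_divide_distrib)
  have IHs: "integral\<^sup>L M (\<lambda>\<omega>. e \<omega> *\<^sub>R cis (s * X k \<omega>)) = complex_of_real (c * exp (- s\<^sup>2 / 2))"
    "integral\<^sup>L M (\<lambda>\<omega>. e \<omega> *\<^sub>R cis (s * X k \<omega> + Y \<omega>)) = complex_of_real (c * exp (- s\<^sup>2 / 2) * exp (- v / 2))"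
    "integral\<^sup>L M (\<lambda>\<omega>. e \<omega> *\<^sub>R cis (s * X k \<omega> - Y \<omega>)) = complex_of_real (c * exp (- s\<^sup>2 / 2) * exp (- v / 2))" for s
    unfolding ex[symmetric] using IH[of s 0] IH[of s 1] IH[of s "- 1"] by simp_all
  have "integral\<^sup>L M (\<lambda>\<omega>. (e \<omega> * indicator (A k) (X k \<omega>)) *\<^sub>R cis (Y \<omega>))
     = complex_of_real (c * measure std_normal_distribution (A k) * exp (- v / 2))"
  proof (rule joint_std_normal_step)
    show "A k \<in> sets borel" using A IJ by auto
    show "0 \<le> e \<omega>" "e \<omega> \<le> 1" for \<omega>
      unfolding e_def by (auto intro!: prod_nonneg prod_le_1 simp: indicator_def)
  qed (rule e Xk Y IHs)+
  moreover have "(\<Prod>j\<in>insert k J. indicator (A j) (X j \<omega>)) = e \<omega> * indicator (A k) (X k \<omega>)" for \<omega>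
    using insert by (simp add: e_def mult.commute)
  moreover have "(\<Prod>j\<in>insert k J. measure std_normal_distribution (A j)) = c * measure std_normal_distribution (A k)"
    using insert by (simp add: c_def mult.commute)
  ultimately show ?case unfolding Y_def v_def R_def by simp
qed

lemma (in prob_space) joint_std_normal:
  fixes X :: "'i \<Rightarrow> 'a \<Rightarrow> real"
  assumes I: "finite I" and X [measurable]: "\<And>i. i \<in> I \<Longrightarrow> X i \<in> borel_measurable M"
    and cf: "\<And>t :: 'i \<Rightarrow> real. integral\<^sup>L M (\<lambda>\<omega>. cis (\<Sum>i\<in>I. t i * X i \<omega>)) = complex_of_real (exp (- (\<Sum>i\<in>I. (t i)\<^sup>2) / 2))"
    and A [measurable]: "\<And>i. i \<in> I \<Longrightarrow> A i \<in> sets borel"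
  shows "measure M {\<omega> \<in> space M. \<forall>i\<in>I. X i \<omega> \<in> A i} = (\<Prod>i\<in>I. measure std_normal_distribution (A i))"
proof -
  have m: "{\<omega> \<in> space M. \<forall>i\<in>I. X i \<omega> \<in> A i} \<in> sets M"
    using I by measurable
  have *: "(\<Prod>j\<in>I. indicator (A j) (X j \<omega>)) = (indicator {\<omega> \<in> space M. \<forall>i\<in>I. X i \<omega> \<in> A i} \<omega> :: real)"
    if "\<omega> \<in> space M" for \<omega>
    using that I by (auto simp: indicator_def intro!: prod.neutral prod_zero)
  have "complex_of_real (measure M {\<omega> \<in> space M. \<forall>i\<in>I. X i \<omega> \<in> A i})
      = integral\<^sup>L M (\<lambda>\<omega>. complex_of_real (indicator {\<omega> \<in> space M. \<forall>i\<in>I. X i \<omega> \<in> A i} \<omega>))"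
    using m by simp
  also have "\<dots> = integral\<^sup>L M (\<lambda>\<omega>. (\<Prod>j\<in>I. indicator (A j) (X j \<omega>)) *\<^sub>R cis (\<Sum>i\<in>I - I. 0 * X i \<omega>))"
    by (intro Bochner_Integration.integral_cong refl) (simp add: * scaleR_conv_of_real)
  also have "\<dots> = complex_of_real (\<Prod>i\<in>I. measure std_normal_distribution (A i))"
    using joint_std_normal_aux[OF I X cf A I subset_refl, where t = "\<lambda>_. 0"] by simp
  finally show ?thesis by (simp only: of_real_eq_iff)
qed

section \<open>Gaussian tails\<close>

text \<open>Exponential tilting: for \<open>x < -u\<close> the density is at most
  \<open>exp (-u^2/2)\<close> times the normal density centred at \<open>-u\<close>, which has total
  mass 1.\<close>

lemma std_normal_lower_tail:
  assumes "u \<ge> 0"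
  shows "measure std_normal_distribution {..<- u} \<le> exp (- u\<^sup>2 / 2)"
proof -
  interpret N: prob_space "density lborel (normal_density (- u) 1)"
    by (rule prob_space_normal_density) simp
  have "emeasure std_normal_distribution {..<- u}
      = (\<integral>\<^sup>+x. ennreal (std_normal_density x) * indicator {..<- u} x \<partial>lborel)"
    by (simp add: emeasure_density)
  also have "\<dots> \<le> (\<integral>\<^sup>+x. ennreal (exp (- u\<^sup>2 / 2)) * ennreal (normal_density (- u) 1 x) \<partial>lborel)"
  proof (rule nn_integral_mono)
    fix x :: real
    show "ennreal (std_normal_density x) * indicator {..<- u} x
       \<le> ennreal (exp (- u\<^sup>2 / 2)) * ennreal (normal_density (- u) 1 x)"
    proof (cases "x < - u")
      case True
      have "u * (u + x) \<le> 0" using True assms by (intro mult_nonneg_nonpos) auto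
      then have "- x\<^sup>2 / 2 \<le> - u\<^sup>2 / 2 + - (x - (- u))\<^sup>2 / 2"
        by (simp add: power2_eq_square algebra_simps)
      then have "exp (- x\<^sup>2 / 2) \<le> exp (- u\<^sup>2 / 2) * exp (- (x - (- u))\<^sup>2 / 2)"
        by (simp only: exp_add[symmetric] exp_le_cancel_iff)
      then have "1 / sqrt (2 * pi) * exp (- x\<^sup>2 / 2) \<le> 1 / sqrt (2 * pi) * (exp (- u\<^sup>2 / 2) * exp (- (x - (- u))\<^sup>2 / 2))"
        by (intro mult_left_mono) auto
      then have "std_normal_density x \<le> exp (- u\<^sup>2 / 2) * normal_density (- u) 1 x"
        unfolding normal_density_def by simp
      then show ?thesis using True by (simp add: ennreal_mult[symmetric] ennreal_leI)
    qed auto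
  qed
  also have "\<dots> = ennreal (exp (- u\<^sup>2 / 2)) * emeasure (density lborel (normal_density (- u) 1)) UNIV"
    by (simp add: nn_integral_cmult emeasure_density)
  also have "\<dots> = ennreal (exp (- u\<^sup>2 / 2))" using N.emeasure_space_1 by simp
  finally show ?thesis
    unfolding measure_def by (simp add: enn2real_leI)
qed

text \<open>Only the mass of \<open>[T, T + 1]\<close> is kept. The unit shift is negligible on the
  scale \<open>sqrt (log d)\<close> of the threshold to which this is applied.\<close>

lemma std_normal_upper_tail_ge:
  assumes "T \<ge> 0"
  shows "measure std_normal_distribution {T..} \<ge> std_normal_density (T + 1)"
proof -
  interpret N: prob_space std_normal_distribution
    by (rule prob_space_normal_density) simp
  have "ennreal (std_normal_density (T + 1)) = (\<integral>\<^sup>+x. ennreal (std_normal_density (T + 1)) * indicator {T..T+1} x \<partial>lborel)"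
    by (simp add: nn_integral_cmult_indicator)
  also have "\<dots> \<le> (\<integral>\<^sup>+x. ennreal (std_normal_density x) * indicator {T..} x \<partial>lborel)"
  proof (rule nn_integral_mono)
    fix x
    have "std_normal_density (T + 1) \<le> std_normal_density x" if "T \<le> x" "x \<le> T + 1"
    proof -
      have "x\<^sup>2 \<le> (T + 1)\<^sup>2" using that assms by (intro power_mono) auto
      then show ?thesis by (simp add: std_normal_density_def divide_right_mono)
    qed
    then show "ennreal (std_normal_density (T + 1)) * indicator {T..T+1} x \<le> ennreal (std_normal_density x) * indicator {T..} x"
      by (auto simp: indicator_def intro!: ennreal_leI)
  qed
  also have "\<dots> = emeasure std_normal_distribution {T..}" by (simp add: emeasure_density)
  finally show ?thesis
    by (simp add: N.emeasure_eq_measure)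
qed

text \<open>For the residuals only an upper bound \<open>V\<close> on the variance is at hand.
  Variance 0 is separated because normalisation divides by its root, and it does occur: the first
  vertex in the orthogonalisation has residual 0.\<close>

lemma (in prob_space) gaussian_lower_tail:
  assumes X [measurable]: "X \<in> borel_measurable M"
    and cf: "\<And>t::real. integral\<^sup>L M (\<lambda>\<omega>. cis (t * X \<omega>)) = complex_of_real (exp (- (t\<^sup>2 * v) / 2))"
    and v: "0 \<le> v" "v \<le> V" "V > 0" and s: "s > 0"
  shows "measure M {\<omega> \<in> space M. X \<omega> < - s} \<le> exp (- s\<^sup>2 / (2 * V))"
proof (cases "v = 0")
  case True
  have "distr M borel X = return borel 0"
  proof (rule Levy_uniqueness)
    show "real_distribution (distr M borel X)" using X by (rule real_distribution_distr)
    show "real_distribution (return borel 0)"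
      by (auto simp: real_distribution_def real_distribution_axioms_def intro: prob_space_return)
    show "char (distr M borel X) = char (return borel 0)"
    proof
      fix t
      have "char (distr M borel X) t = integral\<^sup>L M (\<lambda>\<omega>. cis (t * X \<omega>))"
        unfolding char_def using X by (subst integral_distr) (auto simp: cis_conv_exp)
      then show "char (distr M borel X) t = char (return borel 0) t"
        by (simp add: cf True char_def integral_return)
    qed
  qed
  then have "measure (distr M borel X) {..<- s} = 0"
    using s by (simp add: measure_return)
  moreover have "measure (distr M borel X) {..<- s} = measure M {\<omega> \<in> space M. X \<omega> < - s}"
    by (subst measure_distr) (auto intro!: arg_cong[where f = "measure M"])
  ultimately show ?thesis by simp
next
  case False
  then have v: "0 < v" "v \<le> V" "V > 0" using v by auto
  define Z where "Z \<omega> = X \<omega> / sqrt v" for \<omega>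
  have Z [measurable]: "Z \<in> borel_measurable M" unfolding Z_def by simp
  have "distr M borel Z = std_normal_distribution"
  proof (rule distr_eq_std_normal[OF Z])
    fix t
    have "t * Z \<omega> = (t / sqrt v) * X \<omega>" for \<omega> by (simp add: Z_def)
    moreover have "(t / sqrt v)\<^sup>2 * v = t\<^sup>2" using v by (simp add: power_divide)
    ultimately show "integral\<^sup>L M (\<lambda>\<omega>. cis (t * Z \<omega>)) = complex_of_real (exp (- t\<^sup>2 / 2))"
      using cf[of "t / sqrt v"] by simp
  qed
  then have "measure std_normal_distribution {..<- (s / sqrt v)} = measure (distr M borel Z) {..<- (s / sqrt v)}"
    by simp
  also have "\<dots> = measure M {\<omega> \<in> space M. X \<omega> < - s}"
    using v by (subst measure_distr) (auto intro!: arg_cong[where f = "measure M"] simp: Z_def field_simps)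
  finally have "measure M {\<omega> \<in> space M. X \<omega> < - s} \<le> exp (- (s / sqrt v)\<^sup>2 / 2)"
    using std_normal_lower_tail[of "s / sqrt v"] v s by simp
  also have "\<dots> = exp (- (s\<^sup>2 / (2 * v)))" using v by (simp add: power_divide)
  also have "\<dots> \<le> exp (- (s\<^sup>2 / (2 * V)))"
    using v by (auto intro!: divide_left_mono)
  finally show ?thesis by simp
qed

section \<open>Comparison of the free field with independent variables\<close>

text \<open>The covariance of the linear combinations with coefficients \<open>a\<close> and
  \<open>b\<close>. Orthogonality is argued on coefficient functions instead of random
  variables.\<close>

definition cov_form :: "'v set \<Rightarrow> ('v \<Rightarrow> 'v \<Rightarrow> real) \<Rightarrow> ('v \<Rightarrow> real) \<Rightarrow> ('v \<Rightarrow> real) \<Rightarrow> real" where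
  "cov_form W g a b = (\<Sum>x\<in>W. \<Sum>y\<in>W. a x * b y * g x y)"

lemma cov_form_add_left: "cov_form W g (\<lambda>x. a x + a' x) b = cov_form W g a b + cov_form W g a' b"
  by (simp add: cov_form_def distrib_right sum.distrib)

lemma cov_form_add_right: "cov_form W g a (\<lambda>x. b x + b' x) = cov_form W g a b + cov_form W g a b'"
  by (simp add: cov_form_def distrib_right distrib_left sum.distrib)

lemma cov_form_diff_left: "cov_form W g (\<lambda>x. a x - a' x) b = cov_form W g a b - cov_form W g a' b"
  by (simp add: cov_form_def left_diff_distrib sum_subtractf)

lemma cov_form_diff_right: "cov_form W g a (\<lambda>x. b x - b' x) = cov_form W g a b - cov_form W g a b'"
  by (simp add: cov_form_def left_diff_distrib right_diff_distrib sum_subtractf)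

lemma cov_form_scale_left: "cov_form W g (\<lambda>x. k * a x) b = k * cov_form W g a b"
  by (simp add: cov_form_def sum_distrib_left mult.assoc)

lemma cov_form_scale_right: "cov_form W g a (\<lambda>x. k * b x) = k * cov_form W g a b"
  by (simp add: cov_form_def sum_distrib_left mult.assoc mult.left_commute)

lemma cov_form_sum_left: "finite A \<Longrightarrow> cov_form W g (\<lambda>x. \<Sum>i\<in>A. a i x) b = (\<Sum>i\<in>A. cov_form W g (a i) b)"
  by (induction A rule: finite_induct) (simp_all add: cov_form_add_left, simp add: cov_form_def)

lemma cov_form_sum_right: "finite A \<Longrightarrow> cov_form W g a (\<lambda>x. \<Sum>i\<in>A. b i x) = (\<Sum>i\<in>A. cov_form W g a (b i))"
  by (induction A rule: finite_induct) (simp_all add: cov_form_add_right, simp add: cov_form_def)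

lemma cov_form_sym:
  assumes "\<And>x y. x \<in> W \<Longrightarrow> y \<in> W \<Longrightarrow> g x y = g y x"
  shows "cov_form W g a b = cov_form W g b a"
  unfolding cov_form_def
  by (subst sum.swap) (intro sum.cong refl, simp add: assms)

definition unit_fun :: "'v \<Rightarrow> 'v \<Rightarrow> real" where
  "unit_fun z = (\<lambda>x. if x = z then 1 else 0)"

lemma cov_form_unit_left:
  "finite W \<Longrightarrow> z \<in> W \<Longrightarrow> cov_form W g (unit_fun z) b = (\<Sum>y\<in>W. b y * g z y)"
proof -
  assume W: "finite W" "z \<in> W"
  have "cov_form W g (unit_fun z) b = (\<Sum>x\<in>W. if x = z then \<Sum>y\<in>W. b y * g z y else 0)"
    unfolding cov_form_def by (intro sum.cong refl) (simp add: unit_fun_def)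
  then show ?thesis using W by simp
qed

text \<open>\<open>c x\<close> are the orthonormal vectors, \<open>r x\<close> is the projection of
  \<open>unit_fun x\<close> on the earlier ones and \<open>\<sigma> x\<close> the norm of the
  remainder. By Pythagoras a remainder of square norm at least 1 leaves at most
  \<open>g x x - 1\<close> for \<open>r x\<close>. The support clause for \<open>c\<close> is
  carried along so that \<open>one\<close> applies at the next vertex.\<close>

lemma gram_schmidt:
  fixes g :: "'v \<Rightarrow> 'v \<Rightarrow> real"
  assumes W: "finite W" and "V \<subseteq> W" and sym: "\<And>x y. x \<in> W \<Longrightarrow> y \<in> W \<Longrightarrow> g x y = g y x"
    and one: "\<And>a z. z \<in> V \<Longrightarrow> a z = 1 \<Longrightarrow> cov_form W g a a \<ge> 1"
    and "finite A" "A \<subseteq> V"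
  shows "\<exists>c \<sigma> r. (\<forall>x\<in>A. \<forall>y\<in>A. cov_form W g (c x) (c y) = (if x = y then 1 else 0)) \<and>
     (\<forall>x\<in>A. \<sigma> x \<ge> 1 \<and> (\<forall>w. unit_fun x w = \<sigma> x * c x w + r x w) \<and> cov_form W g (r x) (r x) \<le> g x x - 1
        \<and> (\<forall>w. w \<notin> A \<longrightarrow> c x w = 0))"
  using \<open>finite A\<close> \<open>A \<subseteq> V\<close>
proof (induction A)
  case empty
  then show ?case by simp
next
  case (insert z A)
  define B where "B = cov_form W g"
  note lin = cov_form_add_left cov_form_add_right cov_form_diff_left cov_form_diff_right
    cov_form_scale_left cov_form_scale_right
  have sB: "B a b = B b a" for a b unfolding B_def using sym by (rule cov_form_sym)
  have "A \<subseteq> V" using insert.prems by simp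
  from insert.IH[OF this] obtain c \<sigma> r where
    "(\<forall>x\<in>A. \<forall>y\<in>A. cov_form W g (c x) (c y) = (if x = y then 1 else 0)) \<and>
     (\<forall>x\<in>A. \<sigma> x \<ge> 1 \<and> (\<forall>w. unit_fun x w = \<sigma> x * c x w + r x w) \<and> cov_form W g (r x) (r x) \<le> g x x - 1
        \<and> (\<forall>w. w \<notin> A \<longrightarrow> c x w = 0))"
    by (elim exE)
  then have IH:
    "\<And>x y. x \<in> A \<Longrightarrow> y \<in> A \<Longrightarrow> B (c x) (c y) = (if x = y then 1 else 0)"
    "\<And>x. x \<in> A \<Longrightarrow> \<sigma> x \<ge> 1" "\<And>x w. x \<in> A \<Longrightarrow> unit_fun x w = \<sigma> x * c x w + r x w"
    "\<And>x. x \<in> A \<Longrightarrow> B (r x) (r x) \<le> g x x - 1" "\<And>x w. x \<in> A \<Longrightarrow> w \<notin> A \<Longrightarrow> c x w = 0"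
    by (simp_all add: B_def)
  define k where "k x = B (unit_fun z) (c x)" for x
  define rz where "rz = (\<lambda>w. \<Sum>x\<in>A. k x * c x w)"
  define u where "u = (\<lambda>w. unit_fun z w - rz w)"
  \<comment> \<open>The earlier vectors are supported on \<open>A\<close>, which does not contain
    \<open>z\<close>; hence the remainder \<open>u\<close> keeps coefficient 1 at
    \<open>z\<close>.\<close>
  have "rz z = 0" unfolding rz_def using IH(5) insert by (intro sum.neutral) auto
  then have "u z = 1" by (simp add: u_def unit_fun_def)
  then have Bu: "B u u \<ge> 1" unfolding B_def using insert by (intro one) auto
  have rc: "B rz (c y) = k y" if "y \<in> A" for y
  proof -
    have "B rz (c y) = (\<Sum>x\<in>A. k x * B (c x) (c y))"
      unfolding rz_def B_def using insert by (simp add: cov_form_sum_left lin)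
    also have "\<dots> = (\<Sum>x\<in>A. if x = y then k x else 0)" using that IH(1) by (intro sum.cong) auto
    finally show ?thesis using that insert by simp
  qed
  have uc: "B u (c y) = 0" if "y \<in> A" for y
    using rc[OF that] unfolding u_def B_def k_def by (simp add: lin)
  have ur: "B u rz = 0"
    unfolding rz_def B_def using insert uc by (simp add: cov_form_sum_right lin B_def)
  have "B (unit_fun z) (unit_fun z) = B (\<lambda>w. u w + rz w) (\<lambda>w. u w + rz w)" by (simp add: u_def)
  also have "\<dots> = B u u + B rz rz"
    using ur sB[of rz u] unfolding B_def by (simp add: lin)
  moreover have "B (unit_fun z) (unit_fun z) = g z z"
  proof -
    have "z \<in> W" using insert \<open>V \<subseteq> W\<close> by auto
    then have "B (unit_fun z) (unit_fun z) = (\<Sum>y\<in>W. unit_fun z y * g z y)"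
      unfolding B_def by (rule cov_form_unit_left[OF W])
    also have "\<dots> = (\<Sum>y\<in>W. if y = z then g z y else 0)" by (intro sum.cong) (auto simp: unit_fun_def)
    finally show ?thesis using W \<open>z \<in> W\<close> by simp
  qed
  ultimately have Br: "B rz rz \<le> g z z - 1" using Bu by linarith
  define s where "s = sqrt (B u u)"
  have s: "s \<ge> 1" "s * s = B u u" using Bu by (auto simp: s_def)
  define cz where "cz = (\<lambda>w. (1 / s) * u w)"
  have zz: "B cz cz = 1"
  proof -
    have "B cz cz = (1 / s) * ((1 / s) * B u u)" unfolding cz_def B_def by (simp only: lin)
    then show ?thesis unfolding s(2)[symmetric] using s(1) by simp
  qed
  have zc: "B cz (c y) = 0" if "y \<in> A" for y
    using uc[OF that] unfolding cz_def B_def by (simp only: lin)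
  have cz: "B (c y) cz = 0" if "y \<in> A" for y
    using zc[OF that] sB by metis
  have eq: "unit_fun z w = s * cz w + rz w" for w using s by (simp add: cz_def u_def)
  have sup: "cz w = 0" if "w \<notin> insert z A" for w
  proof -
    have "rz w = 0" unfolding rz_def using that IH(5) by (intro sum.neutral) auto
    then show ?thesis using that by (simp add: cz_def u_def unit_fun_def)
  qed
  show ?case
  proof (rule exI[of _ "c(z := cz)"], rule exI[of _ "\<sigma>(z := s)"], rule exI[of _ "r(z := rz)"],
      intro conjI ballI allI impI)
    fix x y assume xy: "x \<in> insert z A" "y \<in> insert z A"
    show "cov_form W g ((c(z := cz)) x) ((c(z := cz)) y) = (if x = y then 1 else 0)"
      unfolding B_def[symmetric]
      by (cases "x = z"; cases "y = z") (use xy insert.hyps IH(1) zz zc cz in auto)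
  next
    fix x w assume x: "x \<in> insert z A"
    show "1 \<le> (\<sigma>(z := s)) x" using x IH(2) s by auto
    show "unit_fun x w = (\<sigma>(z := s)) x * (c(z := cz)) x w + (r(z := rz)) x w"
      using x IH(3)[of x w] eq[of w] by (cases "x = z") auto
    show "cov_form W g ((r(z := rz)) x) ((r(z := rz)) x) \<le> g x x - 1"
      unfolding B_def[symmetric] using x IH(4)[of x] Br by (cases "x = z") auto
  next
    fix x w assume x: "x \<in> insert z A" and w: "w \<notin> insert z A"
    show "(c(z := cz)) x w = 0"
      using x IH(5)[of x w] sup[OF w] w by (cases "x = z") auto
  qed
qed

section \<open>Positivity of the Green form and conditional variance\<close>

lemma is_GFF_char:
  assumes "is_GFF d M \<phi>" "finite W" "W \<subseteq> lattice d"
  shows "integral\<^sup>L M (\<lambda>\<omega>. cis (t * (\<Sum>x\<in>W. a x * \<phi> x \<omega>)))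
    = complex_of_real (exp (- (t\<^sup>2 * cov_form W (green d) a a) / 2))"
  using assms unfolding is_GFF_def cov_form_def by blast

text \<open>A characteristic function has modulus at most 1. Positivity of the Green form is thus
  read off from the existence of the field.\<close>

lemma is_GFF_cov_form_nonneg:
  assumes "is_GFF d M \<phi>" "finite W" "W \<subseteq> lattice d"
  shows "cov_form W (green d) a a \<ge> 0"
proof -
  interpret prob_space M using assms by (simp add: is_GFF_def)
  have "cmod (integral\<^sup>L M (\<lambda>\<omega>. cis (1 * (\<Sum>x\<in>W. a x * \<phi> x \<omega>))))
     \<le> integral\<^sup>L M (\<lambda>\<omega>. cmod (cis (1 * (\<Sum>x\<in>W. a x * \<phi> x \<omega>))))"
    by (rule integral_norm_bound)
  also have "\<dots> = 1" by (simp add: prob_space)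
  finally show ?thesis unfolding is_GFF_char[OF assms] by (simp add: norm_of_real)
qed

text \<open>Conditionally on all other values, a value of the field has variance 1: test against
  the field minus the average over the neighbours.\<close>

lemma cov_form_green_ge_1:
  assumes W: "finite W" "W \<subseteq> lattice d" and d: "d \<ge> 6"
    and nb: "z \<in> W" "\<And>i. i < d \<Longrightarrow> z(i := z i + 1) \<in> W" "\<And>i. i < d \<Longrightarrow> z(i := z i - 1) \<in> W"
    and psd: "\<And>a. cov_form W (green d) a a \<ge> 0"
    and a: "a z = 1"
  shows "cov_form W (green d) a a \<ge> 1"
proof -
  define B where "B = cov_form W (green d)"
  note lin = cov_form_add_left cov_form_diff_left cov_form_scale_left
  define \<xi> where "\<xi> = (\<lambda>y. unit_fun z y - (1 / (2 * real d)) *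
     (\<Sum>i<d. unit_fun (z(i := z i + 1)) y + unit_fun (z(i := z i - 1)) y))"
  have "\<xi> z = 1"
  proof -
    have "z \<noteq> z(i := z i + 1)" "z \<noteq> z(i := z i - 1)" for i
      by (metis fun_upd_same add_cancel_right_right zero_neq_one, metis fun_upd_same diff_eq_eq add_cancel_right_right zero_neq_one)
    then show ?thesis by (simp add: \<xi>_def unit_fun_def)
  qed
  \<comment> \<open>By \<open>green_harmonic\<close> the Green operator maps \<open>\<xi>\<close> to
    the point mass at \<open>z\<close>, so pairing with \<open>\<xi>\<close> evaluates at
    \<open>z\<close>. The neighbours of \<open>z\<close> must lie in \<open>W\<close> for
    \<open>\<xi>\<close> to be supported there.\<close>
  have \<xi>: "B \<xi> b = b z" for b
  proof -
    have "B \<xi> b = (\<Sum>y\<in>W. b y * green d z y) - (1 / (2 * real d)) *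
       (\<Sum>i<d. (\<Sum>y\<in>W. b y * green d (z(i := z i + 1)) y) + (\<Sum>y\<in>W. b y * green d (z(i := z i - 1)) y))"
      unfolding B_def \<xi>_def using W(1) nb
      by (simp only: lin cov_form_sum_left cov_form_unit_left finite_lessThan)
        (simp add: cov_form_unit_left)
    also have "\<dots> = (\<Sum>y\<in>W. b y * green d z y) - (1 / (2 * real d)) *
       (\<Sum>y\<in>W. \<Sum>i<d. b y * (green d (z(i := z i + 1)) y + green d (z(i := z i - 1)) y))"
      by (subst sum.swap[of _ "{..<d}" W]) (simp add: sum.distrib distrib_left)
    also have "\<dots> = (\<Sum>y\<in>W. b y * (green d z y -
        (\<Sum>i<d. green d (z(i := z i + 1)) y + green d (z(i := z i - 1)) y) / (2 * real d)))"
      by (simp add: sum_distrib_left[symmetric] sum_subtractf right_diff_distrib sum_divide_distrib[where A = W])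
    also have "\<dots> = (\<Sum>y\<in>W. if y = z then b y else 0)"
    proof (intro sum.cong refl)
      fix y assume "y \<in> W"
      then show "b y * (green d z y -
        (\<Sum>i<d. green d (z(i := z i + 1)) y + green d (z(i := z i - 1)) y) / (2 * real d)) = (if y = z then b y else 0)"
        using green_harmonic[of z d y] subsetD[OF W(2), of z] subsetD[OF W(2), of y] nb(1) d by auto
    qed
    finally show ?thesis using W nb by simp
  qed
  have sym: "B x y = B y x" for x y
    unfolding B_def using W by (intro cov_form_sym green_sym) auto
  \<comment> \<open>Expanding the square leaves \<open>B a a - 2 a(z) + \<xi>(z)\<close>, that is
    \<open>B a a - 1\<close>.\<close>
  have "0 \<le> B (\<lambda>y. a y - \<xi> y) (\<lambda>y. a y - \<xi> y)" unfolding B_def by (rule psd)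
  also have "\<dots> = B a a - B \<xi> a - B \<xi> a + B \<xi> \<xi>"
    using sym[of a \<xi>] unfolding B_def by (simp add: cov_form_diff_left cov_form_diff_right)
  finally show ?thesis using \<xi> a \<open>\<xi> z = 1\<close> by (simp add: B_def)
qed

section \<open>From the field to a Bernoulli configuration\<close>

text \<open>Any property of a random subset of a finite set is a finite union of exact patterns, so
  measurability does not depend on the combinatorial form of \<open>G\<close>.\<close>

lemma sets_finite_pattern:
  assumes V: "finite V" and P: "\<And>x. x \<in> V \<Longrightarrow> {\<omega> \<in> space M. P x \<omega>} \<in> sets M"
  shows "{\<omega> \<in> space M. G {x \<in> V. P x \<omega>}} \<in> sets M"
proof -
  have "{\<omega> \<in> space M. {x \<in> V. P x \<omega>} = A} \<in> sets M" if "A \<subseteq> V" for A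
  proof -
    have "{\<omega> \<in> space M. {x \<in> V. P x \<omega>} = A} = {\<omega> \<in> space M. \<forall>x\<in>V. P x \<omega> \<longleftrightarrow> x \<in> A}"
      using that by auto
    also have "\<dots> \<in> sets M"
    proof (rule sets.sets_Collect_finite_All[OF _ V])
      fix x assume "x \<in> V"
      have eq: "{\<omega> \<in> space M. \<not> P x \<omega>} = space M - {\<omega> \<in> space M. P x \<omega>}" by auto
      show "{\<omega> \<in> space M. P x \<omega> \<longleftrightarrow> x \<in> A} \<in> sets M"
        using P[OF \<open>x \<in> V\<close>] by (cases "x \<in> A") (auto simp: eq)
    qed
    finally show ?thesis .
  qed
  moreover have "{\<omega> \<in> space M. G {x \<in> V. P x \<omega>}}
      = (\<Union>A\<in>{A \<in> Pow V. G A}. {\<omega> \<in> space M. {x \<in> V. P x \<omega>} = A})"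
    by auto
  ultimately show ?thesis
    using V by (auto intro!: sets.finite_UN)
qed

text \<open>Both sides give each exact pattern the same product of one-site probabilities. The
  percolation estimates can then be made entirely in \<open>Pi_pmf\<close>.\<close>

lemma (in prob_space) prob_std_normal_pattern:
  fixes X :: "'i \<Rightarrow> 'a \<Rightarrow> real"
  assumes V: "finite V" and X: "\<And>i. i \<in> V \<Longrightarrow> X i \<in> borel_measurable M"
    and cf: "\<And>t :: 'i \<Rightarrow> real. integral\<^sup>L M (\<lambda>\<omega>. cis (\<Sum>i\<in>V. t i * X i \<omega>)) = complex_of_real (exp (- (\<Sum>i\<in>V. (t i)\<^sup>2) / 2))"
  shows "measure M {\<omega> \<in> space M. G {x \<in> V. X x \<omega> \<ge> T}}
    = measure_pmf.prob (Pi_pmf V False (\<lambda>_. bernoulli_pmf (measure std_normal_distribution {T..}))) {f. G {x \<in> V. f x}}"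
proof -
  interpret N: prob_space std_normal_distribution by (rule prob_space_normal_density) simp
  define p where "p = measure std_normal_distribution {T..}"
  define D where "D = Pi_pmf V False (\<lambda>_. bernoulli_pmf p)"
  have p: "0 \<le> p" "p \<le> 1" unfolding p_def by auto
  have p1: "measure std_normal_distribution {..<T} = 1 - p"
  proof -
    have "- {T..} = {..<T}" by auto
    then show ?thesis
      unfolding p_def using N.prob_compl[of "{T..}"] by (simp add: Compl_eq_Diff_UNIV)
  qed
  have pat: "measure M {\<omega> \<in> space M. {x \<in> V. X x \<omega> \<ge> T} = A} = measure_pmf.prob D {f. {x \<in> V. f x} = A}"
    if A: "A \<subseteq> V" for A
  proof -
    have "{\<omega> \<in> space M. {x \<in> V. X x \<omega> \<ge> T} = A} = {\<omega> \<in> space M. \<forall>x\<in>V. X x \<omega> \<in> (if x \<in> A then {T..} else {..<T})}"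
      using A by (auto simp: not_le[symmetric] split: if_splits)
    then have "measure M {\<omega> \<in> space M. {x \<in> V. X x \<omega> \<ge> T} = A}
        = (\<Prod>x\<in>V. measure std_normal_distribution (if x \<in> A then {T..} else {..<T}))"
      using joint_std_normal[OF V X cf, of "\<lambda>x. if x \<in> A then {T..} else {..<T}"] by simp
    also have "\<dots> = (\<Prod>x\<in>V. measure_pmf.prob (bernoulli_pmf p) {x \<in> A})"
      using p by (intro prod.cong refl) (auto simp: measure_pmf_single p1 p_def[symmetric])
    also have "\<dots> = measure_pmf.prob D (Pi V (\<lambda>x. {x \<in> A}))"
      unfolding D_def using V by (simp add: measure_Pi_pmf_Pi)
    also have "Pi V (\<lambda>x. {x \<in> A}) = {f. {x \<in> V. f x} = A}" using A by auto
    finally show ?thesis .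
  qed
  let ?P = "{A \<in> Pow V. G A}"
  have m: "{\<omega> \<in> space M. {x \<in> V. X x \<omega> \<ge> T} = A} \<in> sets M" for A
    using X by (intro sets_finite_pattern[OF V]) auto
  have "measure M {\<omega> \<in> space M. G {x \<in> V. X x \<omega> \<ge> T}}
     = measure M (\<Union>A\<in>?P. {\<omega> \<in> space M. {x \<in> V. X x \<omega> \<ge> T} = A})"
    by (intro arg_cong[where f = "measure M"]) auto
  also have "\<dots> = (\<Sum>A\<in>?P. measure M {\<omega> \<in> space M. {x \<in> V. X x \<omega> \<ge> T} = A})"
    using V m by (intro finite_measure_finite_Union) (auto simp: disjoint_family_on_def)
  also have "\<dots> = (\<Sum>A\<in>?P. measure_pmf.prob D {f. {x \<in> V. f x} = A})"
    using pat by (intro sum.cong) auto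
  also have "\<dots> = measure_pmf.prob D (\<Union>A\<in>?P. {f. {x \<in> V. f x} = A})"
    using V by (intro measure_pmf.finite_measure_finite_Union[symmetric]) (auto simp: disjoint_family_on_def)
  also have "(\<Union>A\<in>?P. {f. {x \<in> V. f x} = A}) = {f. G {x \<in> V. f x}}" by auto
  finally show ?thesis by (simp add: D_def p_def)
qed

text \<open>If \<open>w x \<ge> T \<ge> 0\<close> and \<open>\<sigma> x \<ge> 1\<close>, then
  \<open>\<sigma> x * w x \<ge> T\<close>, and a residual of at least \<open>-s\<close> leaves at
  least \<open>max 0 h\<close>. Hence the level is truncated at 0, where multiplication by
  \<open>\<sigma> x\<close> cannot hurt; the error term is the union bound for the
  residuals.\<close>

lemma gff_dominates_bernoulli:
  assumes gff: "is_GFF d M \<phi>" and d: "d \<ge> 6" and V: "finite V" "V \<subseteq> lattice d"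
    and g: "\<And>x. x \<in> V \<Longrightarrow> green d x x \<le> 1 + v" and v: "v > 0" and s: "s > 0"
    and mono: "\<And>A B. A \<subseteq> B \<Longrightarrow> B \<subseteq> V \<Longrightarrow> G A \<Longrightarrow> G B"
  shows "measure M {\<omega> \<in> space M. G {x \<in> V. \<phi> x \<omega> \<ge> h}}
     \<ge> measure_pmf.prob (Pi_pmf V False (\<lambda>_. bernoulli_pmf (measure std_normal_distribution {max 0 h + s..})))
          {f. G {x \<in> V. f x}} - real (card V) * exp (- s\<^sup>2 / (2 * v))"
proof -
  interpret prob_space M using gff by (simp add: is_GFF_def)
  define T where "T = max 0 h + s"
  \<comment> \<open>The neighbours are added because the test function for the conditional variance
    lives on a vertex and its neighbours.\<close>
  define W where "W = V \<union> (\<Union>x\<in>V. \<Union>i<d. {x(i := x i + 1), x(i := x i - 1)})"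
  have W: "finite W" "W \<subseteq> lattice d" "V \<subseteq> W"
    unfolding W_def using V by (auto simp: lattice_def)
  define B where "B = cov_form W (green d)"
  note cfW = is_GFF_char[OF gff W(1,2)]
  have psd: "cov_form W (green d) a a \<ge> 0" for a by (rule is_GFF_cov_form_nonneg[OF gff W(1,2)])
  have "\<exists>c \<sigma> r. (\<forall>x\<in>V. \<forall>y\<in>V. cov_form W (green d) (c x) (c y) = (if x = y then 1 else 0)) \<and>
     (\<forall>x\<in>V. \<sigma> x \<ge> 1 \<and> (\<forall>w. unit_fun x w = \<sigma> x * c x w + r x w) \<and> cov_form W (green d) (r x) (r x) \<le> green d x x - 1
        \<and> (\<forall>w. w \<notin> V \<longrightarrow> c x w = 0))"
  proof (rule gram_schmidt[OF W(1) W(3) _ _ V(1) subset_refl])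
    show "green d x y = green d y x" if "x \<in> W" "y \<in> W" for x y
      using W that by (intro green_sym) auto
    show "1 \<le> cov_form W (green d) a a" if "z \<in> V" "a z = 1" for a z
      by (rule cov_form_green_ge_1[OF W(1,2) d, where z = z]) (use that psd in \<open>auto simp: W_def\<close>)
  qed
  then obtain c \<sigma> r where *: "(\<forall>x\<in>V. \<forall>y\<in>V. cov_form W (green d) (c x) (c y) = (if x = y then 1 else 0)) \<and>
     (\<forall>x\<in>V. \<sigma> x \<ge> 1 \<and> (\<forall>w. unit_fun x w = \<sigma> x * c x w + r x w) \<and> cov_form W (green d) (r x) (r x) \<le> green d x x - 1
        \<and> (\<forall>w. w \<notin> V \<longrightarrow> c x w = 0))"
    by (elim exE)
  then have GS: "\<And>x y. x \<in> V \<Longrightarrow> y \<in> V \<Longrightarrow> B (c x) (c y) = (if x = y then 1 else 0)"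
    "\<And>x. x \<in> V \<Longrightarrow> \<sigma> x \<ge> 1" "\<And>x w. x \<in> V \<Longrightarrow> unit_fun x w = \<sigma> x * c x w + r x w"
    "\<And>x. x \<in> V \<Longrightarrow> B (r x) (r x) \<le> green d x x - 1"
    by (simp_all add: B_def)
  define w where "w x \<omega> = (\<Sum>y\<in>W. c x y * \<phi> y \<omega>)" for x \<omega>
  define \<rho> where "\<rho> x \<omega> = (\<Sum>y\<in>W. r x y * \<phi> y \<omega>)" for x \<omega>
  have \<phi>m: "\<phi> x \<in> borel_measurable M" if "x \<in> W" for x
    using that gff W by (auto simp: is_GFF_def)
  have wm [measurable]: "w x \<in> borel_measurable M" and \<rho>m [measurable]: "\<rho> x \<in> borel_measurable M" for x
    unfolding w_def \<rho>_def using \<phi>m by (auto intro!: borel_measurable_sum borel_measurable_times)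
  have decomp: "\<phi> x \<omega> = \<sigma> x * w x \<omega> + \<rho> x \<omega>" if "x \<in> V" for x \<omega>
  proof -
    have "\<sigma> x * w x \<omega> + \<rho> x \<omega> = (\<Sum>y\<in>W. (\<sigma> x * c x y + r x y) * \<phi> y \<omega>)"
      unfolding w_def \<rho>_def by (simp add: sum_distrib_left sum.distrib distrib_right mult.assoc)
    also have "\<dots> = (\<Sum>y\<in>W. if y = x then \<phi> y \<omega> else 0)"
      by (intro sum.cong refl) (simp add: GS(3)[OF that, symmetric] unit_fun_def)
    finally show ?thesis using that W by auto
  qed
  have cf: "integral\<^sup>L M (\<lambda>\<omega>. cis (\<Sum>i\<in>V. t i * w i \<omega>)) = complex_of_real (exp (- (\<Sum>i\<in>V. (t i)\<^sup>2) / 2))" for t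
  proof -
    define a where "a = (\<lambda>y. \<Sum>i\<in>V. t i * c i y)"
    have "(\<Sum>i\<in>V. t i * w i \<omega>) = 1 * (\<Sum>y\<in>W. a y * \<phi> y \<omega>)" for \<omega>
      unfolding w_def a_def sum_distrib_left sum_distrib_right
      by (subst sum.swap) (simp add: mult.assoc)
    moreover have "cov_form W (green d) a a = (\<Sum>i\<in>V. (t i)\<^sup>2)"
    proof -
      have "cov_form W (green d) a a = (\<Sum>i\<in>V. \<Sum>j\<in>V. t i * (t j * B (c i) (c j)))"
        unfolding a_def B_def using V
        by (simp add: cov_form_sum_left cov_form_sum_right cov_form_scale_left cov_form_scale_right)
          (simp add: sum_distrib_left)
      also have "\<dots> = (\<Sum>i\<in>V. \<Sum>j\<in>V. if j = i then t i * t j else 0)"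
        by (intro sum.cong refl) (auto simp: GS(1))
      also have "\<dots> = (\<Sum>i\<in>V. (t i)\<^sup>2)" using V by (simp add: power2_eq_square)
      finally show ?thesis .
    qed
    ultimately show ?thesis using cfW[of 1 a] by (simp only: power_one mult_1)
  qed
  define E where "E = {\<omega> \<in> space M. G {x \<in> V. w x \<omega> \<ge> T}}"
  define R where "R x = {\<omega> \<in> space M. \<rho> x \<omega> < - s}" for x
  have R: "measure M (R x) \<le> exp (- s\<^sup>2 / (2 * v))" if "x \<in> V" for x
    unfolding R_def
  proof (rule gaussian_lower_tail[OF \<rho>m _ _ _ v s])
    show "integral\<^sup>L M (\<lambda>\<omega>. cis (t * \<rho> x \<omega>)) = complex_of_real (exp (- (t\<^sup>2 * B (r x) (r x)) / 2))" for t
      unfolding \<rho>_def B_def by (rule cfW)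
    show "0 \<le> B (r x) (r x)" unfolding B_def by (rule psd)
    show "B (r x) (r x) \<le> v" using GS(4)[OF that] g[OF that] by linarith
  qed
  have m: "E \<in> sets M" "\<And>x. R x \<in> sets M" "{\<omega> \<in> space M. G {x \<in> V. \<phi> x \<omega> \<ge> h}} \<in> sets M"
    unfolding E_def R_def using \<phi>m W by (auto intro!: sets_finite_pattern[OF V(1)])
  have "E - (\<Union>x\<in>V. R x) \<subseteq> {\<omega> \<in> space M. G {x \<in> V. \<phi> x \<omega> \<ge> h}}"
  proof
    fix \<omega> assume \<omega>: "\<omega> \<in> E - (\<Union>x\<in>V. R x)"
    have "\<phi> x \<omega> \<ge> h" if x: "x \<in> V" "w x \<omega> \<ge> T" for x
    proof -
      have "w x \<omega> \<ge> 0" using x s by (simp add: T_def)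
      then have "1 * w x \<omega> \<le> \<sigma> x * w x \<omega>" using GS(2) x by (intro mult_right_mono) auto
      moreover have "\<rho> x \<omega> \<ge> - s" using \<omega> x by (auto simp: R_def E_def)
      ultimately show ?thesis using decomp[OF x(1)] x(2) by (simp add: T_def)
    qed
    then have "{x \<in> V. w x \<omega> \<ge> T} \<subseteq> {x \<in> V. \<phi> x \<omega> \<ge> h}" by auto
    with \<omega> show "\<omega> \<in> {\<omega> \<in> space M. G {x \<in> V. \<phi> x \<omega> \<ge> h}}"
      unfolding E_def using mono[of "{x \<in> V. w x \<omega> \<ge> T}" "{x \<in> V. \<phi> x \<omega> \<ge> h}"] by auto
  qed
  then have "measure M (E - (\<Union>x\<in>V. R x)) \<le> measure M {\<omega> \<in> space M. G {x \<in> V. \<phi> x \<omega> \<ge> h}}"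
    using m by (intro finite_measure_mono) auto
  moreover have "measure M E \<le> measure M (E - (\<Union>x\<in>V. R x)) + measure M (\<Union>x\<in>V. R x)"
  proof -
    have "measure M E \<le> measure M ((E - (\<Union>x\<in>V. R x)) \<union> (\<Union>x\<in>V. R x))"
      using m V by (intro finite_measure_mono) auto
    also have "\<dots> \<le> measure M (E - (\<Union>x\<in>V. R x)) + measure M (\<Union>x\<in>V. R x)"
      using m V by (intro measure_Un_le) auto
    finally show ?thesis .
  qed
  moreover have "measure M (\<Union>x\<in>V. R x) \<le> real (card V) * exp (- s\<^sup>2 / (2 * v))"
  proof -
    have "measure M (\<Union>x\<in>V. R x) \<le> (\<Sum>x\<in>V. measure M (R x))"
      using m V by (intro measure_UNION_le) auto
    also have "\<dots> \<le> (\<Sum>x\<in>V. exp (- s\<^sup>2 / (2 * v)))" using R by (intro sum_mono) auto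
    finally show ?thesis by simp
  qed
  moreover have "measure M E = measure_pmf.prob (Pi_pmf V False (\<lambda>_. bernoulli_pmf (measure std_normal_distribution {T..})))
          {f. G {x \<in> V. f x}}"
    unfolding E_def by (rule prob_std_normal_pattern[OF V(1) wm cf])
  ultimately show ?thesis unfolding T_def by linarith
qed

section \<open>Hypercube combinatorics\<close>

text \<open>A point of \<open>{0,1}^d\<close> is coded by the set of its coordinates equal to 1, so
  that crossing an edge is \<open>flip\<close> and exchanging coordinates is set algebra.\<close>

definition cube :: "nat \<Rightarrow> nat set set" where
  "cube d = Pow {..<d}"

definition flip :: "nat set \<Rightarrow> nat \<Rightarrow> nat set" where
  "flip S i = (if i \<in> S then S - {i} else insert i S)"

lemma mem_flip: "k \<in> flip S i \<longleftrightarrow> (if k = i then i \<notin> S else k \<in> S)"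
  by (auto simp: flip_def)

lemma flip_flip [simp]: "flip (flip S i) i = S"
  by (auto simp: flip_def)

lemma flip_in_cube: "S \<in> cube d \<Longrightarrow> i < d \<Longrightarrow> flip S i \<in> cube d"
  by (auto simp: cube_def flip_def)

lemma finite_cube [simp]: "finite (cube d)"
  by (simp add: cube_def)

lemma card_cube: "card (cube d) = 2 ^ d"
  by (simp add: cube_def card_Pow)

text \<open>\<open>mix j S T\<close> is the \<open>j\<close>-th point of the path from \<open>S\<close> to \<open>T\<close> that corrects the coordinates in increasing order.\<close>

definition mix :: "nat \<Rightarrow> nat set \<Rightarrow> nat set \<Rightarrow> nat set" where
  "mix j S T = (T \<inter> {..<j}) \<union> (S - {..<j})"

lemma mix_in_cube: "S \<in> cube d \<Longrightarrow> T \<in> cube d \<Longrightarrow> mix j S T \<in> cube d"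
  by (auto simp: mix_def cube_def)

lemma mix_mix: "mix j (mix j S T) (mix j T S) = S"
  by (auto simp: mix_def)

lemma mix_Suc: "mix (Suc j) S T = mix j S T \<or> mix (Suc j) S T = flip (mix j S T) j"
  by (cases "j \<in> S \<longleftrightarrow> j \<in> T") (auto simp: mix_def flip_def less_Suc_eq)

text \<open>Exchanging the first \<open>j\<close> coordinates of \<open>S\<close> and
  \<open>T\<close> is an involution on pairs. So for uniform endpoints the \<open>j\<close>-th point
  of the path is uniform, which is the congestion estimate behind
  \<open>canonical_paths\<close>.\<close>

lemma card_mix_preimage:
  assumes "X \<subseteq> cube d"
  shows "card {(S, T) \<in> cube d \<times> cube d. mix j S T \<in> X} = card X * 2 ^ d"
proof -
  have "bij_betw (\<lambda>(S, T). (mix j S T, mix j T S)) {(S, T) \<in> cube d \<times> cube d. mix j S T \<in> X} (X \<times> cube d)"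
    by (rule bij_betw_byWitness[where f' = "\<lambda>(S, T). (mix j S T, mix j T S)"])
      (use assms in \<open>auto simp: mix_mix mix_in_cube subset_iff\<close>)
  then show ?thesis
    by (simp add: bij_betw_same_card card_cartesian_product card_cube)
qed

text \<open>Fixing the value \<open>b\<close> of coordinate \<open>j\<close> makes the edges from
  \<open>u\<close> to \<open>flip u j\<close> pairwise disjoint, hence independent under site
  percolation. A vertex lying in both sets counts too, as it links them on its own.\<close>

definition transit :: "nat \<Rightarrow> nat set set \<Rightarrow> nat set set \<Rightarrow> nat \<Rightarrow> bool \<Rightarrow> nat set set" where
  "transit d A B j b = {u \<in> cube d. (j \<in> u \<longleftrightarrow> b) \<and> u \<in> A \<and> (u \<in> B \<or> flip u j \<in> B)}"

lemma finite_transit [simp]: "finite (transit d A B j b)"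
  by (simp add: transit_def)

text \<open>On the path from a point of \<open>A\<close> to a point of \<open>B\<close>, the vertex
  just before the first visit to \<open>B\<close> either lies outside both sets or is in transit. At
  each of the \<open>d + 1\<close> times a given vertex is used by \<open>2 ^ d\<close> pairs of
  endpoints.\<close>

lemma canonical_paths:
  assumes A: "A \<subseteq> cube d" and B: "B \<subseteq> cube d" and d: "d \<ge> 1"
  shows "card A * card B \<le> (d + 1) * 2 ^ d * (card (cube d - (A \<union> B)) + card (\<Union>j<d. \<Union>b. transit d A B j b))"
proof -
  define Tr where "Tr = (\<Union>j<d. \<Union>b. transit d A B j b)"
  define X where "X = (cube d - (A \<union> B)) \<union> Tr"
  have X: "X \<subseteq> cube d" by (auto simp: X_def Tr_def transit_def)
  have Tr: "finite Tr" by (rule finite_subset[of _ "cube d"]) (auto simp: Tr_def transit_def)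
  have "A \<times> B \<subseteq> (\<Union>j\<in>{..d}. {(S, T) \<in> cube d \<times> cube d. mix j S T \<in> X})"
  proof safe
    fix S T assume S: "S \<in> A" and T: "T \<in> B"
    have cub: "S \<in> cube d" "T \<in> cube d" using S T A B by auto
    have "mix d S T = T" using cub by (auto simp: mix_def cube_def)
    then have ex: "mix d S T \<in> B" using T by simp
    define k where "k = (LEAST k. mix k S T \<in> B)"
    have k: "mix k S T \<in> B" "k \<le> d"
      unfolding k_def using ex by (auto intro: LeastI Least_le)
    have below: "mix j S T \<notin> B" if "j < k" for j
      using that not_less_Least unfolding k_def by blast
    have "\<exists>j\<le>d. mix j S T \<in> X"
    proof (cases k)
      \<comment> \<open>The path starts in \<open>B\<close> already; its start is then recorded in
        direction 0, which exists as \<open>d \<ge> 1\<close>.\<close>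
      case 0
      then have "mix 0 S T = S" "S \<in> B" using k by (auto simp: mix_def)
      then have "S \<in> transit d A B 0 (0 \<in> S)" using S cub by (auto simp: transit_def)
      then have "S \<in> X" using d unfolding X_def Tr_def by (intro UnI2 UN_I[of 0] UN_I) auto
      then show ?thesis using \<open>mix 0 S T = S\<close> by auto
    next
      case (Suc j)
      have nb: "mix j S T \<notin> B" using below Suc by simp
      have "mix j S T \<in> X"
      proof (cases "mix j S T \<in> A")
        case True
        have "flip (mix j S T) j \<in> B" using mix_Suc[of j S T] k nb Suc by auto
        then have "mix j S T \<in> transit d A B j (j \<in> mix j S T)"
          using True A by (auto simp: transit_def)
        then show ?thesis using k Suc unfolding X_def Tr_def by (intro UnI2 UN_I[of j] UN_I) auto
      next
        case False
        then show ?thesis using nb mix_in_cube[OF cub] by (auto simp: X_def)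
      qed
      then show ?thesis using Suc k by (intro exI[of _ j]) auto
    qed
    then show "(S, T) \<in> (\<Union>j\<in>{..d}. {(S, T) \<in> cube d \<times> cube d. mix j S T \<in> X})"
      using cub by auto
  qed
  then have "card (A \<times> B) \<le> card (\<Union>j\<in>{..d}. {(S, T) \<in> cube d \<times> cube d. mix j S T \<in> X})"
    by (rule card_mono[rotated]) (auto intro: finite_subset[of _ "cube d \<times> cube d"])
  also have "\<dots> \<le> (\<Sum>j\<in>{..d}. card {(S, T) \<in> cube d \<times> cube d. mix j S T \<in> X})"
    by (rule card_UN_le) auto
  also have "\<dots> = (d + 1) * (card X * 2 ^ d)" unfolding card_mix_preimage[OF X] by simp
  finally have "card A * card B \<le> (d + 1) * 2 ^ d * card X"
    unfolding card_cartesian_product by (simp only: mult_ac)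
  also have "\<dots> \<le> (d + 1) * 2 ^ d * (card (cube d - (A \<union> B)) + card Tr)"
    unfolding X_def by (intro mult_le_mono2 card_Un_le)
  finally show ?thesis unfolding Tr_def .
qed

lemma transit_pigeonhole:
  assumes d: "d \<ge> 1"
  shows "\<exists>j<d. \<exists>b. card (\<Union>j<d. \<Union>b. transit d A B j b) \<le> 2 * d * card (transit d A B j b)"
proof (rule ccontr)
  define c where "c = card (\<Union>j<d. \<Union>b. transit d A B j b)"
  assume "\<not> ?thesis"
  then have lt: "2 * d * card (transit d A B j b) < c" if "j < d" for j b
    using that by (auto simp: c_def not_le)
  have "c \<le> (\<Sum>j<d. card (\<Union>b. transit d A B j b))"
    unfolding c_def by (rule card_UN_le) auto
  also have "\<dots> \<le> (\<Sum>j<d. \<Sum>b\<in>UNIV. card (transit d A B j b))"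
    by (intro sum_mono card_UN_le) auto
  finally have "2 * d * c \<le> (\<Sum>j<d. \<Sum>b\<in>UNIV. 2 * d * card (transit d A B j b))"
    by (simp add: sum_distrib_left[symmetric])
  also have "\<dots> < (\<Sum>j<d. \<Sum>b\<in>(UNIV::bool set). c)"
    using lt d by (intro sum_strict_mono) (auto simp: lessThan_empty_iff)
  also have "\<dots> = 2 * d * c" by simp
  finally show False by simp
qed

section \<open>Independence in finite product measures\<close>

text \<open>\<open>loc\<close> says that \<open>E l\<close> reads only the coordinates in
  \<open>K l\<close>. The blocks will be single vertices, pairs of vertices and images of
  subcubes.\<close>

lemma Pi_pmf_disjoint_blocks:
  fixes E :: "'l \<Rightarrow> ('v \<Rightarrow> bool) \<Rightarrow> bool"
  assumes V: "finite V" and L: "finite L" and K: "\<And>l. l \<in> L \<Longrightarrow> K l \<subseteq> V"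
    and disj: "disjoint_family_on K L"
    and loc: "\<And>l f g. l \<in> L \<Longrightarrow> (\<And>x. x \<in> K l \<Longrightarrow> f x = g x) \<Longrightarrow> E l f = E l g"
  shows "measure_pmf.prob (Pi_pmf V dflt p) {f. \<forall>l\<in>L. E l f} = (\<Prod>l\<in>L. measure_pmf.prob (Pi_pmf V dflt p) {f. E l f})"
proof (cases "L = {}")
  case True
  then show ?thesis by simp
next
  case False
  define D where "D = Pi_pmf V dflt p"
  have "prob_space.indep_vars (measure_pmf D) (\<lambda>_. count_space UNIV) (\<lambda>x f. f x) V"
    unfolding D_def using V by (rule indep_vars_Pi_pmf)
  from prob_space.indep_vars_restrict[OF measure_pmf.prob_space_axioms this K disj]
  have ind: "prob_space.indep_vars (measure_pmf D) (\<lambda>j. PiM (K j) (\<lambda>_. count_space (UNIV :: bool set))) (\<lambda>j \<omega>. restrict (\<lambda>i. \<omega> i) (K j)) L" .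
  define A where "A l = {g \<in> PiE (K l) (\<lambda>_. UNIV). E l g}" for l
  have pre: "(\<lambda>\<omega>. restrict (\<lambda>i. \<omega> i) (K l)) -` A l \<inter> space (measure_pmf D) = {f. E l f}" if "l \<in> L" for l
    using loc[OF that, of "restrict _ (K l)"] by (auto simp: A_def)
  have sets: "A l \<in> sets (PiM (K l) (\<lambda>_. count_space (UNIV :: bool set)))" if "l \<in> L" for l
    using finite_subset[OF K[OF that] V] by (subst count_space_PiM_finite) (auto simp: A_def)
  have "measure_pmf.prob D (\<Inter>l\<in>L. (\<lambda>\<omega>. restrict (\<lambda>i. \<omega> i) (K l)) -` A l \<inter> space (measure_pmf D))
      = (\<Prod>l\<in>L. measure_pmf.prob D ((\<lambda>\<omega>. restrict (\<lambda>i. \<omega> i) (K l)) -` A l \<inter> space (measure_pmf D)))"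
    by (rule prob_space.indep_varsD[OF measure_pmf.prob_space_axioms ind False L subset_refl]) (rule sets)
  also have "(\<Inter>l\<in>L. (\<lambda>\<omega>. restrict (\<lambda>i. \<omega> i) (K l)) -` A l \<inter> space (measure_pmf D)) = {f. \<forall>l\<in>L. E l f}"
    using pre False by auto
  also have "(\<Prod>l\<in>L. measure_pmf.prob D ((\<lambda>\<omega>. restrict (\<lambda>i. \<omega> i) (K l)) -` A l \<inter> space (measure_pmf D))) = (\<Prod>l\<in>L. measure_pmf.prob D {f. E l f})"
    by (intro prod.cong refl) (simp only: pre)
  finally show ?thesis unfolding D_def .
qed

lemma Pi_pmf_bernoulli_coord:
  assumes "finite V" "x \<in> V" "0 \<le> p" "p \<le> 1"
  shows "measure_pmf.prob (Pi_pmf V False (\<lambda>_. bernoulli_pmf p)) {f. f x} = p"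
proof -
  have "measure_pmf.prob (Pi_pmf V False (\<lambda>_. bernoulli_pmf p)) {f. f x}
     = measure_pmf.prob (map_pmf (\<lambda>f. f x) (Pi_pmf V False (\<lambda>_. bernoulli_pmf p))) {True}"
    by (simp add: vimage_def)
  also have "\<dots> = p" using assms by (simp add: Pi_pmf_component measure_pmf_single)
  finally show ?thesis .
qed

lemma prob_no_open_pair:
  assumes V: "finite V" and U: "finite U" and a: "inj_on a U" "a ` U \<subseteq> V" and b: "inj_on b U" "b ` U \<subseteq> V"
    and ab: "a ` U \<inter> b ` U = {}" and q: "0 \<le> q" "q \<le> 1"
  shows "measure_pmf.prob (Pi_pmf V False (\<lambda>_. bernoulli_pmf q)) {f. \<forall>u\<in>U. \<not> (f (a u) \<and> f (b u))} = (1 - q\<^sup>2) ^ card U"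
proof -
  define D where "D = Pi_pmf V False (\<lambda>_. bernoulli_pmf q)"
  have one: "measure_pmf.prob D {f. \<not> (f (a u) \<and> f (b u))} = 1 - q\<^sup>2" if "u \<in> U" for u
  proof -
    have ne: "a u \<noteq> b u" using ab that by blast
    have "measure_pmf.prob D {f. \<forall>z\<in>{a u, b u}. f z} = (\<Prod>z\<in>{a u, b u}. measure_pmf.prob D {f. f z})"
      unfolding D_def
      by (rule Pi_pmf_disjoint_blocks[where K = "\<lambda>z. {z}"]) (use V a b that in \<open>auto simp: disjoint_family_on_def\<close>)
    also have "\<dots> = q\<^sup>2"
      unfolding D_def using ne V a b that q
      by (simp add: Pi_pmf_bernoulli_coord power2_eq_square image_subset_iff)
    finally have "measure_pmf.prob D {f. f (a u) \<and> f (b u)} = q\<^sup>2" by simp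
    then show ?thesis
      using measure_pmf.prob_compl[of "{f. f (a u) \<and> f (b u)}" D]
      by (simp add: Compl_eq_Diff_UNIV[symmetric] Collect_neg_eq[symmetric])
  qed
  have "measure_pmf.prob D {f. \<forall>u\<in>U. \<not> (f (a u) \<and> f (b u))}
     = (\<Prod>u\<in>U. measure_pmf.prob D {f. \<not> (f (a u) \<and> f (b u))})"
    unfolding D_def
  proof (rule Pi_pmf_disjoint_blocks[where K = "\<lambda>u. {a u, b u}"])
    show "disjoint_family_on (\<lambda>u. {a u, b u}) U"
      unfolding disjoint_family_on_def
    proof (intro ballI impI)
      fix m n assume "m \<in> U" "n \<in> U" "m \<noteq> n"
      then have "a m \<noteq> a n" "b m \<noteq> b n"
        using a b by (simp_all add: inj_on_eq_iff)
      moreover have "a m \<noteq> b n" "a n \<noteq> b m"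
        using ab \<open>m \<in> U\<close> \<open>n \<in> U\<close> by blast+
      ultimately show "{a m, b m} \<inter> {a n, b n} = {}" by auto
    qed
  qed (use V U a b in auto)
  also have "\<dots> = (\<Prod>u\<in>U. 1 - q\<^sup>2)" by (intro prod.cong refl one)
  also have "\<dots> = (1 - q\<^sup>2) ^ card U" by simp
  finally show ?thesis by (simp add: D_def)
qed

section \<open>First stage: large clusters near most vertices\<close>

text \<open>A regular tree of open vertices: at level \<open>k\<close> one flips coordinates from the \<open>k\<close>-th batch of \<open>N\<close> blocks
  of length \<open>s\<close>, so that different branches live on disjoint subcubes and are independent.\<close>

primrec tree :: "nat \<Rightarrow> nat \<Rightarrow> (nat set \<Rightarrow> bool) \<Rightarrow> nat \<Rightarrow> nat set \<Rightarrow> bool" where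
  "tree N s g 0 v = True"
| "tree N s g (Suc k) v = (\<forall>l<N. \<exists>i\<in>{(k * N + l) * s..<(k * N + l + 1) * s}. g (flip v i) \<and> tree N s g k (flip v i))"

definition subcube :: "nat \<Rightarrow> nat set \<Rightarrow> nat set set" where
  "subcube m v = {u. \<forall>i\<ge>m. i \<in> u \<longleftrightarrow> i \<in> v}"

lemma subcube_self: "v \<in> subcube m v"
  by (simp add: subcube_def)

lemma block_bounds:
  fixes i :: nat
  assumes "l < N" "i \<in> {(k * N + l) * s..<(k * N + l + 1) * s}"
  shows "k * N * s \<le> i" "i < Suc k * N * s"
proof -
  have "k * N * s \<le> (k * N + l) * s" by (simp add: algebra_simps)
  then show "k * N * s \<le> i" using assms(2) by (meson atLeastLessThan_iff le_trans)
  have "(k * N + l + 1) * s \<le> (Suc k * N) * s" using assms(1) by (intro mult_le_mono1) simp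
  then show "i < Suc k * N * s" using assms(2) by (meson atLeastLessThan_iff less_le_trans)
qed

lemma subcube_flip_mono:
  assumes "m \<le> i" "i < m'"
  shows "subcube m (flip v i) \<subseteq> subcube m' v - {v}"
proof
  fix u assume u: "u \<in> subcube m (flip v i)"
  have "j \<in> u \<longleftrightarrow> j \<in> v" if "j \<ge> m'" for j
    using u that assms by (auto simp: subcube_def mem_flip)
  moreover have "u \<noteq> v" using u assms by (auto simp: subcube_def mem_flip)
  ultimately show "u \<in> subcube m' v - {v}" by (auto simp: subcube_def)
qed

lemma subcube_flip_disjoint:
  assumes "m \<le> i" "m \<le> j" "i \<noteq> j"
  shows "subcube m (flip v i) \<inter> subcube m (flip v j) = {}"
proof -
  have False if "u \<in> subcube m (flip v i)" "u \<in> subcube m (flip v j)" for u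
  proof -
    have "i \<in> u \<longleftrightarrow> i \<in> flip v i" "i \<in> u \<longleftrightarrow> i \<in> flip v j" using that assms by (auto simp: subcube_def)
    then show False using assms by (auto simp: mem_flip)
  qed
  then show ?thesis by auto
qed

lemma subcube_cube:
  assumes "v \<in> cube d" "m \<le> d"
  shows "subcube m v \<subseteq> cube d"
proof
  fix u assume u: "u \<in> subcube m v"
  have "i < d" if "i \<in> u" for i
  proof (rule ccontr)
    assume "\<not> i < d"
    then have "i \<in> v" using that u assms(2) by (auto simp: subcube_def)
    then show False using assms(1) \<open>\<not> i < d\<close> by (auto simp: cube_def)
  qed
  then show "u \<in> cube d" by (auto simp: cube_def)
qed

text \<open>Each level flips a coordinate that the levels below it never touch, so the tree does not
  come back to \<open>v\<close>. Excluding the root makes the state of a child independent of the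
  tree hanging from it.\<close>

lemma tree_cong:
  assumes "\<And>u. u \<in> subcube (k * N * s) v - {v} \<Longrightarrow> g u = g' u"
  shows "tree N s g k v = tree N s g' k v"
  using assms
proof (induction k arbitrary: v)
  case (Suc k)
  have "(g (flip v i) \<and> tree N s g k (flip v i)) = (g' (flip v i) \<and> tree N s g' k (flip v i))"
    if "l < N" "i \<in> {(k * N + l) * s..<(k * N + l + 1) * s}" for l i
  proof -
    have sub: "subcube (k * N * s) (flip v i) \<subseteq> subcube (Suc k * N * s) v - {v}"
      using block_bounds[OF that] by (rule subcube_flip_mono)
    have "g (flip v i) = g' (flip v i)" using sub Suc.prems subcube_self by blast
    moreover have "tree N s g k (flip v i) = tree N s g' k (flip v i)"
      using sub Suc.prems by (intro Suc.IH) blast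
    ultimately show ?thesis by simp
  qed
  then show ?case by (simp only: tree.simps) (metis (no_types, lifting))
qed simp

section \<open>Connection inside a set, and clusters found by the tree\<close>

lemma conn_in_refl: "u \<in> A \<Longrightarrow> conn_in d A u u"
  by (simp add: conn_in_def)

lemma conn_in_step: "u \<in> A \<Longrightarrow> adj d u w \<Longrightarrow> conn_in d A w v \<Longrightarrow> conn_in d A u v"
  unfolding conn_in_def by (auto intro: converse_rtranclp_into_rtranclp)

lemma conn_in_trans: "conn_in d A u v \<Longrightarrow> conn_in d A v w \<Longrightarrow> conn_in d A u w"
  unfolding conn_in_def by auto

lemma conn_in_mem: "conn_in d A u v \<Longrightarrow> v \<in> A"
  unfolding conn_in_def by (auto elim: rtranclp.cases)

lemma adj_sym: "adj d u v \<Longrightarrow> adj d v u"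
  unfolding adj_def by (auto simp: abs_minus_commute)

lemma conn_in_sym: "conn_in d A u v \<Longrightarrow> conn_in d A v u"
proof -
  assume c: "conn_in d A u v"
  have "(\<lambda>p q. p \<in> A \<and> q \<in> A \<and> adj d p q)\<^sup>*\<^sup>* v u"
    by (rule sympD[OF symp_rtranclp]) (use c in \<open>auto simp: symp_def adj_sym conn_in_def\<close>)
  then show ?thesis using conn_in_mem[OF c] by (simp add: conn_in_def)
qed

lemma conn_in_mono: "conn_in d A u v \<Longrightarrow> A \<subseteq> B \<Longrightarrow> conn_in d B u v"
  unfolding conn_in_def by (auto elim!: rtranclp_mono[THEN predicate2D, rotated])

text \<open>Only the \<open>N ^ k\<close> leaves are counted; they are distinct because different
  children explore disjoint subcubes. Openness of the root appears as a premise inside the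
  conclusion, since \<open>tree\<close> says nothing about \<open>v\<close> itself.\<close>

lemma tree_large_cluster:
  assumes adj: "\<And>S i. S \<in> cube d \<Longrightarrow> i < d \<Longrightarrow> adj d (\<iota> S) (\<iota> (flip S i))"
    and \<Omega>: "\<And>S. S \<in> cube d \<Longrightarrow> g S \<Longrightarrow> \<iota> S \<in> \<Omega>"
    and "tree N s g k v" "v \<in> cube d" "k * N * s \<le> d"
  shows "\<exists>X \<subseteq> subcube (k * N * s) v. finite X \<and> card X = N ^ k \<and> (\<iota> v \<in> \<Omega> \<longrightarrow> (\<forall>u\<in>X. conn_in d \<Omega> (\<iota> v) (\<iota> u)))"
  using assms(3-)
proof (induction k arbitrary: v)
  case 0
  then show ?case by (intro exI[of _ "{v}"]) (auto simp: subcube_self conn_in_refl)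
next
  case (Suc k)
  let ?B = "\<lambda>l. {(k * N + l) * s..<(k * N + l + 1) * s}"
  have "k * N * s \<le> Suc k * N * s" by (intro mult_le_mono1) simp
  then have kd: "k * N * s \<le> d" using Suc.prems(3) by (rule le_trans)
  have "\<forall>l\<in>{..<N}. \<exists>i. i \<in> ?B l \<and> g (flip v i) \<and> tree N s g k (flip v i)"
    using Suc.prems(1) unfolding tree.simps Bex_def by blast
  from bchoice[OF this] obtain c where c: "\<And>l. l < N \<Longrightarrow> c l \<in> ?B l" "\<And>l. l < N \<Longrightarrow> g (flip v (c l))"
    "\<And>l. l < N \<Longrightarrow> tree N s g k (flip v (c l))"
    by (metis (no_types, lifting) lessThan_iff)
  have cb: "k * N * s \<le> c l" "c l < Suc k * N * s" "c l < d" if "l < N" for l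
    using block_bounds[OF that c(1)[OF that]] less_le_trans[OF _ Suc.prems(3)] by blast+
  have fc: "flip v (c l) \<in> cube d" if "l < N" for l using cb[OF that] Suc.prems(2) by (intro flip_in_cube)
  have inj: "c l \<noteq> c l'" if "l < l'" "l' < N" for l l'
  proof -
    have "(k * N + l + 1) * s \<le> (k * N + l') * s" using that by (intro mult_le_mono1) simp
    then show ?thesis using c(1)[of l] c(1)[of l'] that by force
  qed
  have "\<forall>l\<in>{..<N}. \<exists>X. X \<subseteq> subcube (k * N * s) (flip v (c l)) \<and> finite X \<and> card X = N ^ k \<and>
     (\<forall>u\<in>X. conn_in d \<Omega> (\<iota> (flip v (c l))) (\<iota> u))"
  proof
    fix l assume "l \<in> {..<N}"
    then have l: "l < N" by simp
    from Suc.IH[OF c(3)[OF l] fc[OF l] kd] obtain X where "X \<subseteq> subcube (k * N * s) (flip v (c l))"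
      "finite X" "card X = N ^ k" "\<iota> (flip v (c l)) \<in> \<Omega> \<longrightarrow> (\<forall>u\<in>X. conn_in d \<Omega> (\<iota> (flip v (c l))) (\<iota> u))"
      by (elim exE conjE)
    with \<Omega>[OF fc[OF l] c(2)[OF l]]
    show "\<exists>X. X \<subseteq> subcube (k * N * s) (flip v (c l)) \<and> finite X \<and> card X = N ^ k \<and>
       (\<forall>u\<in>X. conn_in d \<Omega> (\<iota> (flip v (c l))) (\<iota> u))"
      by (intro exI[of _ X]) simp
  qed
  from bchoice[OF this] obtain X where X: "\<And>l. l < N \<Longrightarrow> X l \<subseteq> subcube (k * N * s) (flip v (c l))" "\<And>l. l < N \<Longrightarrow> finite (X l)"
    "\<And>l. l < N \<Longrightarrow> card (X l) = N ^ k" "\<And>l u. l < N \<Longrightarrow> u \<in> X l \<Longrightarrow> conn_in d \<Omega> (\<iota> (flip v (c l))) (\<iota> u)"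
    by auto
  have disj: "X l \<inter> X l' = {}" if "l < N" "l' < N" "l \<noteq> l'" for l l'
  proof -
    have "c l \<noteq> c l'" using inj[of l l'] inj[of l' l] that by (cases "l < l'") auto
    then show ?thesis using subcube_flip_disjoint[of "k * N * s" "c l" "c l'" v] cb that X(1)[of l] X(1)[of l'] by blast
  qed
  show ?case
  proof (intro exI[of _ "\<Union>l<N. X l"] conjI impI ballI)
    show "(\<Union>l<N. X l) \<subseteq> subcube (Suc k * N * s) v"
      using X(1) cb subcube_flip_mono by fastforce
    show "finite (\<Union>l<N. X l)" using X by auto
    have "card (\<Union>l<N. X l) = (\<Sum>l<N. card (X l))"
      using X disj by (intro card_UN_disjoint) auto
    then show "card (\<Union>l<N. X l) = N ^ Suc k" using X by simp
    fix u assume v: "\<iota> v \<in> \<Omega>" and "u \<in> (\<Union>l<N. X l)"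
    then obtain l where l: "l < N" "u \<in> X l" by auto
    show "conn_in d \<Omega> (\<iota> v) (\<iota> u)"
      by (rule conn_in_step[OF v adj[OF Suc.prems(2) cb(3)[OF l(1)]] X(4)[OF l]])
  qed
qed

text \<open>The bound does not deteriorate with the depth: \<open>half\<close> keeps each subtree
  alive with probability at least 1/2, so a candidate child is usable with probability at least
  \<open>p / 2\<close>, independently of the other candidates in its block. A block of
  \<open>s\<close> candidates fails with probability at most \<open>(1 - p / 2) ^ s\<close>, and
  there are \<open>N\<close> blocks.\<close>

lemma prob_not_tree:
  assumes V: "finite V" and \<iota>: "inj_on \<iota> (cube d)" "\<iota> ` cube d \<subseteq> V" and p: "0 \<le> p" "p \<le> 1"
    and half: "real N * (1 - p / 2) ^ s \<le> 1 / 2"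
    and "v \<in> cube d" "k * N * s \<le> d"
  shows "measure_pmf.prob (Pi_pmf V False (\<lambda>_. bernoulli_pmf p)) {f. \<not> tree N s (\<lambda>S. f (\<iota> S)) k v}
     \<le> real N * (1 - p / 2) ^ s"
  using assms(7-)
proof (induction k arbitrary: v)
  case 0
  then show ?case using p by simp
next
  case (Suc k)
  define D where "D = Pi_pmf V False (\<lambda>_. bernoulli_pmf p)"
  define m where "m = k * N * s"
  define F where "F f i \<longleftrightarrow> f (\<iota> (flip v i)) \<and> tree N s (\<lambda>S. f (\<iota> S)) k (flip v i)" for f i
  let ?B = "\<lambda>l. {(k * N + l) * s..<(k * N + l + 1) * s}"
  have "k * N * s \<le> Suc k * N * s" by (intro mult_le_mono1) simp
  then have kd: "k * N * s \<le> d" using Suc.prems(2) by (rule le_trans)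
  have cb: "m \<le> i" "i < Suc k * N * s" "i < d" if "l < N" "i \<in> ?B l" for l i
    using block_bounds[OF that] less_le_trans[OF _ Suc.prems(2)] unfolding m_def by blast+
  have fc: "flip v i \<in> cube d" if "l < N" "i \<in> ?B l" for l i
    using cb[OF that] Suc.prems(1) by (intro flip_in_cube)
  have sc: "subcube m (flip v i) \<subseteq> cube d" if "l < N" "i \<in> ?B l" for l i
    unfolding m_def by (rule subcube_cube[OF fc[OF that] kd])
  have one: "measure_pmf.prob D {f. \<not> F f i} \<le> 1 - p / 2" if li: "l < N" "i \<in> ?B l" for l i
  proof -
    define c where "c = flip v i"
    \<comment> \<open>The two Boolean values index two independent blocks: the child itself and its
      subcube without it.\<close>
    define E where "E b f \<longleftrightarrow> (if b then f (\<iota> c) else tree N s (\<lambda>S. f (\<iota> S)) k c)" for b f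
    define K where "K b = (if b then {\<iota> c} else \<iota> ` (subcube m c - {c}))" for b
    have cc: "c \<in> cube d" "subcube m c \<subseteq> cube d" using fc[OF li] sc[OF li] by (auto simp: c_def)
    have "measure_pmf.prob D {f. \<forall>b\<in>UNIV. E b f} = (\<Prod>b\<in>UNIV. measure_pmf.prob D {f. E b f})"
      unfolding D_def
    proof (rule Pi_pmf_disjoint_blocks[where K = K])
      show "K b \<subseteq> V" for b using \<iota> cc by (auto simp: K_def)
      have "\<iota> c \<notin> \<iota> ` (subcube m c - {c})" using \<iota>(1) cc by (auto simp: inj_on_def)
      then show "disjoint_family_on K UNIV"
        unfolding disjoint_family_on_def by (auto simp: K_def split: if_splits)
      show "E b f = E b g" if "\<And>x. x \<in> K b \<Longrightarrow> f x = g x" for b f g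
      proof (cases b)
        case False
        then have "tree N s (\<lambda>S. f (\<iota> S)) k c = tree N s (\<lambda>S. g (\<iota> S)) k c"
          using that by (intro tree_cong) (auto simp: K_def m_def)
        then show ?thesis using False by (simp add: E_def)
      qed (use that in \<open>auto simp: E_def K_def\<close>)
    qed (use V in auto)
    also have "\<dots> = p * measure_pmf.prob D {f. tree N s (\<lambda>S. f (\<iota> S)) k c}"
      unfolding UNIV_bool E_def D_def using V \<iota> cc p
      by (simp add: Pi_pmf_bernoulli_coord image_subset_iff)
    also have "{f. \<forall>b\<in>UNIV. E b f} = {f. F f i}"
      by (auto simp: UNIV_bool E_def F_def c_def)
    finally have "measure_pmf.prob D {f. F f i} = p * measure_pmf.prob D {f. tree N s (\<lambda>S. f (\<iota> S)) k c}" .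
    moreover have "measure_pmf.prob D {f. tree N s (\<lambda>S. f (\<iota> S)) k c} \<ge> 1 / 2"
    proof -
      have "measure_pmf.prob D {f. \<not> tree N s (\<lambda>S. f (\<iota> S)) k c} \<le> 1 / 2"
        using Suc.IH[OF cc(1) kd] half unfolding D_def by linarith
      then show ?thesis
        using measure_pmf.prob_compl[of "{f. tree N s (\<lambda>S. f (\<iota> S)) k c}" D]
        by (simp add: Compl_eq_Diff_UNIV[symmetric] Collect_neg_eq[symmetric])
    qed
    ultimately have "measure_pmf.prob D {f. F f i} \<ge> p * (1 / 2)"
      using p by (simp only: mult_left_mono)
    then show ?thesis
      using measure_pmf.prob_compl[of "{f. F f i}" D]
      by (simp add: Compl_eq_Diff_UNIV[symmetric] Collect_neg_eq[symmetric])
  qed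
  have blk: "measure_pmf.prob D {f. \<forall>i\<in>?B l. \<not> F f i} \<le> (1 - p / 2) ^ s" if l: "l < N" for l
  proof -
    have "measure_pmf.prob D {f. \<forall>i\<in>?B l. \<not> F f i} = (\<Prod>i\<in>?B l. measure_pmf.prob D {f. \<not> F f i})"
      unfolding D_def
    proof (rule Pi_pmf_disjoint_blocks[where K = "\<lambda>i. \<iota> ` subcube m (flip v i)"])
      show "\<iota> ` subcube m (flip v i) \<subseteq> V" if "i \<in> ?B l" for i using sc[OF l that] \<iota> by auto
      show "disjoint_family_on (\<lambda>i. \<iota> ` subcube m (flip v i)) (?B l)"
        unfolding disjoint_family_on_def
      proof (intro ballI impI)
        fix i j assume ij: "i \<in> ?B l" "j \<in> ?B l" "i \<noteq> j"
        have "subcube m (flip v i) \<inter> subcube m (flip v j) = {}"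
          using cb(1)[OF l ij(1)] cb(1)[OF l ij(2)] ij(3) by (rule subcube_flip_disjoint)
        then show "\<iota> ` subcube m (flip v i) \<inter> \<iota> ` subcube m (flip v j) = {}"
          using inj_on_image_Int[OF \<iota>(1) sc[OF l ij(1)] sc[OF l ij(2)]] by simp
      qed
      show "(\<not> F f i) = (\<not> F g i)" if "i \<in> ?B l" "\<And>x. x \<in> \<iota> ` subcube m (flip v i) \<Longrightarrow> f x = g x" for i f g
      proof -
        have "f (\<iota> (flip v i)) = g (\<iota> (flip v i))" using that(2) subcube_self by blast
        moreover have "tree N s (\<lambda>S. f (\<iota> S)) k (flip v i) = tree N s (\<lambda>S. g (\<iota> S)) k (flip v i)"
          using that(2) by (intro tree_cong) (auto simp: m_def)
        ultimately show ?thesis by (simp add: F_def)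
      qed
    qed (use V in auto)
    also have "\<dots> \<le> (\<Prod>i\<in>?B l. 1 - p / 2)" using one[OF l] by (intro prod_mono) auto
    also have "\<dots> = (1 - p / 2) ^ s" by simp
    finally show ?thesis .
  qed
  have "{f. \<not> tree N s (\<lambda>S. f (\<iota> S)) (Suc k) v} = (\<Union>l<N. {f. \<forall>i\<in>?B l. \<not> F f i})"
    by (auto simp: F_def)
  then have "measure_pmf.prob D {f. \<not> tree N s (\<lambda>S. f (\<iota> S)) (Suc k) v} = measure_pmf.prob D (\<Union>l<N. {f. \<forall>i\<in>?B l. \<not> F f i})"
    by simp
  also have "\<dots> \<le> (\<Sum>l<N. measure_pmf.prob D {f. \<forall>i\<in>?B l. \<not> F f i})"
    by (rule measure_pmf.finite_measure_subadditive_finite) auto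
  also have "\<dots> \<le> (\<Sum>l<N. (1 - p / 2) ^ s)" using blk by (intro sum_mono) auto
  finally show ?case by (simp add: D_def)
qed

section \<open>Second stage: sprinkling\<close>

definition box_pt :: "(nat \<Rightarrow> int) \<Rightarrow> nat set \<Rightarrow> nat \<Rightarrow> int" where
  "box_pt x S = (\<lambda>i. 2 * x i + (if i \<in> S then 1 else 0))"

lemma inj_box_pt: "inj_on (box_pt x) A"
proof (rule inj_onI)
  fix S T assume eq: "box_pt x S = box_pt x T"
  have "i \<in> S \<longleftrightarrow> i \<in> T" for i
    using fun_cong[OF eq, of i] by (auto simp: box_pt_def split: if_splits)
  then show "S = T" by blast
qed

lemma box_pt_lattice: "x \<in> lattice d \<Longrightarrow> S \<in> cube d \<Longrightarrow> box_pt x S \<in> lattice d"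
  by (auto simp: lattice_def box_pt_def cube_def)

lemma Hbox_eq_image:
  assumes "x \<in> lattice d"
  shows "Hbox d x = box_pt x ` cube d"
proof
  show "box_pt x ` cube d \<subseteq> Hbox d x"
    using box_pt_lattice[OF assms] by (auto simp: Hbox_def) (auto simp: box_pt_def)
  show "Hbox d x \<subseteq> box_pt x ` cube d"
  proof
    fix y assume y: "y \<in> Hbox d x"
    define S where "S = {i. i < d \<and> y i = 2 * x i + 1}"
    have "y = box_pt x S"
    proof
      fix i
      show "y i = box_pt x S i"
        using y assms by (cases "i < d") (auto simp: Hbox_def box_pt_def S_def lattice_def)
    qed
    then show "y \<in> box_pt x ` cube d" by (auto simp: S_def cube_def)
  qed
qed

lemma card_Hbox: "x \<in> lattice d \<Longrightarrow> card (Hbox d x) = 2 ^ d"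
  by (simp add: Hbox_eq_image card_image[OF inj_box_pt] card_cube)

lemma finite_Hbox: "x \<in> lattice d \<Longrightarrow> finite (Hbox d x)"
  by (simp add: Hbox_eq_image)

lemma Hbox_disjoint:
  assumes "x \<in> lattice d" "y \<in> lattice d" "x \<noteq> y"
  shows "Hbox d x \<inter> Hbox d y = {}"
proof -
  obtain i where i: "x i \<noteq> y i" using assms by blast
  then have "i < d" using assms by (auto simp: lattice_def not_le[symmetric])
  have False if z: "z \<in> Hbox d x" "z \<in> Hbox d y" for z
  proof -
    have "z i - 2 * x i \<in> {0, 1}" "z i - 2 * y i \<in> {0, 1}" using z \<open>i < d\<close> by (auto simp: Hbox_def)
    then show False using i by auto
  qed
  then show ?thesis by auto
qed

lemma adj_single_coord:
  assumes "u \<in> lattice d" "v \<in> lattice d" "i < d" "\<bar>u i - v i\<bar> = 1" "\<And>k. k \<noteq> i \<Longrightarrow> u k = v k"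
  shows "adj d u v"
proof -
  have "(\<Sum>k<d. \<bar>u k - v k\<bar>) = (\<Sum>k<d. if k = i then 1 else 0)"
    using assms by (intro sum.cong) auto
  then show ?thesis using assms by (simp add: adj_def)
qed

lemma adj_box_pt:
  assumes "x \<in> lattice d" "S \<in> cube d" "i < d"
  shows "adj d (box_pt x S) (box_pt x (flip S i))"
proof (rule adj_single_coord[where i = i])
  show "box_pt x S \<in> lattice d" "box_pt x (flip S i) \<in> lattice d"
    using assms by (simp_all add: box_pt_lattice flip_in_cube)
qed (use assms in \<open>auto simp: box_pt_def mem_flip\<close>)

text \<open>The upper face of a box is next to the lower face of the following one, so a single step
  across has to flip coordinate \<open>j\<close> of the code.\<close>

lemma adj_box_pt_cross:
  assumes "x \<in> lattice d" "S \<in> cube d" "j < d" "y = x(j := x j + (if j \<in> S then 1 else - 1))"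
  shows "adj d (box_pt x S) (box_pt y (flip S j))"
proof (rule adj_single_coord[where i = j])
  have "y \<in> lattice d" using assms by (auto simp: lattice_def)
  then show "box_pt x S \<in> lattice d" "box_pt y (flip S j) \<in> lattice d"
    using assms by (simp_all add: box_pt_lattice flip_in_cube)
qed (use assms in \<open>auto simp: box_pt_def mem_flip\<close>)

lemma nbhd0_eq: "nbhd0 d = {emb2 0 0, emb2 1 0, emb2 (- 1) 0, emb2 0 1, emb2 0 (- 1)}"
proof -
  have "a = 0 \<and> b = 0 \<or> a = 1 \<and> b = 0 \<or> a = - 1 \<and> b = 0 \<or> a = 0 \<and> b = 1 \<or> a = 0 \<and> b = - 1"
    if "\<bar>a\<bar> + \<bar>b\<bar> \<le> 1" for a b :: int
    using that by presburger
  moreover have "emb2 a b \<in> nbhd0 d" if "\<bar>a\<bar> + \<bar>b\<bar> \<le> 1" for a b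
    using that by (auto simp: nbhd0_def)
  ultimately show ?thesis by (auto simp: nbhd0_def)
qed

lemma finite_nbhd0 [simp]: "finite (nbhd0 d)"
  by (simp add: nbhd0_eq)

lemma card_nbhd0_le: "card (nbhd0 d) \<le> 5"
  unfolding nbhd0_eq by (auto simp: card_insert_if)

lemma nbhd0_lattice: "d \<ge> 2 \<Longrightarrow> x \<in> nbhd0 d \<Longrightarrow> x \<in> lattice d"
  by (auto simp: nbhd0_eq lattice_def emb2_def)

lemma nbhd0_shift:
  assumes "y \<in> nbhd0 d" "y \<noteq> emb2 0 0"
  shows "\<exists>j<2. \<exists>b. y = (emb2 0 0)(j := emb2 0 0 j + (if b then 1 else - 1))"
proof -
  have 1: "emb2 1 0 = (emb2 0 0)(0 := emb2 0 0 0 + (if True then 1 else - 1))"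
    "emb2 (- 1) 0 = (emb2 0 0)(0 := emb2 0 0 0 + (if False then 1 else - 1))"
    "emb2 0 1 = (emb2 0 0)(1 := emb2 0 0 1 + (if True then 1 else - 1))"
    "emb2 0 (- 1) = (emb2 0 0)(1 := emb2 0 0 1 + (if False then 1 else - 1))"
    by (auto simp: emb2_def fun_eq_iff)
  show ?thesis
  proof -
    consider "y = emb2 1 0" | "y = emb2 (- 1) 0" | "y = emb2 0 1" | "y = emb2 0 (- 1)"
      using assms by (auto simp: nbhd0_eq)
    then show ?thesis
      by cases (use 1 in \<open>metis zero_less_numeral one_less_numeral_iff semiring_norm(76)\<close>)+
  qed
qed

section \<open>Clusters inside one box\<close>

definition box_cluster :: "nat \<Rightarrow> (nat \<Rightarrow> int) \<Rightarrow> (nat \<Rightarrow> int) set \<Rightarrow> (nat \<Rightarrow> int) \<Rightarrow> (nat \<Rightarrow> int) set" where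
  "box_cluster d x \<Omega> a = {b. conn_in d (Hbox d x \<inter> \<Omega>) a b}"

definition big_clusters :: "nat \<Rightarrow> nat \<Rightarrow> (nat \<Rightarrow> int) \<Rightarrow> (nat \<Rightarrow> int) set \<Rightarrow> (nat \<Rightarrow> int) set set" where
  "big_clusters d L x \<Omega> = {C. \<exists>a\<in>Hbox d x \<inter> \<Omega>. C = box_cluster d x \<Omega> a \<and> L \<le> card C}"

text \<open>Membership means that opening this one vertex attaches it to \<open>A\<close>. Families
  of clusters are measured by this set because it bounds their closure from below and is the place
  where sprinkling acts.\<close>

definition nbr_set :: "nat \<Rightarrow> (nat \<Rightarrow> int) \<Rightarrow> (nat \<Rightarrow> int) set \<Rightarrow> nat set set" where
  "nbr_set d x A = {S \<in> cube d. \<exists>i<d. box_pt x (flip S i) \<in> A}"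

lemma nbr_set_cube: "nbr_set d x A \<subseteq> cube d"
  by (auto simp: nbr_set_def)

lemma finite_nbr_set [simp]: "finite (nbr_set d x A)"
  by (rule finite_subset[OF nbr_set_cube]) simp

lemma card_nbr_set_le_closure:
  assumes "x \<in> lattice d" "A \<subseteq> C"
  shows "card (nbr_set d x A) \<le> card (closure_in d (Hbox d x) C)"
proof -
  have "box_pt x ` nbr_set d x A \<subseteq> closure_in d (Hbox d x) C"
  proof safe
    fix S assume S: "S \<in> nbr_set d x A"
    then obtain i where i: "S \<in> cube d" "i < d" "box_pt x (flip S i) \<in> A" by (auto simp: nbr_set_def)
    then have "adj d (box_pt x (flip S i)) (box_pt x S)"
      using adj_box_pt[OF assms(1) i(1,2)] by (rule_tac adj_sym)
    moreover have "box_pt x S \<in> Hbox d x" using i assms by (simp add: Hbox_eq_image)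
    ultimately show "box_pt x S \<in> closure_in d (Hbox d x) C"
      using i assms by (auto simp: closure_in_def)
  qed
  moreover have "finite (closure_in d (Hbox d x) C)"
    using finite_Hbox[OF assms(1)] by (simp add: closure_in_def)
  ultimately have "card (box_pt x ` nbr_set d x A) \<le> card (closure_in d (Hbox d x) C)"
    by (intro card_mono)
  then show ?thesis by (simp add: card_image[OF inj_box_pt])
qed

lemma big_clusterD:
  assumes "C \<in> big_clusters d L x \<Omega>"
  shows "C \<subseteq> Hbox d x \<inter> \<Omega>" "C \<noteq> {}" "L \<le> card C" "u \<in> C \<Longrightarrow> v \<in> C \<Longrightarrow> conn_in d (Hbox d x \<inter> \<Omega>) u v"
    "u \<in> C \<Longrightarrow> C = box_cluster d x \<Omega> u"
proof -
  obtain a where a: "a \<in> Hbox d x \<inter> \<Omega>" "C = box_cluster d x \<Omega> a" "L \<le> card C"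
    using assms by (auto simp: big_clusters_def)
  show "C \<subseteq> Hbox d x \<inter> \<Omega>" using a conn_in_mem by (auto simp: box_cluster_def)
  show "C \<noteq> {}" using a conn_in_refl[OF a(1)] unfolding box_cluster_def by blast
  show "L \<le> card C" by fact
  show "conn_in d (Hbox d x \<inter> \<Omega>) u v" if "u \<in> C" "v \<in> C"
    using that a conn_in_sym conn_in_trans unfolding box_cluster_def by blast
  show "C = box_cluster d x \<Omega> u" if "u \<in> C"
  proof -
    have "conn_in d (Hbox d x \<inter> \<Omega>) a u" using that a by (auto simp: box_cluster_def)
    then show ?thesis unfolding a(2) box_cluster_def
      using conn_in_sym conn_in_trans by blast
  qed
qed

lemma finite_big_clusters: "x \<in> lattice d \<Longrightarrow> finite (big_clusters d L x \<Omega>)"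
  by (rule finite_subset[of _ "Pow (Hbox d x)"]) (auto simp: finite_Hbox dest: big_clusterD(1))

lemma card_big_clusters_le:
  assumes "x \<in> lattice d"
  shows "card (big_clusters d L x \<Omega>) * L \<le> 2 ^ d"
proof -
  let ?B = "big_clusters d L x \<Omega>"
  have "card ?B * L = (\<Sum>C\<in>?B. L)" by simp
  also have "\<dots> \<le> (\<Sum>C\<in>?B. card C)" by (intro sum_mono big_clusterD(3))
  also have "\<dots> = card (\<Union>?B)"
  proof (rule card_Union_disjoint[symmetric])
    show "pairwise disjnt ?B"
      unfolding pairwise_def disjnt_def using big_clusterD(5) by blast
    show "finite C" if "C \<in> ?B" for C
      using big_clusterD(1)[OF that] finite_Hbox[OF assms] by (meson finite_Int finite_subset)
  qed
  also have "\<dots> \<le> card (Hbox d x)"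
    using big_clusterD(1) by (intro card_mono finite_Hbox[OF assms]) blast
  finally show ?thesis by (simp add: card_Hbox[OF assms])
qed

lemma is_component_of_point:
  assumes "a \<in> H"
  shows "is_component d H {b. conn_in d H a b}"
  unfolding is_component_def
proof (intro conjI ballI allI)
  show "{b. conn_in d H a b} \<noteq> {}" using conn_in_refl[OF assms] by auto
  show "{b. conn_in d H a b} \<subseteq> H" using conn_in_mem by auto
  fix u v assume "u \<in> {b. conn_in d H a b}"
  then show "(v \<in> {b. conn_in d H a b}) = conn_in d H u v"
    using conn_in_sym conn_in_trans by blast
qed

text \<open>The bridge consists of one or two open vertices, so the clusters it joins may be three
  steps apart. Demanding a bridge for all splittings at once makes the merging argument
  deterministic.\<close>

definition sprinkled :: "nat \<Rightarrow> real \<Rightarrow> (nat \<Rightarrow> int) \<Rightarrow> (nat \<Rightarrow> int) set set \<Rightarrow> (nat \<Rightarrow> int) set \<Rightarrow> bool" where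
  "sprinkled d \<delta> x \<B> \<Omega> \<longleftrightarrow> (\<forall>\<A>\<subseteq>\<B>. \<delta> * 2 ^ d \<le> card (nbr_set d x (\<Union>\<A>)) \<longrightarrow> \<delta> * 2 ^ d \<le> card (nbr_set d x (\<Union>(\<B> - \<A>))) \<longrightarrow>
     (\<exists>u\<in>nbr_set d x (\<Union>\<A>). \<exists>v\<in>nbr_set d x (\<Union>(\<B> - \<A>)). (v = u \<or> (\<exists>j<d. v = flip u j)) \<and>
        box_pt x u \<in> \<Omega> \<and> box_pt x v \<in> \<Omega>))"

text \<open>Among the families of big clusters that are closed under connection after sprinkling and see a positive
  fraction of the box, a minimal one consists of a single class.\<close>

lemma giant_component:
  fixes \<delta> \<eta> :: real
  assumes x: "x \<in> lattice d" and \<B>: "\<B> = big_clusters d L x \<Omega>1"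
    and bad: "card (cube d - nbr_set d x (\<Union>\<B>)) \<le> \<eta> * 2 ^ d"
    and spr: "sprinkled d \<delta> x \<B> \<Omega>2" and \<delta>: "\<delta> > 0" "3 * \<delta> + \<eta> \<le> 1"
  shows "\<exists>\<A> C. \<A> \<subseteq> \<B> \<and> is_component d (Hbox d x \<inter> (\<Omega>1 \<union> \<Omega>2)) C \<and> \<Union>\<A> \<subseteq> C \<and>
     (1 - \<eta> - \<delta>) * 2 ^ d \<le> card (nbr_set d x (\<Union>\<A>))"
proof -
  define H where "H = Hbox d x \<inter> (\<Omega>1 \<union> \<Omega>2)"
  define nb where "nb \<A> = nbr_set d x (\<Union>\<A>)" for \<A>
  define lnk where "lnk P Q \<longleftrightarrow> (\<exists>a\<in>P. \<exists>b\<in>Q. conn_in d H a b)" for P Q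
  define closed where "closed \<A> \<longleftrightarrow> \<A> \<subseteq> \<B> \<and> (\<forall>P\<in>\<A>. \<forall>Q\<in>\<B>. lnk P Q \<longrightarrow> Q \<in> \<A>)" for \<A>
  have inH: "P \<subseteq> H" if "P \<in> \<B>" for P using big_clusterD(1) that by (fastforce simp: \<B> H_def)
  have intra: "conn_in d H a b" if "P \<in> \<B>" "a \<in> P" "b \<in> P" for P a b
    using big_clusterD(4)[of P d L x \<Omega>1 a b] that unfolding \<B> H_def by (auto elim: conn_in_mono)
  have lnk_sym: "lnk Q P" if "lnk P Q" for P Q using that conn_in_sym unfolding lnk_def by blast
  have lnk_trans: "lnk P R" if PQ: "lnk P Q" and QR: "lnk Q R" and Q: "Q \<in> \<B>" for P Q R
  proof -
    obtain a b where ab: "a \<in> P" "b \<in> Q" "conn_in d H a b" using PQ unfolding lnk_def by blast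
    obtain b' c where bc: "b' \<in> Q" "c \<in> R" "conn_in d H b' c" using QR unfolding lnk_def by blast
    have "conn_in d H a c"
      by (rule conn_in_trans[OF ab(3) conn_in_trans[OF intra[OF Q ab(2) bc(1)] bc(3)]])
    then show ?thesis using ab bc unfolding lnk_def by blast
  qed
  have fB: "finite \<B>" unfolding \<B> by (rule finite_big_clusters[OF x])
  have nbU: "nb \<B> \<subseteq> nb \<A> \<union> nb (\<B> - \<A>)" for \<A> by (auto simp: nb_def nbr_set_def)
  have nbB: "(1 - \<eta>) * 2 ^ d \<le> card (nb \<B>)"
  proof -
    have "card (cube d - nb \<B>) + card (nb \<B>) = 2 ^ d"
      using card_Diff_subset[of "nb \<B>" "cube d"] nbr_set_cube card_mono[of "cube d" "nb \<B>"]
      by (simp add: nb_def card_cube)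
    then have "real (card (cube d - nb \<B>)) + card (nb \<B>) = 2 ^ d"
      by (metis of_nat_add of_nat_numeral of_nat_power)
    then show ?thesis using bad by (simp add: nb_def left_diff_distrib)
  qed
  \<comment> \<open>A bridge from a closed family to its complement would contradict closedness, so
    the complement sees few vertices.\<close>
  have small: "card (nb (\<B> - \<A>)) < \<delta> * 2 ^ d" if cl: "closed \<A>" and big: "\<delta> * 2 ^ d \<le> card (nb \<A>)" for \<A>
  proof (rule ccontr)
    assume "\<not> ?thesis"
    then have "\<delta> * 2 ^ d \<le> card (nb (\<B> - \<A>))" by simp
    moreover have AB: "\<A> \<subseteq> \<B>" using cl by (simp add: closed_def)
    ultimately obtain u v where uv: "u \<in> nb \<A>" "v \<in> nb (\<B> - \<A>)" "v = u \<or> (\<exists>j<d. v = flip u j)"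
      "box_pt x u \<in> \<Omega>2" "box_pt x v \<in> \<Omega>2"
      using spr big unfolding sprinkled_def nb_def by blast
    have cub: "u \<in> cube d" "v \<in> cube d" using uv nbr_set_cube by (auto simp: nb_def)
    then have uvH: "box_pt x u \<in> H" "box_pt x v \<in> H" using uv x by (auto simp: H_def Hbox_eq_image)
    obtain i P where i: "i < d" "box_pt x (flip u i) \<in> P" "P \<in> \<A>" using uv(1) by (auto simp: nb_def nbr_set_def)
    obtain k Q where k: "k < d" "box_pt x (flip v k) \<in> Q" "Q \<in> \<B>" "Q \<notin> \<A>" using uv(2) by (auto simp: nb_def nbr_set_def)
    have "conn_in d H (box_pt x v) (box_pt x (flip v k))"
      using k inH[OF k(3)] by (intro conn_in_step[OF uvH(2) adj_box_pt[OF x cub(2) k(1)]] conn_in_refl) auto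
    moreover have "conn_in d H (box_pt x u) (box_pt x v)"
      using uv(3)
    proof
      assume "\<exists>j<d. v = flip u j"
      then obtain j where "j < d" "v = flip u j" by blast
      then have "adj d (box_pt x u) (box_pt x v)" using adj_box_pt[OF x cub(1)] by simp
      then show ?thesis using conn_in_step[OF uvH(1) _ conn_in_refl[OF uvH(2)]] by blast
    qed (use uvH conn_in_refl in simp)
    moreover have "conn_in d H (box_pt x (flip u i)) (box_pt x u)"
      using i AB inH[of P] by (intro conn_in_step[OF _ adj_sym[OF adj_box_pt[OF x cub(1) i(1)]] conn_in_refl[OF uvH(1)]]) auto
    ultimately have "lnk P Q" using i k conn_in_trans unfolding lnk_def by blast
    then show False using cl i k by (auto simp: closed_def)
  qed
  have "\<delta> * 2 ^ d \<le> card (nb \<B>)"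
  proof -
    have "\<delta> * 2 ^ d \<le> (1 - \<eta>) * 2 ^ d" using \<delta> by (intro mult_right_mono) auto
    then show ?thesis using nbB by linarith
  qed
  then have "closed \<B> \<and> \<delta> * 2 ^ d \<le> card (nb \<B>)" by (auto simp: closed_def)
  \<comment> \<open>Minimality is in the number of clusters: every closed subfamily with fewer
    members then sees fewer than \<open>\<delta> * 2 ^ d\<close> vertices.\<close>
  from ex_has_least_nat[of "\<lambda>\<A>. closed \<A> \<and> \<delta> * 2 ^ d \<le> card (nb \<A>)" \<B> card, OF this]
  obtain \<A> where cl: "closed \<A>" "\<delta> * 2 ^ d \<le> card (nb \<A>)"
    and least: "\<And>\<A>'. closed \<A>' \<Longrightarrow> \<delta> * 2 ^ d \<le> card (nb \<A>') \<Longrightarrow> card \<A> \<le> card \<A>'"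
    by blast
  have AB: "\<A> \<subseteq> \<B>" using cl by (simp add: closed_def)
  have fA: "finite \<A>" using finite_subset[OF AB fB] .
  have nbA: "(1 - \<eta> - \<delta>) * 2 ^ d \<le> card (nb \<A>)"
  proof -
    have "card (nb \<B>) \<le> card (nb \<A> \<union> nb (\<B> - \<A>))" using nbU by (intro card_mono) (auto simp: nb_def)
    also have "\<dots> \<le> card (nb \<A>) + card (nb (\<B> - \<A>))" by (rule card_Un_le)
    finally have "real (card (nb \<B>)) \<le> card (nb \<A>) + card (nb (\<B> - \<A>))" by linarith
    then show ?thesis using nbB small[OF cl] by (simp add: left_diff_distrib)
  qed
  have "\<A> \<noteq> {}"
  proof
    assume "\<A> = {}"
    then have "card (nb \<A>) = 0" by (simp add: nb_def nbr_set_def)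
    moreover have "\<delta> * 2 ^ d > 0" using \<delta>(1) by simp
    ultimately show False using cl(2) by simp
  qed
  then obtain P0 where P0: "P0 \<in> \<A>" by blast
  then have P0B: "P0 \<in> \<B>" using AB by auto
  define \<A>0 where "\<A>0 = {Q \<in> \<B>. lnk P0 Q}"
  have "P0 \<in> \<A>0"
    using big_clusterD(2)[OF P0B[unfolded \<B>]] intra[OF P0B] P0B unfolding \<A>0_def lnk_def by blast
  have A0A: "\<A>0 \<subseteq> \<A>" using cl(1) P0 unfolding \<A>0_def closed_def by blast
  have cl0: "closed \<A>0" unfolding closed_def \<A>0_def using lnk_trans by blast
  have cl1: "closed (\<A> - \<A>0)"
    unfolding closed_def
  proof (intro conjI ballI impI)
    fix P Q assume P: "P \<in> \<A> - \<A>0" and Q: "Q \<in> \<B>" and l: "lnk P Q"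
    have "Q \<notin> \<A>0"
    proof
      assume "Q \<in> \<A>0"
      then have "lnk P0 P" using lnk_trans[OF _ lnk_sym[OF l] Q] by (auto simp: \<A>0_def)
      then show False using P AB by (auto simp: \<A>0_def)
    qed
    then show "Q \<in> \<A> - \<A>0" using cl(1) P Q l by (auto simp: closed_def)
  qed (use AB in auto)
  have "\<A>0 = \<A>"
  proof (rule ccontr)
    assume ne: "\<A>0 \<noteq> \<A>"
    have "card \<A>0 < card \<A>" using ne A0A fA by (intro psubset_card_mono) auto
    then have 0: "card (nb \<A>0) < \<delta> * 2 ^ d" using least[OF cl0] by fastforce
    have "card (\<A> - \<A>0) < card \<A>"
      using P0 \<open>P0 \<in> \<A>0\<close> fA by (intro psubset_card_mono) auto
    then have 1: "card (nb (\<A> - \<A>0)) < \<delta> * 2 ^ d" using least[OF cl1] by fastforce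
    have "nb \<A> \<subseteq> nb \<A>0 \<union> nb (\<A> - \<A>0)" by (auto simp: nb_def nbr_set_def)
    then have "card (nb \<A>) \<le> card (nb \<A>0 \<union> nb (\<A> - \<A>0))" by (intro card_mono) (auto simp: nb_def)
    also have "\<dots> \<le> card (nb \<A>0) + card (nb (\<A> - \<A>0))" by (rule card_Un_le)
    finally have "real (card (nb \<A>)) \<le> card (nb \<A>0) + card (nb (\<A> - \<A>0))" by linarith
    \<comment> \<open>Two closed parts below \<open>\<delta>\<close> cannot make up a family that
      sees \<open>1 - \<eta> - \<delta>\<close>; this is where
      \<open>3 * \<delta> + \<eta> \<le> 1\<close> enters.\<close>
    then have "(1 - \<eta> - \<delta>) * 2 ^ d < 2 * \<delta> * 2 ^ d" using 0 1 nbA by linarith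
    then have "1 - \<eta> - \<delta> < 2 * \<delta>" by simp
    then show False using \<delta> by simp
  qed
  obtain a0 where a0: "a0 \<in> P0" using big_clusterD(2)[OF P0B[unfolded \<B>]] by blast
  have "\<Union>\<A> \<subseteq> {b. conn_in d H a0 b}"
  proof safe
    fix b Q assume Q: "Q \<in> \<A>" "b \<in> Q"
    then have QB: "Q \<in> \<B>" "lnk P0 Q" using \<open>\<A>0 = \<A>\<close> by (auto simp: \<A>0_def)
    then obtain a c where ac: "a \<in> P0" "c \<in> Q" "conn_in d H a c" unfolding lnk_def by blast
    show "conn_in d H a0 b"
      by (rule conn_in_trans[OF intra[OF P0B a0 ac(1)] conn_in_trans[OF ac(3) intra[OF QB(1) ac(2) Q(2)]]])
  qed
  moreover have "is_component d H {b. conn_in d H a0 b}"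
    using a0 inH[OF P0B] by (intro is_component_of_point) auto
  ultimately show ?thesis using AB nbA unfolding H_def nb_def by blast
qed

text \<open>The event \<open>G0\<close> as a property of an arbitrary set of open vertices, so that
  it applies to level sets and to Bernoulli configurations alike.\<close>

definition open_good :: "nat \<Rightarrow> (nat \<Rightarrow> int) set \<Rightarrow> bool" where
  "open_good d \<Omega> \<longleftrightarrow> (\<exists>C. (\<forall>x\<in>nbhd0 d.
        is_component d (Hbox d x \<inter> \<Omega>) (C x) \<and>
        real (card (closure_in d (Hbox d x) (C x))) \<ge> (1 - 1 / (real d)\<^sup>2) * real (card (Hbox d x))) \<and>
     (\<forall>x\<in>nbhd0 d. \<forall>x'\<in>nbhd0 d. \<exists>u\<in>C x. \<exists>v\<in>C x'.
        conn_in d (\<Omega> \<inter> (\<Union>z\<in>nbhd0 d. Hbox d z)) u v))"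

text \<open>Components may grow and merge with the open set, so the old witnesses are replaced by
  the components containing them. The comparison of the field with independent variables rests on
  this monotonicity.\<close>

lemma open_good_mono:
  assumes d: "d \<ge> 2" and "open_good d \<Omega>" "\<Omega> \<subseteq> \<Omega>'"
  shows "open_good d \<Omega>'"
proof -
  obtain C where C: "\<And>x. x \<in> nbhd0 d \<Longrightarrow> is_component d (Hbox d x \<inter> \<Omega>) (C x)"
    "\<And>x. x \<in> nbhd0 d \<Longrightarrow> real (card (closure_in d (Hbox d x) (C x))) \<ge> (1 - 1 / (real d)\<^sup>2) * real (card (Hbox d x))"
    "\<And>x x'. x \<in> nbhd0 d \<Longrightarrow> x' \<in> nbhd0 d \<Longrightarrow> \<exists>u\<in>C x. \<exists>v\<in>C x'. conn_in d (\<Omega> \<inter> (\<Union>z\<in>nbhd0 d. Hbox d z)) u v"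
    using assms(2) unfolding open_good_def by blast
  define a where "a x = (SOME a. a \<in> C x)" for x
  define C' where "C' x = {b. conn_in d (Hbox d x \<inter> \<Omega>') (a x) b}" for x
  have a: "a x \<in> C x" if "x \<in> nbhd0 d" for x
    using C(1)[OF that] unfolding a_def is_component_def by (metis someI_ex ex_in_conv)
  have CC: "C x \<subseteq> C' x" if "x \<in> nbhd0 d" for x
  proof
    fix b assume "b \<in> C x"
    then have "conn_in d (Hbox d x \<inter> \<Omega>) (a x) b" using C(1)[OF that] a[OF that] by (auto simp: is_component_def)
    then show "b \<in> C' x" unfolding C'_def using assms(3) by (auto elim: conn_in_mono)
  qed
  show ?thesis
    unfolding open_good_def
  proof (intro exI[of _ C'] conjI ballI)
    fix x assume x: "x \<in> nbhd0 d"
    have "a x \<in> Hbox d x \<inter> \<Omega>'" using a[OF x] C(1)[OF x] assms(3) by (auto simp: is_component_def)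
    then show "is_component d (Hbox d x \<inter> \<Omega>') (C' x)" unfolding C'_def by (rule is_component_of_point)
    have "closure_in d (Hbox d x) (C x) \<subseteq> closure_in d (Hbox d x) (C' x)"
      using CC[OF x] by (auto simp: closure_in_def)
    then have "card (closure_in d (Hbox d x) (C x)) \<le> card (closure_in d (Hbox d x) (C' x))"
      using finite_Hbox[OF nbhd0_lattice[OF d x]] by (intro card_mono) (auto simp: closure_in_def)
    then show "real (card (closure_in d (Hbox d x) (C' x))) \<ge> (1 - 1 / (real d)\<^sup>2) * real (card (Hbox d x))"
      using C(2)[OF x] by linarith
  next
    fix x x' assume x: "x \<in> nbhd0 d" "x' \<in> nbhd0 d"
    from C(3)[OF x] obtain u v where uv: "u \<in> C x" "v \<in> C x'" "conn_in d (\<Omega> \<inter> (\<Union>z\<in>nbhd0 d. Hbox d z)) u v"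
      by blast
    have "conn_in d (\<Omega>' \<inter> (\<Union>z\<in>nbhd0 d. Hbox d z)) u v"
      by (rule conn_in_mono[OF uv(3)]) (use assms(3) in auto)
    then show "\<exists>u\<in>C' x. \<exists>v\<in>C' x'. conn_in d (\<Omega>' \<inter> (\<Union>z\<in>nbhd0 d. Hbox d z)) u v"
      using uv CC[OF x(1)] CC[OF x(2)] by blast
  qed
qed

section \<open>Probability that sprinkling leaves a splitting unbridged\<close>

text \<open>The product of the two sizes is at least \<open>4^d / (4 d^4)\<close>. The tolerance
  \<open>2^d / (16 d^5)\<close> for uncovered vertices is chosen to use up at most half of this in
  \<open>canonical_paths\<close>; the rest is shared among \<open>2 d\<close> choices of direction
  and side, which leaves \<open>2^d / (32 d^6)\<close>.\<close>

lemma large_transit: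
  assumes A: "A \<subseteq> cube d" and B: "B \<subseteq> cube d" and d: "d \<ge> 1"
    and bad: "real (card (cube d - (A \<union> B))) \<le> 2 ^ d / (16 * real d ^ 5)"
    and cA: "1 / (2 * (real d)\<^sup>2) * 2 ^ d \<le> card A" and cB: "1 / (2 * (real d)\<^sup>2) * 2 ^ d \<le> card B"
  shows "\<exists>j<d. \<exists>b. 2 ^ d / (32 * real d ^ 6) \<le> card (transit d A B j b)"
proof -
  obtain j b where j: "j < d" and tr: "card (\<Union>j<d. \<Union>b. transit d A B j b) \<le> 2 * d * card (transit d A B j b)"
    using transit_pigeonhole[OF d] by blast
  define U where "U = real (card (transit d A B j b))"
  define D where "D = (2::real) ^ d"
  define n where "n = real d"
  have n: "n \<ge> 1" using d by (simp add: n_def)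
  have D: "D > 0" by (simp add: D_def)
  have "card A * card B \<le> (d + 1) * 2 ^ d * (card (cube d - (A \<union> B)) + 2 * d * card (transit d A B j b))"
    using canonical_paths[OF A B d] tr by (meson add_left_mono le_trans mult_le_mono2)
  then have "real (card A * card B) \<le> real ((d + 1) * 2 ^ d * (card (cube d - (A \<union> B)) + 2 * d * card (transit d A B j b)))"
    by (rule of_nat_mono)
  then have "real (card A) * card B \<le> (n + 1) * D * (real (card (cube d - (A \<union> B))) + 2 * n * U)"
    by (simp add: U_def D_def n_def distrib_right add.commute)
  also have "\<dots> \<le> (2 * n) * D * (D / (16 * n ^ 5) + 2 * n * U)"
    using n D bad by (intro mult_mono add_mono) (auto simp: D_def n_def U_def)
  finally have 1: "real (card A) * card B \<le> (2 * n) * D * (D / (16 * n ^ 5) + 2 * n * U)" .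
  have "(1 / (2 * n\<^sup>2) * D) * (1 / (2 * n\<^sup>2) * D) \<le> real (card A) * card B"
    using cA cB D n by (intro mult_mono) (auto simp: D_def n_def)
  moreover have "(2 * n) * D * (D / (16 * n ^ 5) + 2 * n * U) = D * (D / (8 * n ^ 4) + 4 * n\<^sup>2 * U)"
  proof -
    have "n ^ 5 = n * n ^ 4" by (simp add: eval_nat_numeral)
    then have e: "2 * n * (D / (16 * n ^ 5)) = D / (8 * n ^ 4)" using n by simp
    have "(2 * n) * D * (X + 2 * n * U) = D * (2 * n * X + 4 * n\<^sup>2 * U)" for X
      by (simp add: algebra_simps power2_eq_square)
    from this[of "D / (16 * n ^ 5)"] show ?thesis unfolding e .
  qed
  moreover have "(1 / (2 * n\<^sup>2) * D) * (1 / (2 * n\<^sup>2) * D) = D * (D / (4 * n ^ 4))"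
    by (simp add: power_add[symmetric] mult.assoc[symmetric])
  ultimately have "D * (D / (4 * n ^ 4)) \<le> D * (D / (8 * n ^ 4) + 4 * n\<^sup>2 * U)"
    using 1 by linarith
  then have "D / (4 * n ^ 4) \<le> D / (8 * n ^ 4) + 4 * n\<^sup>2 * U" using D by (rule mult_left_le_imp_le)
  then have "D / (8 * n ^ 4) \<le> 4 * n\<^sup>2 * U" by simp
  then have "D / (8 * n ^ 4) / (4 * n\<^sup>2) \<le> U" using n by (simp add: field_simps)
  moreover have "D / (8 * n ^ 4) / (4 * n\<^sup>2) = D / (32 * n ^ 6)"
    by (simp add: power_add[symmetric] mult.assoc[symmetric])
  ultimately show ?thesis using j unfolding U_def D_def n_def by auto
qed

lemma one_minus_power_le_exp:
  assumes "0 \<le> q" "q \<le> 1" "M \<le> real n"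
  shows "(1 - q\<^sup>2) ^ n \<le> exp (- q\<^sup>2 * M)"
proof -
  have q2: "q\<^sup>2 \<le> 1" using assms by (simp add: power_le_one)
  have "(1 - q\<^sup>2) ^ n \<le> exp (- q\<^sup>2) ^ n"
    using exp_ge_add_one_self[of "- q\<^sup>2"] q2 by (intro power_mono) auto
  also have "\<dots> = exp (- (q\<^sup>2 * n))" by (simp add: exp_of_nat_mult[symmetric] mult.commute)
  also have "\<dots> \<le> exp (- (q\<^sup>2 * M))" using assms by (simp add: mult_left_mono)
  finally show ?thesis by simp
qed

lemma prob_UN_le:
  assumes "finite I" "\<And>i. i \<in> I \<Longrightarrow> measure_pmf.prob D (E i) \<le> c"
  shows "measure_pmf.prob D (\<Union>i\<in>I. E i) \<le> real (card I) * c"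
proof -
  have "measure_pmf.prob D (\<Union>i\<in>I. E i) \<le> (\<Sum>i\<in>I. measure_pmf.prob D (E i))"
    by (rule measure_pmf.finite_measure_subadditive_finite) (use assms in auto)
  also have "\<dots> \<le> (\<Sum>i\<in>I. c)" by (intro sum_mono assms)
  finally show ?thesis by simp
qed

text \<open>\<open>\<B>\<close> is fixed before \<open>g\<close> is drawn, as it will come from the
  independent first stage. The at most \<open>2 ^ card \<B>\<close> splittings are paid for by the
  number of disjoint pairs, each of which would be a bridge if open.\<close>

lemma prob_not_sprinkled:
  assumes V: "finite V" "Hbox d x \<subseteq> V" and x: "x \<in> lattice d" and d: "d \<ge> 1" and q: "0 \<le> q" "q \<le> 1"
    and \<B>: "finite \<B>" and bad: "real (card (cube d - nbr_set d x (\<Union>\<B>))) \<le> 2 ^ d / (16 * real d ^ 5)"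
  shows "measure_pmf.prob (Pi_pmf V False (\<lambda>_. bernoulli_pmf q)) {g. \<not> sprinkled d (1 / (2 * (real d)\<^sup>2)) x \<B> {z. g z}}
     \<le> 2 ^ card \<B> * exp (- q\<^sup>2 * (2 ^ d / (32 * real d ^ 6)))"
proof -
  define D where "D = Pi_pmf V False (\<lambda>_. bernoulli_pmf q)"
  define \<delta> where "\<delta> = 1 / (2 * (real d)\<^sup>2)"
  define nb where "nb \<A> = nbr_set d x (\<Union>\<A>)" for \<A>
  define I where "I = {\<A> \<in> Pow \<B>. \<delta> * 2 ^ d \<le> card (nb \<A>) \<and> \<delta> * 2 ^ d \<le> card (nb (\<B> - \<A>))}"
  define E where "E \<A> = {g. \<not> (\<exists>u\<in>nb \<A>. \<exists>v\<in>nb (\<B> - \<A>). (v = u \<or> (\<exists>j<d. v = flip u j)) \<and> g (box_pt x u) \<and> g (box_pt x v))}" for \<A>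
  have "sprinkled d \<delta> x \<B> {z. g z}" if g: "g \<notin> (\<Union>\<A>\<in>I. E \<A>)" for g
    unfolding sprinkled_def
  proof (intro allI impI)
    fix \<A> assume "\<A> \<subseteq> \<B>" "\<delta> * 2 ^ d \<le> card (nbr_set d x (\<Union>\<A>))" "\<delta> * 2 ^ d \<le> card (nbr_set d x (\<Union>(\<B> - \<A>)))"
    then have "\<A> \<in> I" by (simp add: I_def nb_def)
    then have "g \<notin> E \<A>" using g by blast
    then show "\<exists>u\<in>nbr_set d x (\<Union>\<A>). \<exists>v\<in>nbr_set d x (\<Union>(\<B> - \<A>)). (v = u \<or> (\<exists>j<d. v = flip u j)) \<and>
        box_pt x u \<in> {z. g z} \<and> box_pt x v \<in> {z. g z}"
      by (simp only: E_def nb_def mem_Collect_eq not_not)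
  qed
  then have "{g. \<not> sprinkled d \<delta> x \<B> {z. g z}} \<subseteq> (\<Union>\<A>\<in>I. E \<A>)" by blast
  then have "measure_pmf.prob D {g. \<not> sprinkled d \<delta> x \<B> {z. g z}} \<le> measure_pmf.prob D (\<Union>\<A>\<in>I. E \<A>)"
    by (intro measure_pmf.finite_measure_mono) auto
  also have "\<dots> \<le> real (card I) * exp (- q\<^sup>2 * (2 ^ d / (32 * real d ^ 6)))"
  proof (rule prob_UN_le)
    show "finite I" using \<B> by (simp add: I_def)
    fix \<A> assume A: "\<A> \<in> I"
    have "nb \<B> \<subseteq> nb \<A> \<union> nb (\<B> - \<A>)" by (auto simp: nb_def nbr_set_def)
    then have "card (cube d - (nb \<A> \<union> nb (\<B> - \<A>))) \<le> card (cube d - nb \<B>)" by (intro card_mono) auto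
    then have "real (card (cube d - (nb \<A> \<union> nb (\<B> - \<A>)))) \<le> 2 ^ d / (16 * real d ^ 5)"
      using bad unfolding nb_def by linarith
    then obtain j b where j: "j < d" and U: "2 ^ d / (32 * real d ^ 6) \<le> card (transit d (nb \<A>) (nb (\<B> - \<A>)) j b)"
      using large_transit[of "nb \<A>" d "nb (\<B> - \<A>)"] A d nbr_set_cube unfolding I_def \<delta>_def nb_def by blast
    define U where "U = transit d (nb \<A>) (nb (\<B> - \<A>)) j b"
    have Uc: "U \<subseteq> cube d" "\<And>u. u \<in> U \<Longrightarrow> j \<in> u \<longleftrightarrow> b" "\<And>u. u \<in> U \<Longrightarrow> flip u j \<in> cube d"
      using flip_in_cube[OF _ j] by (auto simp: U_def transit_def)
    have "E \<A> \<subseteq> {g. \<forall>u\<in>U. \<not> (g (box_pt x u) \<and> g (box_pt x (flip u j)))}"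
    proof safe
      fix g u assume g: "g \<in> E \<A>" and u: "u \<in> U" "g (box_pt x u)" "g (box_pt x (flip u j))"
      have "u \<in> nb \<A>" "u \<in> nb (\<B> - \<A>) \<or> flip u j \<in> nb (\<B> - \<A>)" using u by (auto simp: U_def transit_def)
      then show False using g u j unfolding E_def by blast
    qed
    then have "measure_pmf.prob D (E \<A>) \<le> measure_pmf.prob D {g. \<forall>u\<in>U. \<not> (g (box_pt x u) \<and> g (box_pt x (flip u j)))}"
      by (intro measure_pmf.finite_measure_mono) auto
    also have "\<dots> = (1 - q\<^sup>2) ^ card U"
      unfolding D_def
    proof (rule prob_no_open_pair[OF V(1) _ inj_box_pt _ _ _ _ q])
      show "finite U" by (simp add: U_def)
      show "box_pt x ` U \<subseteq> V" "(\<lambda>u. box_pt x (flip u j)) ` U \<subseteq> V"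
        using Uc(1,3) V(2) unfolding Hbox_eq_image[OF x] by blast+
      show "inj_on (\<lambda>u. box_pt x (flip u j)) U"
        by (rule inj_onI) (metis inj_onD[OF inj_box_pt[of x UNIV]] UNIV_I flip_flip)
      show "box_pt x ` U \<inter> (\<lambda>u. box_pt x (flip u j)) ` U = {}"
      proof safe
        fix u v assume uv: "u \<in> U" "v \<in> U" "box_pt x u = box_pt x (flip v j)"
        then have "u = flip v j" using inj_onD[OF inj_box_pt[of x UNIV]] by blast
        then have "j \<in> u \<longleftrightarrow> j \<notin> v" by (simp add: mem_flip)
        then show "box_pt x u \<in> {}" using Uc(2) uv by blast
      qed
    qed
    also have "\<dots> \<le> exp (- q\<^sup>2 * (2 ^ d / (32 * real d ^ 6)))"
      using q U by (intro one_minus_power_le_exp) (auto simp: U_def)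
    finally show "measure_pmf.prob D (E \<A>) \<le> exp (- q\<^sup>2 * (2 ^ d / (32 * real d ^ 6)))" .
  qed
  also have "\<dots> \<le> 2 ^ card \<B> * exp (- q\<^sup>2 * (2 ^ d / (32 * real d ^ 6)))"
  proof -
    have "card I \<le> card (Pow \<B>)" using \<B> by (intro card_mono) (auto simp: I_def)
    then have "card I \<le> 2 ^ card \<B>" by (simp add: card_Pow \<B>)
    then have "real (card I) \<le> real (2 ^ card \<B>)" by (rule of_nat_mono)
    then show ?thesis by (intro mult_right_mono) auto
  qed
  finally show ?thesis by (simp add: D_def \<delta>_def)
qed

text \<open>The threshold 7/8 is met by the giant families since
  \<open>1 - 1 / d^2 \<ge> 8/9\<close> for \<open>d \<ge> 3\<close>. On the common face it still
  leaves \<open>1/2 - 1/8 - 1/8 = 1/4\<close> of \<open>2 ^ d\<close> as usable pairs.\<close>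

definition cross_sprinkled :: "nat \<Rightarrow> (nat \<Rightarrow> int) \<Rightarrow> (nat \<Rightarrow> int) \<Rightarrow> (nat \<Rightarrow> int) set set \<Rightarrow> (nat \<Rightarrow> int) set set \<Rightarrow> (nat \<Rightarrow> int) set \<Rightarrow> bool" where
  "cross_sprinkled d x y \<B> \<B>' \<Omega> \<longleftrightarrow> (\<forall>\<A>\<subseteq>\<B>. \<forall>\<A>'\<subseteq>\<B>'. 7 / 8 * 2 ^ d \<le> real (card (nbr_set d x (\<Union>\<A>))) \<longrightarrow>
     7 / 8 * 2 ^ d \<le> real (card (nbr_set d y (\<Union>\<A>'))) \<longrightarrow>
     (\<exists>u\<in>nbr_set d x (\<Union>\<A>). \<exists>v\<in>nbr_set d y (\<Union>\<A>'). adj d (box_pt x u) (box_pt y v) \<and> box_pt x u \<in> \<Omega> \<and> box_pt y v \<in> \<Omega>))"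

lemma card_half_cube:
  assumes "j < d"
  shows "2 * card {u \<in> cube d. j \<in> u \<longleftrightarrow> b} = 2 ^ d"
proof -
  have "bij_betw (\<lambda>u. flip u j) {u \<in> cube d. j \<in> u \<longleftrightarrow> b} {u \<in> cube d. j \<in> u \<longleftrightarrow> \<not> b}"
    by (rule bij_betw_byWitness[where f' = "\<lambda>u. flip u j"])
      (use assms in \<open>auto simp: flip_in_cube mem_flip\<close>)
  then have "card {u \<in> cube d. j \<in> u \<longleftrightarrow> b} = card {u \<in> cube d. j \<in> u \<longleftrightarrow> \<not> b}"
    by (rule bij_betw_same_card)
  moreover have "card {u \<in> cube d. j \<in> u \<longleftrightarrow> b} + card {u \<in> cube d. j \<in> u \<longleftrightarrow> \<not> b} = card (cube d)"
    by (subst card_Un_disjoint[symmetric]) (auto intro!: arg_cong[where f = card])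
  ultimately show ?thesis by (simp add: card_cube)
qed

lemma card_cross_pairs:
  assumes j: "j < d" and A: "A \<subseteq> cube d" "7 / 8 * 2 ^ d \<le> real (card A)" and B: "B \<subseteq> cube d" "7 / 8 * 2 ^ d \<le> real (card B)"
  shows "2 ^ d / 4 \<le> real (card {u \<in> cube d. (j \<in> u \<longleftrightarrow> b) \<and> u \<in> A \<and> flip u j \<in> B})"
proof -
  define U where "U = {u \<in> cube d. (j \<in> u \<longleftrightarrow> b) \<and> u \<in> A \<and> flip u j \<in> B}"
  have co: "real (card (cube d - X)) \<le> 2 ^ d / 8" if "X \<subseteq> cube d" "7 / 8 * 2 ^ d \<le> real (card X)" for X
  proof -
    have "card (cube d - X) + card X = 2 ^ d"
      using that card_Diff_subset[of X "cube d"] card_mono[of "cube d" X] finite_subset[of X "cube d"] by (simp add: card_cube)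
    then have "real (card (cube d - X)) + card X = 2 ^ d"
      by (metis of_nat_add of_nat_numeral of_nat_power)
    then show ?thesis using that(2) by simp
  qed
  have "{u \<in> cube d. j \<in> u \<longleftrightarrow> b} \<subseteq> U \<union> ((cube d - A) \<union> (\<lambda>u. flip u j) ` (cube d - B))"
  proof
    fix u assume u: "u \<in> {u \<in> cube d. j \<in> u \<longleftrightarrow> b}"
    show "u \<in> U \<union> ((cube d - A) \<union> (\<lambda>u. flip u j) ` (cube d - B))"
    proof (cases "flip u j \<in> B")
      case False
      then have "flip u j \<in> cube d - B" using u j by (auto intro: flip_in_cube)
      then have "flip (flip u j) j \<in> (\<lambda>u. flip u j) ` (cube d - B)" by (rule imageI)
      then show ?thesis by simp
    qed (use u in \<open>auto simp: U_def\<close>)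
  qed
  then have "card {u \<in> cube d. j \<in> u \<longleftrightarrow> b} \<le> card (U \<union> ((cube d - A) \<union> (\<lambda>u. flip u j) ` (cube d - B)))"
    by (intro card_mono) (auto simp: U_def)
  also have "\<dots> \<le> card U + (card (cube d - A) + card ((\<lambda>u. flip u j) ` (cube d - B)))"
    by (meson add_left_mono card_Un_le le_trans)
  also have "\<dots> \<le> card U + (card (cube d - A) + card (cube d - B))"
    by (intro add_left_mono card_image_le) auto
  finally have "real (card {u \<in> cube d. j \<in> u \<longleftrightarrow> b}) \<le> card U + (card (cube d - A) + card (cube d - B))"
    by linarith
  moreover have "2 * real (card {u \<in> cube d. j \<in> u \<longleftrightarrow> b}) = 2 ^ d"
    using arg_cong[OF card_half_cube[OF j, of b], of real] by simp
  ultimately show ?thesis using co[OF A] co[OF B] unfolding U_def by linarith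
qed

lemma prob_not_cross_sprinkled:
  assumes V: "finite V" "Hbox d x \<subseteq> V" "Hbox d y \<subseteq> V" and x: "x \<in> lattice d" and d: "d \<ge> 1" and j: "j < d"
    and y: "y = x(j := x j + (if b then 1 else - 1))" and q: "0 \<le> q" "q \<le> 1"
    and \<B>: "finite \<B>" "finite \<B>'"
  shows "measure_pmf.prob (Pi_pmf V False (\<lambda>_. bernoulli_pmf q)) {g. \<not> cross_sprinkled d x y \<B> \<B>' {z. g z}}
     \<le> 2 ^ (card \<B> + card \<B>') * exp (- q\<^sup>2 * (2 ^ d / (32 * real d ^ 6)))"
proof -
  define D where "D = Pi_pmf V False (\<lambda>_. bernoulli_pmf q)"
  have yl: "y \<in> lattice d" using x y j by (auto simp: lattice_def)
  have "y j \<noteq> x j" unfolding y by simp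
  then have xy: "x \<noteq> y" by blast
  define nx where "nx \<A> = nbr_set d x (\<Union>\<A>)" for \<A>
  define ny where "ny \<A> = nbr_set d y (\<Union>\<A>)" for \<A>
  define I where "I = {(\<A>, \<A>') \<in> Pow \<B> \<times> Pow \<B>'. 7 / 8 * 2 ^ d \<le> real (card (nx \<A>)) \<and> 7 / 8 * 2 ^ d \<le> real (card (ny \<A>'))}"
  define E where "E P = {g. \<not> (\<exists>u\<in>nx (fst P). \<exists>v\<in>ny (snd P). adj d (box_pt x u) (box_pt y v) \<and> g (box_pt x u) \<and> g (box_pt y v))}" for P
  have "cross_sprinkled d x y \<B> \<B>' {z. g z}" if g: "g \<notin> (\<Union>P\<in>I. E P)" for g
    unfolding cross_sprinkled_def
  proof (intro allI impI)
    fix \<A> \<A>' assume "\<A> \<subseteq> \<B>" "\<A>' \<subseteq> \<B>'" "7 / 8 * 2 ^ d \<le> real (card (nbr_set d x (\<Union>\<A>)))"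
      "7 / 8 * 2 ^ d \<le> real (card (nbr_set d y (\<Union>\<A>')))"
    then have "(\<A>, \<A>') \<in> I" by (simp add: I_def nx_def ny_def)
    then have "g \<notin> E (\<A>, \<A>')" using g by blast
    then show "\<exists>u\<in>nbr_set d x (\<Union>\<A>). \<exists>v\<in>nbr_set d y (\<Union>\<A>'). adj d (box_pt x u) (box_pt y v) \<and>
        box_pt x u \<in> {z. g z} \<and> box_pt y v \<in> {z. g z}"
      by (simp only: E_def nx_def ny_def mem_Collect_eq not_not fst_conv snd_conv)
  qed
  then have "{g. \<not> cross_sprinkled d x y \<B> \<B>' {z. g z}} \<subseteq> (\<Union>P\<in>I. E P)" by blast
  then have "measure_pmf.prob D {g. \<not> cross_sprinkled d x y \<B> \<B>' {z. g z}} \<le> measure_pmf.prob D (\<Union>P\<in>I. E P)"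
    by (intro measure_pmf.finite_measure_mono) auto
  also have "\<dots> \<le> real (card I) * exp (- q\<^sup>2 * (2 ^ d / (32 * real d ^ 6)))"
  proof (rule prob_UN_le)
    show "finite I" by (rule finite_subset[of _ "Pow \<B> \<times> Pow \<B>'"]) (use \<B> in \<open>auto simp: I_def\<close>)
    fix P assume P: "P \<in> I"
    define U where "U = {u \<in> cube d. (j \<in> u \<longleftrightarrow> b) \<and> u \<in> nx (fst P) \<and> flip u j \<in> ny (snd P)}"
    have Uc: "U \<subseteq> cube d" "\<And>u. u \<in> U \<Longrightarrow> flip u j \<in> cube d"
      using flip_in_cube[OF _ j] by (auto simp: U_def)
    have "2 ^ d / 4 \<le> real (card U)"
      unfolding U_def by (rule card_cross_pairs[OF j]) (use P in \<open>auto simp: I_def nx_def ny_def nbr_set_cube\<close>)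
    \<comment> \<open>The quarter is weakened to the number of pairs available inside a box, so that
      both kinds of failure have the same estimate.\<close>
    moreover have "(2::real) ^ d / (32 * real d ^ 6) \<le> 2 ^ d / 4"
    proof -
      have "1 \<le> real d ^ 6" using d by (intro one_le_power) simp
      then have "4 \<le> 32 * real d ^ 6" by linarith
      then show ?thesis by (intro frac_le) auto
    qed
    ultimately have U: "2 ^ d / (32 * real d ^ 6) \<le> real (card U)" by linarith
    have "E P \<subseteq> {g. \<forall>u\<in>U. \<not> (g (box_pt x u) \<and> g (box_pt y (flip u j)))}"
    proof safe
      fix g u assume g: "g \<in> E P" and u: "u \<in> U" "g (box_pt x u)" "g (box_pt y (flip u j))"
      have "adj d (box_pt x u) (box_pt y (flip u j))"
        by (rule adj_box_pt_cross[OF x _ j]) (use u y in \<open>auto simp: U_def\<close>)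
      then show False using g u unfolding E_def U_def by blast
    qed
    then have "measure_pmf.prob D (E P) \<le> measure_pmf.prob D {g. \<forall>u\<in>U. \<not> (g (box_pt x u) \<and> g (box_pt y (flip u j)))}"
      by (intro measure_pmf.finite_measure_mono) auto
    also have "\<dots> = (1 - q\<^sup>2) ^ card U"
      unfolding D_def
    proof (rule prob_no_open_pair[OF V(1) _ inj_box_pt _ _ _ _ q])
      show "finite U" by (simp add: U_def)
      have im: "box_pt x ` U \<subseteq> Hbox d x" "(\<lambda>u. box_pt y (flip u j)) ` U \<subseteq> Hbox d y"
        using Uc unfolding Hbox_eq_image[OF x] Hbox_eq_image[OF yl] by blast+
      show "box_pt x ` U \<subseteq> V" "(\<lambda>u. box_pt y (flip u j)) ` U \<subseteq> V" using im V by auto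
      show "inj_on (\<lambda>u. box_pt y (flip u j)) U"
        by (rule inj_onI) (metis inj_onD[OF inj_box_pt[of y UNIV]] UNIV_I flip_flip)
      show "box_pt x ` U \<inter> (\<lambda>u. box_pt y (flip u j)) ` U = {}"
        using im Hbox_disjoint[OF x yl xy] by blast
    qed
    also have "\<dots> \<le> exp (- q\<^sup>2 * (2 ^ d / (32 * real d ^ 6)))"
      using q U by (intro one_minus_power_le_exp)
    finally show "measure_pmf.prob D (E P) \<le> exp (- q\<^sup>2 * (2 ^ d / (32 * real d ^ 6)))" .
  qed
  also have "\<dots> \<le> 2 ^ (card \<B> + card \<B>') * exp (- q\<^sup>2 * (2 ^ d / (32 * real d ^ 6)))"
  proof -
    have "card I \<le> card (Pow \<B> \<times> Pow \<B>')" using \<B> by (intro card_mono) (auto simp: I_def)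
    then have "card I \<le> 2 ^ (card \<B> + card \<B>')" by (simp add: card_cartesian_product card_Pow \<B> power_add)
    then have "real (card I) \<le> real (2 ^ (card \<B> + card \<B>'))" by (rule of_nat_mono)
    then show ?thesis by (intro mult_right_mono) auto
  qed
  finally show ?thesis by (simp add: D_def)
qed

section \<open>The five boxes together\<close>

definition boxes :: "nat \<Rightarrow> (nat \<Rightarrow> int) set" where
  "boxes d = (\<Union>x\<in>nbhd0 d. Hbox d x)"

lemma finite_boxes: "d \<ge> 2 \<Longrightarrow> finite (boxes d)"
  unfolding boxes_def using finite_Hbox nbhd0_lattice by auto

lemma card_boxes_le:
  assumes "d \<ge> 2"
  shows "card (boxes d) \<le> 5 * 2 ^ d"
proof -
  have "card (boxes d) \<le> (\<Sum>x\<in>nbhd0 d. card (Hbox d x))"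
    unfolding boxes_def by (rule card_UN_le) simp
  also have "\<dots> = card (nbhd0 d) * 2 ^ d"
    using card_Hbox nbhd0_lattice[OF assms] by simp
  also have "\<dots> \<le> 5 * 2 ^ d" using card_nbhd0_le by simp
  finally show ?thesis .
qed

lemma boxes_lattice: "boxes d \<subseteq> lattice d"
  by (auto simp: boxes_def Hbox_def)

lemma zero_in_nbhd0: "emb2 0 0 \<in> nbhd0 d"
  by (simp add: nbhd0_eq)

text \<open>A deterministic statement. Vertices seen by no big cluster, and those seen only outside
  the giant family, make up at most \<open>\<eta> + \<delta> \<le> 1 / d^2\<close> of a box, the
  loss permitted by the event. Connections between boxes run through the central one.\<close>

lemma sprinkled_imp_open_good:
  fixes \<Omega>1 \<Omega>2 :: "(nat \<Rightarrow> int) set"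
  assumes d: "d \<ge> 3" and \<B>: "\<And>x. \<B> x = big_clusters d L x \<Omega>1"
    and bad: "\<And>x. x \<in> nbhd0 d \<Longrightarrow> real (card (cube d - nbr_set d x (\<Union>(\<B> x)))) \<le> 2 ^ d / (16 * real d ^ 5)"
    and spr: "\<And>x. x \<in> nbhd0 d \<Longrightarrow> sprinkled d (1 / (2 * (real d)\<^sup>2)) x (\<B> x) \<Omega>2"
    and cross: "\<And>y. y \<in> nbhd0 d \<Longrightarrow> y \<noteq> emb2 0 0 \<Longrightarrow> cross_sprinkled d (emb2 0 0) y (\<B> (emb2 0 0)) (\<B> y) \<Omega>2"
  shows "open_good d (\<Omega>1 \<union> \<Omega>2)"
proof -
  define \<delta> where "\<delta> = 1 / (2 * (real d)\<^sup>2)"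
  define \<eta> where "\<eta> = 1 / (16 * real d ^ 5)"
  define \<Omega> where "\<Omega> = \<Omega>1 \<union> \<Omega>2"
  let ?o = "emb2 0 0"
  have dr: "real d \<ge> 3" using d by simp
  have lat: "x \<in> lattice d" if "x \<in> nbhd0 d" for x using nbhd0_lattice that d by auto
  have sq: "(real d)\<^sup>2 \<ge> 9" using power_mono[of 3 "real d" 2] dr by simp
  have \<delta>: "\<delta> > 0" "\<delta> \<le> 1 / 18" "\<eta> \<le> \<delta>" "\<eta> + \<delta> \<le> 1 / (real d)\<^sup>2"
  proof -
    show "\<delta> > 0" using dr by (simp add: \<delta>_def)
    show "\<delta> \<le> 1 / 18" unfolding \<delta>_def using sq d by (intro divide_left_mono) auto
    have "(real d)\<^sup>2 \<le> real d ^ 5" using dr by (intro power_increasing) auto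
    then have "2 * (real d)\<^sup>2 \<le> 16 * real d ^ 5" using sq by linarith
    then show "\<eta> \<le> \<delta>" unfolding \<eta>_def \<delta>_def using dr by (intro divide_left_mono) auto
    then have "\<eta> + \<delta> \<le> 2 * \<delta>" by simp
    also have "\<dots> = 1 / (real d)\<^sup>2" by (simp add: \<delta>_def)
    finally show "\<eta> + \<delta> \<le> 1 / (real d)\<^sup>2" .
  qed
  have "\<exists>\<A> C. \<A> \<subseteq> \<B> x \<and> is_component d (Hbox d x \<inter> \<Omega>) C \<and> \<Union>\<A> \<subseteq> C \<and>
     (1 - \<eta> - \<delta>) * 2 ^ d \<le> card (nbr_set d x (\<Union>\<A>))" if x: "x \<in> nbhd0 d" for x
    unfolding \<Omega>_def
    by (rule giant_component[OF lat[OF x] \<B>])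
      (use bad[OF x] spr[OF x] \<delta> in \<open>auto simp: \<delta>_def[symmetric], auto simp: \<eta>_def\<close>)
  then have "\<forall>x\<in>nbhd0 d. \<exists>P. fst P \<subseteq> \<B> x \<and> is_component d (Hbox d x \<inter> \<Omega>) (snd P) \<and> \<Union>(fst P) \<subseteq> snd P \<and>
     (1 - \<eta> - \<delta>) * 2 ^ d \<le> card (nbr_set d x (\<Union>(fst P)))" by simp
  from bchoice[OF this] obtain P where P: "\<forall>x\<in>nbhd0 d. fst (P x) \<subseteq> \<B> x \<and> is_component d (Hbox d x \<inter> \<Omega>) (snd (P x)) \<and> \<Union>(fst (P x)) \<subseteq> snd (P x) \<and>
     (1 - \<eta> - \<delta>) * 2 ^ d \<le> card (nbr_set d x (\<Union>(fst (P x))))" by (elim exE)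
  define \<A> where "\<A> x = fst (P x)" for x
  define C where "C x = snd (P x)" for x
  have AC: "\<A> x \<subseteq> \<B> x" "is_component d (Hbox d x \<inter> \<Omega>) (C x)" "\<Union>(\<A> x) \<subseteq> C x"
    "(1 - \<eta> - \<delta>) * 2 ^ d \<le> card (nbr_set d x (\<Union>(\<A> x)))" if "x \<in> nbhd0 d" for x
    using bspec[OF P that] by (simp_all add: \<A>_def C_def)
  have nb: "(1 - 1 / (real d)\<^sup>2) * 2 ^ d \<le> card (nbr_set d x (\<Union>(\<A> x)))" if "x \<in> nbhd0 d" for x
  proof -
    have "(1 - 1 / (real d)\<^sup>2) * 2 ^ d \<le> (1 - \<eta> - \<delta>) * 2 ^ d" using \<delta>(4) by (intro mult_right_mono) auto
    then show ?thesis using AC(4)[OF that] by linarith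
  qed
  have nb78: "7 / 8 * 2 ^ d \<le> real (card (nbr_set d x (\<Union>(\<A> x))))" if "x \<in> nbhd0 d" for x
  proof -
    have "1 / (real d)\<^sup>2 \<le> 1 / 9" using sq d by (intro divide_left_mono) auto
    then have "7 / 8 * 2 ^ d \<le> (1 - 1 / (real d)\<^sup>2) * 2 ^ d" by (intro mult_right_mono) auto
    then show ?thesis using nb[OF that] by linarith
  qed
  define W where "W = \<Omega> \<inter> (\<Union>z\<in>nbhd0 d. Hbox d z)"
  have CW: "C x \<subseteq> W" if "x \<in> nbhd0 d" for x using AC(2)[OF that] that by (auto simp: is_component_def W_def)
  have ptW: "box_pt x u \<in> W" if "x \<in> nbhd0 d" "u \<in> cube d" "box_pt x u \<in> \<Omega>2" for x u
    using that Hbox_eq_image[OF lat] unfolding W_def \<Omega>_def by blast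
  have link: "\<exists>v\<in>C y. \<exists>u\<in>C ?o. conn_in d W v u" if y: "y \<in> nbhd0 d" for y
  proof (cases "y = ?o")
    case True
    then show ?thesis using AC(2)[OF y] CW[OF y] conn_in_refl unfolding is_component_def by blast
  next
    case False
    note o = zero_in_nbhd0[of d]
    from cross[OF y False] AC(1)[OF o] AC(1)[OF y] nb78[OF o] nb78[OF y]
    obtain u v where uv: "u \<in> nbr_set d ?o (\<Union>(\<A> ?o))" "v \<in> nbr_set d y (\<Union>(\<A> y))"
      "adj d (box_pt ?o u) (box_pt y v)" "box_pt ?o u \<in> \<Omega>2" "box_pt y v \<in> \<Omega>2"
      unfolding cross_sprinkled_def by blast
    have cub: "u \<in> cube d" "v \<in> cube d" using uv nbr_set_cube by auto
    note W = ptW[OF o cub(1) uv(4)] ptW[OF y cub(2) uv(5)]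
    obtain i where i: "i < d" "box_pt ?o (flip u i) \<in> C ?o" using uv(1) AC(3)[OF o] by (auto simp: nbr_set_def)
    obtain k where k: "k < d" "box_pt y (flip v k) \<in> C y" using uv(2) AC(3)[OF y] by (auto simp: nbr_set_def)
    have "conn_in d W (box_pt ?o u) (box_pt ?o (flip u i))"
      using CW[OF o] i by (intro conn_in_step[OF W(1) adj_box_pt[OF lat[OF o] cub(1) i(1)]] conn_in_refl) auto
    then have "conn_in d W (box_pt y v) (box_pt ?o (flip u i))"
      by (rule conn_in_step[OF W(2) adj_sym[OF uv(3)]])
    then have "conn_in d W (box_pt y (flip v k)) (box_pt ?o (flip u i))"
      using CW[OF y] k(2) by (intro conn_in_step[OF _ adj_sym[OF adj_box_pt[OF lat[OF y] cub(2) k(1)]]]) auto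
    then show ?thesis using i k by blast
  qed
  show ?thesis
    unfolding open_good_def \<Omega>_def[symmetric]
  proof (intro exI[of _ C] conjI ballI)
    fix x assume x: "x \<in> nbhd0 d"
    show "is_component d (Hbox d x \<inter> \<Omega>) (C x)" by (rule AC(2)[OF x])
    show "(1 - 1 / (real d)\<^sup>2) * real (card (Hbox d x)) \<le> real (card (closure_in d (Hbox d x) (C x)))"
      using nb[OF x] card_nbr_set_le_closure[OF lat[OF x] AC(3)[OF x]] card_Hbox[OF lat[OF x]] by simp
  next
    fix x x' assume x: "x \<in> nbhd0 d" "x' \<in> nbhd0 d"
    obtain v u where vu: "v \<in> C x" "u \<in> C ?o" "conn_in d W v u" using link[OF x(1)] by blast
    obtain v' u' where vu': "v' \<in> C x'" "u' \<in> C ?o" "conn_in d W v' u'" using link[OF x(2)] by blast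
    have "conn_in d (Hbox d ?o \<inter> \<Omega>) u u'" using AC(2)[OF zero_in_nbhd0] vu(2) vu'(2) by (auto simp: is_component_def)
    then have "conn_in d W u u'" by (rule conn_in_mono) (use zero_in_nbhd0 in \<open>auto simp: W_def\<close>)
    then have "conn_in d W v v'" using vu(3) vu'(3) conn_in_trans conn_in_sym by blast
    then show "\<exists>u\<in>C x. \<exists>v\<in>C x'. conn_in d (\<Omega> \<inter> (\<Union>z\<in>nbhd0 d. Hbox d z)) u v"
      using vu(1) vu'(1) unfolding W_def by blast
  qed
qed

text \<open>Keeping \<open>\<Omega>1\<close> as a parameter amounts to conditioning on the first
  stage. There are at most five failure events of each kind; the exponent
  \<open>2 * (2 ^ d div L)\<close> bounds the number of clusters in two boxes and serves for both
  kinds.\<close>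

lemma prob_sprinkling_fails:
  assumes d: "d \<ge> 3" and L: "L \<ge> 1" and q: "0 \<le> q" "q \<le> 1"
    and bad: "\<And>x. x \<in> nbhd0 d \<Longrightarrow> real (card (cube d - nbr_set d x (\<Union>(big_clusters d L x \<Omega>1)))) \<le> 2 ^ d / (16 * real d ^ 5)"
  shows "measure_pmf.prob (Pi_pmf (boxes d) False (\<lambda>_. bernoulli_pmf q)) {g. \<not> open_good d (\<Omega>1 \<union> {z. g z})}
    \<le> 10 * 2 ^ (2 * (2 ^ d div L)) * exp (- q\<^sup>2 * (2 ^ d / (32 * real d ^ 6)))"
proof -
  define D where "D = Pi_pmf (boxes d) False (\<lambda>_. bernoulli_pmf q)"
  define \<B> where "\<B> x = big_clusters d L x \<Omega>1" for x
  define e where "e = exp (- q\<^sup>2 * (2 ^ d / (32 * real d ^ 6)))"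
  define m where "m = 2 ^ d div L"
  define E1 where "E1 x = {g :: (nat \<Rightarrow> int) \<Rightarrow> bool. \<not> sprinkled d (1 / (2 * (real d)\<^sup>2)) x (\<B> x) {z. g z}}" for x
  define E2 where "E2 y = {g :: (nat \<Rightarrow> int) \<Rightarrow> bool. y \<noteq> emb2 0 0 \<and> \<not> cross_sprinkled d (emb2 0 0) y (\<B> (emb2 0 0)) (\<B> y) {z. g z}}" for y
  have lat: "x \<in> lattice d" if "x \<in> nbhd0 d" for x using nbhd0_lattice that d by auto
  have V: "finite (boxes d)" using d by (intro finite_boxes) simp
  have VH: "Hbox d x \<subseteq> boxes d" if "x \<in> nbhd0 d" for x using that by (auto simp: boxes_def)
  have fin: "finite (\<B> x)" if "x \<in> nbhd0 d" for x unfolding \<B>_def by (rule finite_big_clusters[OF lat[OF that]])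
  have cm: "card (\<B> x) \<le> m" if "x \<in> nbhd0 d" for x
    unfolding \<B>_def m_def using card_big_clusters_le[OF lat[OF that]] L
    by (simp add: less_eq_div_iff_mult_less_eq)
  have pw: "(2::real) ^ a * e \<le> 2 ^ (2 * m) * e" if "a \<le> 2 * m" for a
    using that by (intro mult_right_mono power_increasing) (auto simp: e_def)
  have E1: "measure_pmf.prob D (E1 x) \<le> 2 ^ (2 * m) * e" if x: "x \<in> nbhd0 d" for x
  proof -
    have "measure_pmf.prob D (E1 x) \<le> 2 ^ card (\<B> x) * e"
      unfolding D_def E1_def e_def
      by (rule prob_not_sprinkled[OF V VH[OF x] lat[OF x] _ q fin[OF x]]) (use d bad[OF x] in \<open>auto simp: \<B>_def\<close>)
    also have "\<dots> \<le> 2 ^ (2 * m) * e" using cm[OF x] by (intro pw) simp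
    finally show ?thesis .
  qed
  have E2: "measure_pmf.prob D (E2 y) \<le> 2 ^ (2 * m) * e" if y: "y \<in> nbhd0 d" for y
  proof (cases "y = emb2 0 0")
    case True
    then have "E2 y = {}" by (simp add: E2_def)
    then show ?thesis by (simp add: e_def)
  next
    case False
    note o = zero_in_nbhd0[of d]
    obtain j b where j: "j < 2" "y = (emb2 0 0)(j := emb2 0 0 j + (if b then 1 else - 1))"
      using nbhd0_shift[OF y False] by blast
    have "measure_pmf.prob D (E2 y) = measure_pmf.prob D {g. \<not> cross_sprinkled d (emb2 0 0) y (\<B> (emb2 0 0)) (\<B> y) {z. g z}}"
      using False by (simp add: E2_def)
    also have "\<dots> \<le> 2 ^ (card (\<B> (emb2 0 0)) + card (\<B> y)) * e"
      unfolding D_def e_def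
      by (rule prob_not_cross_sprinkled[OF V VH[OF o] VH[OF y] lat[OF o] _ _ j(2) q fin[OF o] fin[OF y]]) (use d j in auto)
    also have "\<dots> \<le> 2 ^ (2 * m) * e" using cm[OF y] cm[OF o] by (intro pw) simp
    finally show ?thesis .
  qed
  have "{g. \<not> open_good d (\<Omega>1 \<union> {z. g z})} \<subseteq> (\<Union>x\<in>nbhd0 d. E1 x) \<union> (\<Union>x\<in>nbhd0 d. E2 x)"
  proof (rule subsetI, rule ccontr)
    fix g assume g: "g \<in> {g. \<not> open_good d (\<Omega>1 \<union> {z. g z})}" and n: "g \<notin> (\<Union>x\<in>nbhd0 d. E1 x) \<union> (\<Union>x\<in>nbhd0 d. E2 x)"
    have "open_good d (\<Omega>1 \<union> {z. g z})"
    proof (rule sprinkled_imp_open_good[OF d \<B>_def])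
      show "real (card (cube d - nbr_set d x (\<Union>(\<B> x)))) \<le> 2 ^ d / (16 * real d ^ 5)" if "x \<in> nbhd0 d" for x
        using bad[OF that] by (simp add: \<B>_def)
      show "sprinkled d (1 / (2 * (real d)\<^sup>2)) x (\<B> x) {z. g z}" if "x \<in> nbhd0 d" for x
        using n that by (auto simp: E1_def)
      show "cross_sprinkled d (emb2 0 0) y (\<B> (emb2 0 0)) (\<B> y) {z. g z}" if "y \<in> nbhd0 d" "y \<noteq> emb2 0 0" for y
        using n that by (auto simp: E2_def)
    qed
    then show False using g by simp
  qed
  then have "measure_pmf.prob D {g. \<not> open_good d (\<Omega>1 \<union> {z. g z})} \<le> measure_pmf.prob D ((\<Union>x\<in>nbhd0 d. E1 x) \<union> (\<Union>x\<in>nbhd0 d. E2 x))"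
    by (intro measure_pmf.finite_measure_mono) auto
  also have "\<dots> \<le> measure_pmf.prob D (\<Union>x\<in>nbhd0 d. E1 x) + measure_pmf.prob D (\<Union>x\<in>nbhd0 d. E2 x)"
    by (rule measure_Un_le) auto
  also have "\<dots> \<le> real (card (nbhd0 d)) * (2 ^ (2 * m) * e) + real (card (nbhd0 d)) * (2 ^ (2 * m) * e)"
    by (intro add_mono prob_UN_le E1 E2) auto
  also have "\<dots> \<le> 5 * (2 ^ (2 * m) * e) + 5 * (2 ^ (2 * m) * e)"
    using card_nbhd0_le[of d] by (intro add_mono mult_right_mono) (auto simp: e_def)
  finally show ?thesis by (simp add: D_def e_def m_def)
qed

section \<open>Splitting the configuration into two stages\<close>

text \<open>\<open>p2\<close> is the solution of \<open>p1 + (1 - p1) p2 = p\<close>. It is at least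
  \<open>p / 2\<close>, so each stage keeps at least half of the density.\<close>

lemma bernoulli_pmf_or:
  assumes "0 \<le> p" "p \<le> 1" "p1 = p / 2" "p2 = (p / 2) / (1 - p / 2)"
  shows "bernoulli_pmf p = bind_pmf (bernoulli_pmf p1) (\<lambda>b. bind_pmf (bernoulli_pmf p2) (\<lambda>c. return_pmf (b \<or> c)))"
proof -
  have p: "0 \<le> p1" "p1 \<le> 1" "0 \<le> p2" "p2 \<le> 1" "p1 + (1 - p1) * p2 = p"
  proof -
    have pos: "1 - p / 2 > 0" using assms by simp
    show "0 \<le> p1" "p1 \<le> 1" using assms by auto
    show "0 \<le> p2" unfolding assms(4) using pos assms(1) by (intro divide_nonneg_pos) auto
    show "p2 \<le> 1" unfolding assms(4) using pos assms(2) by (simp add: pos_divide_le_eq)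
    have "r * (b / r) = b" if "r > 0" for r b :: real using that by simp
    from this[OF pos, of "p / 2"] show "p1 + (1 - p1) * p2 = p" unfolding assms(3,4) by linarith
  qed
  have "pmf (bind_pmf (bernoulli_pmf p1) (\<lambda>b. bind_pmf (bernoulli_pmf p2) (\<lambda>c. return_pmf (b \<or> c)))) True = p"
    using p by (simp add: pmf_bind mult.commute)
  moreover have "pmf (bernoulli_pmf p) True = p" using assms by simp
  ultimately show ?thesis
    by (intro pmf_eqI) (metis (full_types) pmf_False_conv_True)
qed

lemma Pi_pmf_bernoulli_or:
  assumes "finite V" "0 \<le> p" "p \<le> 1" "p1 = p / 2" "p2 = (p / 2) / (1 - p / 2)"
  shows "Pi_pmf V False (\<lambda>_. bernoulli_pmf p) =
    bind_pmf (Pi_pmf V False (\<lambda>_. bernoulli_pmf p1)) (\<lambda>f.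
      bind_pmf (Pi_pmf V False (\<lambda>_. bernoulli_pmf p2)) (\<lambda>g. return_pmf (\<lambda>x. if x \<in> V then f x \<or> g x else False)))"
  unfolding bernoulli_pmf_or[OF assms(2-5)]
  using assms(1) by (simp add: Pi_pmf_bind[where d' = False])

lemma prob_bind_pmf_le:
  assumes "\<And>x. x \<notin> B \<Longrightarrow> measure_pmf.prob (F x) A \<le> c" "c \<ge> 0"
  shows "measure_pmf.prob (bind_pmf D F) A \<le> measure_pmf.prob D B + c"
proof -
  have "emeasure (measure_pmf (bind_pmf D F)) A = (\<integral>\<^sup>+x. emeasure (measure_pmf (F x)) A \<partial>measure_pmf D)"
    by (rule emeasure_bind_pmf)
  also have "\<dots> \<le> (\<integral>\<^sup>+x. indicator B x + ennreal c \<partial>measure_pmf D)"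
  proof (rule nn_integral_mono)
    fix x
    show "emeasure (measure_pmf (F x)) A \<le> indicator B x + ennreal c"
    proof (cases "x \<in> B")
      case True
      have "emeasure (measure_pmf (F x)) A \<le> 1" by (rule measure_pmf.emeasure_le_1)
      then show ?thesis using True by (simp add: add_increasing2)
    next
      case False
      then show ?thesis using assms(1)[OF False] by (simp add: measure_pmf.emeasure_eq_measure ennreal_leI)
    qed
  qed
  also have "\<dots> = emeasure (measure_pmf D) B + ennreal c"
    by (simp add: nn_integral_add measure_pmf.emeasure_space_1[simplified])
  also have "\<dots> = ennreal (measure_pmf.prob D B + c)"
    using assms(2) by (simp add: measure_pmf.emeasure_eq_measure ennreal_plus)
  finally have "ennreal (measure_pmf.prob (bind_pmf D F) A) \<le> ennreal (measure_pmf.prob D B + c)"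
    by (simp only: measure_pmf.emeasure_eq_measure)
  then show ?thesis using assms(2) by (subst (asm) ennreal_le_iff) auto
qed

text \<open>Markov's inequality for a counting variable. Trees rooted at different vertices overlap,
  so the argument stays with the first moment.\<close>

lemma prob_count_gt:
  assumes Q: "finite Q" and t: "t > 0" and c: "\<And>S. S \<in> Q \<Longrightarrow> measure_pmf.prob D {f. R S f} \<le> c"
  shows "measure_pmf.prob D {f. t < real (card {S \<in> Q. R S f})} \<le> real (card Q) * c / t"
proof -
  have eq: "real (card {S \<in> Q. R S f}) = (\<Sum>S\<in>Q. indicator {f. R S f} f)" for f
    using Q by (simp add: indicator_def sum.If_cases Int_def)
  have int: "integrable (measure_pmf D) (indicator A :: _ \<Rightarrow> real)" for A
    by (rule measure_pmf.integrable_const_bound[where B = 1]) (auto simp: indicator_def)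
  have "t * measure_pmf.prob D {f. t < real (card {S \<in> Q. R S f})}
      = (\<integral>f. t * indicator {f. t < real (card {S \<in> Q. R S f})} f \<partial>measure_pmf D)" by simp
  also have "\<dots> \<le> (\<integral>f. (\<Sum>S\<in>Q. indicator {f. R S f} f) \<partial>measure_pmf D)"
  proof (rule integral_mono)
    show "integrable (measure_pmf D) (\<lambda>f. t * indicator {f. t < real (card {S \<in> Q. R S f})} f)"
      using int by (intro integrable_mult_right)
    show "integrable (measure_pmf D) (\<lambda>f. \<Sum>S\<in>Q. indicator {f. R S f} f :: real)"
      using int by (intro Bochner_Integration.integrable_sum)
    show "t * indicator {f. t < real (card {S \<in> Q. R S f})} f \<le> (\<Sum>S\<in>Q. indicator {f. R S f} f)" for f
      unfolding eq[symmetric] by (simp add: indicator_def)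
  qed
  also have "\<dots> = (\<Sum>S\<in>Q. measure_pmf.prob D {f. R S f})"
    using int by (subst Bochner_Integration.integral_sum) auto
  also have "\<dots> \<le> (\<Sum>S\<in>Q. c)" by (intro sum_mono c)
  finally show ?thesis using t by (simp add: field_simps)
qed

text \<open>Depth \<open>Suc K\<close> is one more than the cluster needs: its first level leads
  from \<open>S\<close>, which may be closed, to an open child, whose own tree of depth
  \<open>K\<close> has \<open>N ^ K\<close> leaves.\<close>

lemma tree_imp_nbr_set:
  assumes x: "x \<in> lattice d" and S: "S \<in> cube d" and N: "N \<ge> 1" and s: "Suc K * N * s \<le> d"
    and tree: "tree N s (\<lambda>T. box_pt x T \<in> \<Omega>) (Suc K) S"
  shows "S \<in> nbr_set d x (\<Union>(big_clusters d (N ^ K) x \<Omega>))"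
proof -
  have "0 < N" using N by simp
  then obtain i where i: "i \<in> {(K * N + 0) * s..<(K * N + 0 + 1) * s}" "box_pt x (flip S i) \<in> \<Omega>"
    "tree N s (\<lambda>T. box_pt x T \<in> \<Omega>) K (flip S i)"
    using tree unfolding tree.simps by blast
  have id: "i < d" using block_bounds(2)[OF \<open>0 < N\<close> i(1)] s by (rule less_le_trans)
  have c: "flip S i \<in> cube d" by (rule flip_in_cube[OF S id])
  have "K * N * s \<le> Suc K * N * s" by (intro mult_le_mono1) simp
  then have "K * N * s \<le> d" using s by (rule le_trans)
  from tree_large_cluster[where \<iota> = "box_pt x" and \<Omega> = "Hbox d x \<inter> \<Omega>", OF adj_box_pt[OF x] _ i(3) c this]
  obtain X where X: "X \<subseteq> subcube (K * N * s) (flip S i)" "finite X" "card X = N ^ K"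
    "box_pt x (flip S i) \<in> Hbox d x \<inter> \<Omega> \<longrightarrow> (\<forall>u\<in>X. conn_in d (Hbox d x \<inter> \<Omega>) (box_pt x (flip S i)) (box_pt x u))"
    using Hbox_eq_image[OF x] by blast
  have a: "box_pt x (flip S i) \<in> Hbox d x \<inter> \<Omega>" using c i(2) Hbox_eq_image[OF x] by blast
  define P where "P = box_cluster d x \<Omega> (box_pt x (flip S i))"
  have "box_pt x ` X \<subseteq> P" using X(4) a by (auto simp: P_def box_cluster_def)
  moreover have "finite P"
    using finite_Hbox[OF x] conn_in_mem by (intro finite_subset[of P "Hbox d x"]) (auto simp: P_def box_cluster_def)
  ultimately have "card (box_pt x ` X) \<le> card P" by (intro card_mono)
  then have "N ^ K \<le> card P" using X by (simp add: card_image[OF inj_box_pt])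
  then have "P \<in> big_clusters d (N ^ K) x \<Omega>" using a unfolding big_clusters_def P_def by blast
  moreover have "box_pt x (flip S i) \<in> P" using conn_in_refl[OF a] by (simp add: P_def box_cluster_def)
  ultimately show ?thesis using S id unfolding nbr_set_def by blast
qed

text \<open>The first term is Markov's inequality in five boxes with threshold
  \<open>2^d / (16 d^5)\<close>, hence the factor 80; \<open>p / 4\<close> is half of the
  first-stage density. The second term is the sprinkling estimate with \<open>p / 2\<close> as lower
  bound for the second density.\<close>

lemma prob_not_open_good:
  assumes d: "d \<ge> 3" and p: "0 \<le> p" "p \<le> 1" and N: "N \<ge> 1" and s: "Suc K * N * s \<le> d"
    and half: "real N * (1 - p / 4) ^ s \<le> 1 / 2"
  shows "measure_pmf.prob (Pi_pmf (boxes d) False (\<lambda>_. bernoulli_pmf p)) {f. \<not> open_good d {z \<in> boxes d. f z}}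
    \<le> 80 * real d ^ 5 * (real N * (1 - p / 4) ^ s)
      + 10 * 2 ^ (2 * (2 ^ d div (N ^ K))) * exp (- (p / 2)\<^sup>2 * (2 ^ d / (32 * real d ^ 6)))"
proof -
  define V where "V = boxes d"
  define p1 where "p1 = p / 2"
  define p2 where "p2 = (p / 2) / (1 - p / 2)"
  have pp: "0 \<le> p1" "p1 \<le> 1" "0 \<le> p2" "p2 \<le> 1" "p / 2 \<le> p2"
    using p by (auto simp: p1_def p2_def field_simps mult_left_le)
  define D1 where "D1 = Pi_pmf V False (\<lambda>_. bernoulli_pmf p1)"
  define D2 where "D2 = Pi_pmf V False (\<lambda>_. bernoulli_pmf p2)"
  define c where "c = real N * (1 - p / 4) ^ s"
  define e where "e = 10 * 2 ^ (2 * (2 ^ d div (N ^ K))) * exp (- (p / 2)\<^sup>2 * (2 ^ d / (32 * real d ^ 6)))"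
  define Bx where "Bx x = {f. 2 ^ d / (16 * real d ^ 5) < real (card {S \<in> cube d. \<not> tree N s (\<lambda>T. f (box_pt x T)) (Suc K) S})}" for x
  have V: "finite V" unfolding V_def using d by (intro finite_boxes) simp
  have lat: "x \<in> lattice d" if "x \<in> nbhd0 d" for x using nbhd0_lattice that d by auto
  have VH: "Hbox d x \<subseteq> V" if "x \<in> nbhd0 d" for x using that by (auto simp: V_def boxes_def)
  have B: "measure_pmf.prob D1 (\<Union>x\<in>nbhd0 d. Bx x) \<le> 80 * real d ^ 5 * c"
  proof -
    have "measure_pmf.prob D1 (Bx x) \<le> 16 * real d ^ 5 * c" if x: "x \<in> nbhd0 d" for x
    proof -
      have "measure_pmf.prob D1 (Bx x) \<le> real (card (cube d)) * c / (2 ^ d / (16 * real d ^ 5))"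
        unfolding Bx_def
      proof (rule prob_count_gt)
        show "measure_pmf.prob D1 {f. \<not> tree N s (\<lambda>T. f (box_pt x T)) (Suc K) S} \<le> c" if "S \<in> cube d" for S
        proof -
          have p4: "1 - p1 / 2 = 1 - p / 4" by (simp add: p1_def)
          show ?thesis
            unfolding D1_def c_def p4[symmetric]
            by (rule prob_not_tree[OF V inj_box_pt _ pp(1,2) _ that s])
              (use VH[OF x] half Hbox_eq_image[OF lat[OF x]] in \<open>auto simp: p4\<close>)
        qed
      qed (use d in auto)
      then show ?thesis by (simp add: card_cube mult.commute)
    qed
    then have "measure_pmf.prob D1 (\<Union>x\<in>nbhd0 d. Bx x) \<le> real (card (nbhd0 d)) * (16 * real d ^ 5 * c)"
      by (intro prob_UN_le) auto
    also have "\<dots> \<le> 5 * (16 * real d ^ 5 * c)"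
      using card_nbhd0_le[of d] p by (intro mult_right_mono) (auto simp: c_def)
    finally show ?thesis by simp
  qed
  have "measure_pmf.prob (Pi_pmf V False (\<lambda>_. bernoulli_pmf p)) {f. \<not> open_good d {z \<in> V. f z}}
     \<le> measure_pmf.prob D1 (\<Union>x\<in>nbhd0 d. Bx x) + e"
    unfolding Pi_pmf_bernoulli_or[OF V p p1_def p2_def] D1_def[symmetric] D2_def[symmetric]
  proof (rule prob_bind_pmf_le)
    fix f assume f: "f \<notin> (\<Union>x\<in>nbhd0 d. Bx x)"
    define \<Omega>1 where "\<Omega>1 = {z \<in> V. f z}"
    have bad: "real (card (cube d - nbr_set d x (\<Union>(big_clusters d (N ^ K) x \<Omega>1)))) \<le> 2 ^ d / (16 * real d ^ 5)"
      if x: "x \<in> nbhd0 d" for x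
    proof -
      have "cube d - nbr_set d x (\<Union>(big_clusters d (N ^ K) x \<Omega>1)) \<subseteq> {S \<in> cube d. \<not> tree N s (\<lambda>T. f (box_pt x T)) (Suc K) S}"
      proof safe
        fix S assume S: "S \<in> cube d" "tree N s (\<lambda>T. f (box_pt x T)) (Suc K) S"
          "S \<notin> nbr_set d x (\<Union>(big_clusters d (N ^ K) x \<Omega>1))"
        have "tree N s (\<lambda>T. f (box_pt x T)) (Suc K) S = tree N s (\<lambda>T. box_pt x T \<in> \<Omega>1) (Suc K) S"
        proof (rule tree_cong)
          fix u assume "u \<in> subcube (Suc K * N * s) S - {S}"
          then have "u \<in> cube d" using subcube_cube[OF S(1) s] by blast
          then have "box_pt x u \<in> V" using VH[OF x] Hbox_eq_image[OF lat[OF x]] by blast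
          then show "f (box_pt x u) = (box_pt x u \<in> \<Omega>1)" by (simp add: \<Omega>1_def)
        qed
        then show False using tree_imp_nbr_set[OF lat[OF x] S(1) N s] S by blast
      qed
      then have "card (cube d - nbr_set d x (\<Union>(big_clusters d (N ^ K) x \<Omega>1)))
         \<le> card {S \<in> cube d. \<not> tree N s (\<lambda>T. f (box_pt x T)) (Suc K) S}" by (intro card_mono) auto
      moreover have "real (card {S \<in> cube d. \<not> tree N s (\<lambda>T. f (box_pt x T)) (Suc K) S}) \<le> 2 ^ d / (16 * real d ^ 5)"
        using f x by (auto simp: Bx_def not_less)
      ultimately show ?thesis by linarith
    qed
    have "measure_pmf.prob (bind_pmf D2 (\<lambda>g. return_pmf (\<lambda>x. if x \<in> V then f x \<or> g x else False))) {f. \<not> open_good d {z \<in> V. f z}}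
       = measure_pmf.prob D2 {g. \<not> open_good d {z \<in> V. f z \<or> g z}}"
    proof -
      have "bind_pmf D2 (\<lambda>g. return_pmf (\<lambda>x. if x \<in> V then f x \<or> g x else False)) = map_pmf (\<lambda>g x. if x \<in> V then f x \<or> g x else False) D2"
        by (simp add: map_pmf_def)
      moreover have "(\<lambda>g x. if x \<in> V then f x \<or> g x else False) -` {f. \<not> open_good d {z \<in> V. f z}} = {g. \<not> open_good d {z \<in> V. f z \<or> g z}}"
        by (auto cong: conj_cong)
      ultimately show ?thesis by simp
    qed
    also have "\<dots> \<le> measure_pmf.prob D2 {g. \<not> open_good d (\<Omega>1 \<union> {z. g z})}"
    proof -
      have "AE g in measure_pmf D2. \<not> open_good d {z \<in> V. f z \<or> g z} \<longrightarrow> \<not> open_good d (\<Omega>1 \<union> {z. g z})"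
      proof (rule AE_pmfI)
        fix g assume "g \<in> set_pmf D2"
        then have "\<forall>z. z \<notin> V \<longrightarrow> \<not> g z"
          using subsetD[OF set_Pi_pmf_subset[OF V, of False "\<lambda>_. bernoulli_pmf p2"], of g] by (simp add: D2_def)
        then have "{z \<in> V. f z \<or> g z} = \<Omega>1 \<union> {z. g z}" unfolding \<Omega>1_def by blast
        then show "\<not> open_good d {z \<in> V. f z \<or> g z} \<longrightarrow> \<not> open_good d (\<Omega>1 \<union> {z. g z})" by simp
      qed
      then show ?thesis by (intro measure_pmf.finite_measure_mono_AE) auto
    qed
    also have "\<dots> \<le> 10 * 2 ^ (2 * (2 ^ d div (N ^ K))) * exp (- p2\<^sup>2 * (2 ^ d / (32 * real d ^ 6)))"
      unfolding D2_def V_def using N by (intro prob_sprinkling_fails[OF d _ pp(3,4) bad]) auto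
    also have "\<dots> \<le> e"
    proof -
      have "(p / 2)\<^sup>2 \<le> p2\<^sup>2" using pp p by (intro power_mono) auto
      then have "(p / 2)\<^sup>2 * (2 ^ d / (32 * real d ^ 6)) \<le> p2\<^sup>2 * (2 ^ d / (32 * real d ^ 6))"
        by (intro mult_right_mono) auto
      then show ?thesis unfolding e_def by (intro mult_left_mono) auto
    qed
    finally show "measure_pmf.prob (bind_pmf D2 (\<lambda>g. return_pmf (\<lambda>x. if x \<in> V then f x \<or> g x else False))) {f. \<not> open_good d {z \<in> V. f z}} \<le> e" .
  qed (simp add: e_def)
  then show ?thesis using B unfolding e_def c_def V_def by linarith
qed

section \<open>Conclusion\<close>

lemma open_good_cong:
  assumes "\<Omega> \<inter> boxes d = \<Omega>' \<inter> boxes d"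
  shows "open_good d \<Omega> = open_good d \<Omega>'"
proof -
  have "Hbox d x \<inter> \<Omega> = Hbox d x \<inter> \<Omega>'" if "x \<in> nbhd0 d" for x
    using assms that unfolding boxes_def by blast
  then show ?thesis
    using assms unfolding open_good_def boxes_def by (simp cong: ball_cong)
qed

lemma G0_eq_open_good: "G0 d h f = open_good d {x \<in> boxes d. f x \<ge> h}"
proof -
  have "G0 d h f = open_good d (level_set d f h)"
    by (simp add: G0_def open_good_def)
  also have "\<dots> = open_good d {x \<in> boxes d. f x \<ge> h}"
    by (rule open_good_cong) (use boxes_lattice[of d] in \<open>auto simp: level_set_def\<close>)
  finally show ?thesis .
qed

section \<open>Choice of the exponents\<close>

text \<open>A threshold \<open>\<theta> sqrt (2 log d)\<close> is exceeded with probability about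
  \<open>d^(-\<theta>^2)\<close>, which must beat \<open>d^(2\<epsilon> - 1)\<close>. Here
  \<open>\<theta>\<close> is the relative level, cut off at 0, plus an allowance
  \<open>\<epsilon>\<close> for all errors; from \<open>\<epsilon> = 1/8\<close> on only the
  allowance remains.\<close>

lemma exponent_gap:
  fixes \<epsilon> :: real
  assumes "0 < \<epsilon>" "\<epsilon> < 1 / 3"
  shows "(max 0 (1 - 8 * \<epsilon>) + \<epsilon>)\<^sup>2 < 1 - 2 * \<epsilon>"
proof (cases "\<epsilon> < 1 / 8")
  case True
  define t where "t = 1 - 7 * \<epsilon>"
  have t: "0 \<le> t" "t \<le> 1" using assms True by (auto simp: t_def)
  have "t * t \<le> t * 1" using t by (intro mult_left_mono) auto
  moreover have "t < 1 - 2 * \<epsilon>" using assms by (simp add: t_def)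
  moreover have "max 0 (1 - 8 * \<epsilon>) + \<epsilon> = t" using True by (simp add: t_def)
  ultimately show ?thesis by (simp add: power2_eq_square)
next
  case False
  have "\<epsilon> * \<epsilon> \<le> 1 / 3 * \<epsilon>" using assms by (intro mult_right_mono) auto
  then have "\<epsilon> * \<epsilon> < 1 - 2 * \<epsilon>" using assms by linarith
  then show ?thesis using False by (simp add: power2_eq_square)
qed

text \<open>Half of the allowance \<open>\<epsilon> sqrt (2 log d)\<close> is the residual bound
  added to the threshold. The other half absorbs the factor \<open>sqrt g\<close> in
  \<open>h_as\<close> and the unit shift of the tail bound; the strict gap \<open>\<gamma>\<close>
  absorbs \<open>sqrt (2 pi)\<close>.\<close>

lemma eventually_level_probability:
  fixes \<epsilon> C :: real
  assumes \<epsilon>: "0 < \<epsilon>" "\<epsilon> < 1 / 3" and C: "C > 0"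
  shows "\<forall>\<^sub>F d in sequentially. green d (\<lambda>_. 0) (\<lambda>_. 0) \<le> 1 + C / real d \<longrightarrow>
     real d powr (2 * \<epsilon> - 1) \<le> measure std_normal_distribution {max 0 (h_as d * (1 - 8 * \<epsilon>)) + \<epsilon> / 2 * sqrt (2 * ln (real d))..}"
proof -
  define m where "m = max 0 (1 - 8 * \<epsilon>)"
  define \<theta> where "\<theta> = m + \<epsilon>"
  define \<gamma> where "\<gamma> = 1 - 2 * \<epsilon> - \<theta>\<^sup>2"
  have \<gamma>: "\<gamma> > 0" using exponent_gap[OF \<epsilon>] by (simp add: \<gamma>_def \<theta>_def m_def)
  have m: "0 \<le> m" "m \<le> 1" using \<epsilon> by (auto simp: m_def)
  have "\<forall>\<^sub>F d::nat in sequentially. sqrt (2 * ln (real d)) * (C / real d) + \<epsilon> / 2 * sqrt (2 * ln (real d)) + 1 \<le> \<epsilon> * sqrt (2 * ln (real d))"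
    using \<epsilon>(1) C by real_asymp
  moreover have "\<forall>\<^sub>F d::nat in sequentially. sqrt (2 * pi) \<le> real d powr \<gamma>"
    using \<gamma> by real_asymp
  ultimately show ?thesis using eventually_ge_at_top[of 6]
  proof eventually_elim
    case (elim d)
    show ?case
    proof
      assume g: "green d (\<lambda>_. 0) (\<lambda>_. 0) \<le> 1 + C / real d"
      define l where "l = sqrt (2 * ln (real d))"
      have d: "real d \<ge> 6" using elim by simp
      have l: "l \<ge> 0" "l\<^sup>2 = 2 * ln (real d)" using d by (auto simp: l_def)
      have "h_as d \<le> l * (1 + C / real d)"
      proof -
        have "1 + C / real d \<le> (1 + C / real d)\<^sup>2"
        proof -
          have "(1 + C / real d) * 1 \<le> (1 + C / real d) * (1 + C / real d)"
            using C d by (intro mult_left_mono) auto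
          then show ?thesis by (simp add: power2_eq_square)
        qed
        then have "green d (\<lambda>_. 0) (\<lambda>_. 0) \<le> (1 + C / real d)\<^sup>2" using g by linarith
        then have "2 * ln (real d) * green d (\<lambda>_. 0) (\<lambda>_. 0) \<le> 2 * ln (real d) * (1 + C / real d)\<^sup>2"
          using d by (intro mult_left_mono) auto
        then have "2 * green d (\<lambda>_. 0) (\<lambda>_. 0) * ln (real d) \<le> (l * (1 + C / real d))\<^sup>2"
          by (simp add: power_mult_distrib l(2) mult_ac)
        then show ?thesis unfolding h_as_def using l C d by (intro real_le_lsqrt) auto
      qed
      then have h: "m * h_as d \<le> m * l + l * (C / real d)"
      proof -
        assume h: "h_as d \<le> l * (1 + C / real d)"
        have "m * h_as d \<le> m * (l * (1 + C / real d))" using m h by (intro mult_left_mono)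
        also have "\<dots> = m * l + m * (l * (C / real d))" by (simp add: algebra_simps)
        also have "m * (l * (C / real d)) \<le> 1 * (l * (C / real d))"
          using m l C d by (intro mult_right_mono) auto
        finally show ?thesis by simp
      qed
      define T where "T = max 0 (h_as d * (1 - 8 * \<epsilon>)) + \<epsilon> / 2 * l"
      have "max 0 (h_as d * (1 - 8 * \<epsilon>)) \<le> m * l + l * (C / real d)"
      proof -
        have "green d (\<lambda>_. 0) (\<lambda>_. 0) \<ge> 0"
          unfolding green_def using elim(3)
          by (intro suminf_nonneg summable_srw_p srw_p_nonneg) (auto simp: lattice_def)
        then have "h_as d \<ge> 0" unfolding h_as_def using d by simp
        then have "h_as d * (1 - 8 * \<epsilon>) \<le> h_as d * m" by (intro mult_left_mono) (auto simp: m_def)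
        then have "h_as d * (1 - 8 * \<epsilon>) \<le> m * l + l * (C / real d)" using h by (simp add: mult.commute)
        moreover have "0 \<le> m * l + l * (C / real d)" using m l C by auto
        ultimately show ?thesis by simp
      qed
      then have T: "T + 1 \<le> \<theta> * l" "0 \<le> T"
        using elim(1) \<epsilon> l unfolding T_def \<theta>_def l_def[symmetric] by (auto simp: algebra_simps)
      have "(T + 1)\<^sup>2 \<le> (\<theta> * l)\<^sup>2" using T by (intro power_mono) auto
      also have "\<dots> = 2 * (\<theta>\<^sup>2 * ln (real d))" by (simp add: power_mult_distrib l(2))
      finally have "exp (- (\<theta>\<^sup>2 * ln (real d))) \<le> exp (- (T + 1)\<^sup>2 / 2)" by simp
      then have 1: "real d powr (- \<theta>\<^sup>2) \<le> exp (- (T + 1)\<^sup>2 / 2)" using d by (simp add: powr_def)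
      have "real d powr (2 * \<epsilon> - 1) * sqrt (2 * pi) \<le> real d powr (2 * \<epsilon> - 1) * real d powr \<gamma>"
        using elim(2) by (intro mult_left_mono) auto
      also have "\<dots> = real d powr (- \<theta>\<^sup>2)" by (simp add: powr_add[symmetric] \<gamma>_def)
      finally have "real d powr (2 * \<epsilon> - 1) * sqrt (2 * pi) \<le> exp (- (T + 1)\<^sup>2 / 2)" using 1 by linarith
      then have "real d powr (2 * \<epsilon> - 1) \<le> std_normal_density (T + 1)"
        unfolding std_normal_density_def by (simp add: pos_le_divide_eq)
      also have "\<dots> \<le> measure std_normal_distribution {T..}" by (rule std_normal_upper_tail_ge[OF T(2)])
      finally show "real d powr (2 * \<epsilon> - 1) \<le> measure std_normal_distribution
          {max 0 (h_as d * (1 - 8 * \<epsilon>)) + \<epsilon> / 2 * sqrt (2 * ln (real d))..}"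
        by (simp add: T_def l_def)
    qed
  qed
qed

text \<open>The coordinates available limit the tree by \<open>(K + 1) N s \<le> d\<close>. With
  \<open>N\<close> of order \<open>d^\<epsilon>\<close> and \<open>s\<close> of order
  \<open>d^(1 - \<epsilon>)\<close>, a block has on average at least a multiple of
  \<open>d^\<epsilon>\<close> open candidates, while a depth depending only on
  \<open>\<epsilon>\<close> already gives clusters of size \<open>d^10\<close>.\<close>

lemma eventually_bernoulli_percolation:
  fixes \<epsilon> :: real
  assumes \<epsilon>: "0 < \<epsilon>" "\<epsilon> < 1 / 3"
  shows "\<exists>a>0. a \<le> 1 \<and> (\<forall>\<^sub>F d in sequentially. \<forall>p. real d powr (2 * \<epsilon> - 1) \<le> p \<longrightarrow> p \<le> 1 \<longrightarrow>
     measure_pmf.prob (Pi_pmf (boxes d) False (\<lambda>_. bernoulli_pmf p)) {f. \<not> open_good d {z \<in> boxes d. f z}}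
       \<le> exp (- a * real d powr \<epsilon>) + exp (- real d))"
proof -
  \<comment> \<open>As \<open>N \<ge> d^(\<epsilon>/2)\<close>, depth \<open>20 / \<epsilon>\<close>
    makes \<open>N ^ K\<close> at least \<open>d^10\<close>.\<close>
  define K where "K = nat \<lceil>20 / \<epsilon>\<rceil>"
  define k where "k = real (Suc K)"
  \<comment> \<open>This is the constant in \<open>p s / 4 \<ge> a d^\<epsilon>\<close>, where
    rounding \<open>s\<close> down costs the factor 2 in
    \<open>s \<ge> d^(1 - \<epsilon>) / (2 k)\<close>.\<close>
  define a where "a = 1 / (8 * k)"
  have k: "k \<ge> 1" by (simp add: k_def)
  have a: "a > 0" "a \<le> 1" using k by (auto simp: a_def divide_simps)
  have K: "real K \<ge> 20 / \<epsilon>" unfolding K_def using real_nat_ceiling_ge by blast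
  then have K\<epsilon>: "\<epsilon> / 2 * real K \<ge> 10" using \<epsilon> by (simp add: field_simps)
  have ev1: "\<forall>\<^sub>F d::nat in sequentially. real d powr (\<epsilon> / 2) \<le> real d powr \<epsilon> - 1"
    using \<epsilon>(1) by real_asymp
  have ev2: "\<forall>\<^sub>F d::nat in sequentially. real d powr (1 - \<epsilon>) / (2 * k) \<le> real d powr (1 - \<epsilon>) / k - 1"
  proof -
    have "\<epsilon> < 1" "k > 0" using \<epsilon> k by auto
    then show ?thesis using \<epsilon>(1) by real_asymp
  qed
  have ev3: "\<forall>\<^sub>F d::nat in sequentially. real d * exp (- a * real d powr \<epsilon>) \<le> 1 / 2"
    using \<epsilon>(1) a(1) by real_asymp
  have ev4: "\<forall>\<^sub>F d::nat in sequentially. 80 * real d ^ 5 * (real d * exp (- a * real d powr \<epsilon>)) \<le> exp (- (a / 2) * real d powr \<epsilon>)"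
    using \<epsilon>(1) a(1) by real_asymp
  have ev5: "\<forall>\<^sub>F d::nat in sequentially. 1 / real d \<le> real d powr (2 * \<epsilon> - 1) / 2"
    using \<epsilon>(1) by real_asymp
  have ev6: "\<forall>\<^sub>F d::nat in sequentially. 10 * exp (- (2 ^ d / (64 * real d ^ 8))) \<le> exp (- real d)"
    by real_asymp
  have "\<forall>\<^sub>F d in sequentially. \<forall>p. real d powr (2 * \<epsilon> - 1) \<le> p \<longrightarrow> p \<le> 1 \<longrightarrow>
     measure_pmf.prob (Pi_pmf (boxes d) False (\<lambda>_. bernoulli_pmf p)) {f. \<not> open_good d {z \<in> boxes d. f z}}
       \<le> exp (- (a / 2) * real d powr \<epsilon>) + exp (- real d)"
    using ev1 ev2 ev3 ev4 ev5 ev6 eventually_ge_at_top[of 12]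
  proof eventually_elim
    case (elim d)
    show ?case
    proof (intro allI impI)
      fix p assume p: "real d powr (2 * \<epsilon> - 1) \<le> p" "p \<le> 1"
      have d: "real d \<ge> 12" using elim by simp
      have p0: "0 \<le> p" using p(1) by (meson order_trans powr_ge_zero)
      define N where "N = nat \<lfloor>real d powr \<epsilon>\<rfloor>"
      define s where "s = nat \<lfloor>real d powr (1 - \<epsilon>) / k\<rfloor>"
      have N: "real N \<le> real d powr \<epsilon>" "real d powr (\<epsilon> / 2) \<le> real N"
        using elim(1) unfolding N_def by (auto simp: of_nat_nat intro: order_trans[OF _ less_imp_le])
      have s: "real s \<le> real d powr (1 - \<epsilon>) / k" "real d powr (1 - \<epsilon>) / (2 * k) \<le> real s"
      proof -
        have "real d powr (1 - \<epsilon>) / k \<ge> 0" using k by auto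
        then show "real s \<le> real d powr (1 - \<epsilon>) / k" unfolding s_def by linarith
        show "real d powr (1 - \<epsilon>) / (2 * k) \<le> real s" using elim(2) unfolding s_def by linarith
      qed
      have "1 \<le> real d powr (\<epsilon> / 2)" using d \<epsilon> by (intro ge_one_powr_ge_zero) auto
      then have N1: "N \<ge> 1" using N(2) by linarith
      have Nd: "real N \<le> real d"
      proof -
        have "real d powr \<epsilon> \<le> real d powr 1" using d \<epsilon> by (intro powr_mono) auto
        then show ?thesis using N d by simp
      qed
      have "k * real N * real s \<le> k * real d powr \<epsilon> * (real d powr (1 - \<epsilon>) / k)"
        using N s k by (intro mult_mono) auto
      also have "\<dots> = real d" using k d by (simp add: powr_add[symmetric])
      finally have "real (Suc K * N * s) \<le> real d" unfolding k_def by (simp only: of_nat_mult)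
      then have Ks: "Suc K * N * s \<le> d" by (simp only: of_nat_le_iff)
      have c: "real N * (1 - p / 4) ^ s \<le> real d * exp (- a * real d powr \<epsilon>)"
      proof (rule mult_mono[OF Nd])
        have "(1 - p / 4) ^ s \<le> exp (- (p / 4)) ^ s"
          using p p0 exp_ge_add_one_self[of "- (p / 4)"] by (intro power_mono) auto
        also have "\<dots> = exp (- (p / 4 * real s))" by (simp add: exp_of_nat_mult[symmetric] mult.commute)
        also have "\<dots> \<le> exp (- (a * real d powr \<epsilon>))"
        proof -
          have "a * real d powr \<epsilon> = real d powr (2 * \<epsilon> - 1) / 4 * (real d powr (1 - \<epsilon>) / (2 * k))"
          proof -
            have "real d powr \<epsilon> = real d powr (2 * \<epsilon> - 1) * real d powr (1 - \<epsilon>)"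
              by (simp add: powr_add[symmetric])
            then show ?thesis by (simp add: a_def)
          qed
          also have "\<dots> \<le> p / 4 * real s" using p p0 s k by (intro mult_mono) auto
          finally show ?thesis by simp
        qed
        finally show "(1 - p / 4) ^ s \<le> exp (- a * real d powr \<epsilon>)" by simp
      qed (use p p0 in auto)
      have NK: "real d ^ 10 \<le> real (N ^ K)"
      proof -
        have "real d ^ 10 = real d powr 10" using d by (simp add: powr_numeral)
        also have "\<dots> \<le> real d powr (\<epsilon> / 2 * real K)" using d K\<epsilon> by (intro powr_mono) auto
        also have "\<dots> = (real d powr (\<epsilon> / 2)) ^ K" using d by (simp add: powr_realpow[symmetric] powr_powr)
        also have "\<dots> \<le> real N ^ K" using N by (intro power_mono) auto
        finally show ?thesis by simp
      qed
      define m where "m = 2 ^ d div (N ^ K)"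
      have m: "real m \<le> 2 ^ d / real d ^ 10"
      proof -
        have "real m \<le> real (2 ^ d) / real (N ^ K)" unfolding m_def by (rule of_nat_div_le_of_nat)
        also have "\<dots> \<le> 2 ^ d / real d ^ 10" using NK d by (intro frac_le) auto
        finally show ?thesis .
      qed
      have t2: "10 * 2 ^ (2 * m) * exp (- (p / 2)\<^sup>2 * (2 ^ d / (32 * real d ^ 6))) \<le> exp (- real d)"
      proof -
        define D where "D = (2::real) ^ d"
        have "(2::real) ^ (2 * m) \<le> exp 1 ^ (2 * m)" using exp_ge_add_one_self[of 1] by (intro power_mono) auto
        also have "\<dots> = exp (2 * real m)" by (simp add: exp_of_nat_mult[symmetric])
        also have "\<dots> \<le> exp (2 * (D / real d ^ 10))" using m by (simp add: D_def)
        finally have 1: "(2::real) ^ (2 * m) \<le> exp (2 * (D / real d ^ 10))" .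
        have "1 / real d \<le> p / 2" using elim(5) p by linarith
        then have "(1 / real d)\<^sup>2 \<le> (p / 2)\<^sup>2" using d by (intro power_mono) auto
        then have "(1 / real d)\<^sup>2 * (D / (32 * real d ^ 6)) \<le> (p / 2)\<^sup>2 * (D / (32 * real d ^ 6))"
          by (intro mult_right_mono) (auto simp: D_def)
        moreover have "(1 / real d)\<^sup>2 * (D / (32 * real d ^ 6)) = D / (32 * real d ^ 8)"
          by (simp add: power_one_over power_add[symmetric])
        \<comment> \<open>The entropy of the splittings, of order \<open>2^d / d^10\<close>, has to
          lose against \<open>2^d / d^8\<close>. The constants ask for \<open>d^2 \<ge> 128\<close>,
          which \<open>d \<ge> 12\<close> provides.\<close>
        moreover have "2 * (D / real d ^ 10) \<le> D / (64 * real d ^ 8)"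
        proof -
          have "real d ^ 10 = real d ^ 8 * (real d)\<^sup>2" by (simp add: power_add[symmetric])
          moreover have "(real d)\<^sup>2 \<ge> 128" using power_mono[of 12 "real d" 2] d by simp
          moreover have "real d ^ 8 * 128 \<le> real d ^ 8 * (real d)\<^sup>2"
            using \<open>(real d)\<^sup>2 \<ge> 128\<close> by (intro mult_left_mono) auto
          ultimately have "64 * real d ^ 8 * 2 \<le> real d ^ 10" by linarith
          then have "D * (64 * real d ^ 8 * 2) \<le> D * real d ^ 10" by (intro mult_left_mono) (auto simp: D_def)
          then show ?thesis using d by (simp add: field_simps)
        qed
        ultimately have "2 * (D / real d ^ 10) + - (p / 2)\<^sup>2 * (D / (32 * real d ^ 6)) \<le> - (D / (64 * real d ^ 8))"
          by simp
        then have 2: "exp (2 * (D / real d ^ 10)) * exp (- (p / 2)\<^sup>2 * (D / (32 * real d ^ 6))) \<le> exp (- (D / (64 * real d ^ 8)))"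
          by (simp only: exp_add[symmetric] exp_le_cancel_iff)
        have "10 * 2 ^ (2 * m) * exp (- (p / 2)\<^sup>2 * (D / (32 * real d ^ 6)))
            \<le> 10 * (exp (2 * (D / real d ^ 10)) * exp (- (p / 2)\<^sup>2 * (D / (32 * real d ^ 6))))"
          using 1 by (simp add: mult_right_mono)
        also have "\<dots> \<le> 10 * exp (- (D / (64 * real d ^ 8)))" using 2 by simp
        also have "\<dots> \<le> exp (- real d)" using elim(6) by (simp add: D_def)
        finally show ?thesis by (simp add: D_def)
      qed
      have "measure_pmf.prob (Pi_pmf (boxes d) False (\<lambda>_. bernoulli_pmf p)) {f. \<not> open_good d {z \<in> boxes d. f z}}
         \<le> 80 * real d ^ 5 * (real N * (1 - p / 4) ^ s)
           + 10 * 2 ^ (2 * (2 ^ d div (N ^ K))) * exp (- (p / 2)\<^sup>2 * (2 ^ d / (32 * real d ^ 6)))"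
        by (rule prob_not_open_good[OF _ p0 p(2) N1 Ks]) (use elim(3,7) c in auto)
      also have "80 * real d ^ 5 * (real N * (1 - p / 4) ^ s) \<le> 80 * real d ^ 5 * (real d * exp (- a * real d powr \<epsilon>))"
        using c by (intro mult_left_mono) auto
      also have "\<dots> \<le> exp (- (a / 2) * real d powr \<epsilon>)" by (rule elim(4))
      finally show "measure_pmf.prob (Pi_pmf (boxes d) False (\<lambda>_. bernoulli_pmf p)) {f. \<not> open_good d {z \<in> boxes d. f z}}
        \<le> exp (- (a / 2) * real d powr \<epsilon>) + exp (- real d)"
        using t2 unfolding m_def by linarith
    qed
  qed
  \<comment> \<open>The other half of the exponent \<open>a\<close> has been spent on the polynomial
    factor \<open>80 d^6\<close>.\<close>
  then show ?thesis using a by (intro exI[of _ "a / 2"]) auto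
qed

theorem theorem4p8:
  fixes \<epsilon> :: real
  assumes "0 < \<epsilon>" and "\<epsilon> < 1/3"
  shows "\<exists>c c'. c > 0 \<and> c' > 0 \<and>
    (\<forall>d::nat. \<forall>(M :: ((nat \<Rightarrow> int) \<Rightarrow> real) measure) \<phi>. d \<ge> 3 \<longrightarrow> is_GFF d M \<phi> \<longrightarrow>
       measure M {\<omega> \<in> space M. G0 d (h_as d * (1 - 8 * \<epsilon>)) (\<lambda>x. \<phi> x \<omega>)}
         \<ge> 1 - c * exp (- c' * real d powr \<epsilon>))"
proof -
  obtain C where C: "C > 0" and evC: "\<forall>\<^sub>F d in sequentially. \<forall>x \<in> lattice d. green d x x \<le> 1 + C / real d"
    using green_diag_bound by blast
  obtain a where a: "a > 0" "a \<le> 1" and ev_perc: "\<forall>\<^sub>F d in sequentially. \<forall>p. real d powr (2 * \<epsilon> - 1) \<le> p \<longrightarrow> p \<le> 1 \<longrightarrow>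
     measure_pmf.prob (Pi_pmf (boxes d) False (\<lambda>_. bernoulli_pmf p)) {f. \<not> open_good d {z \<in> boxes d. f z}}
       \<le> exp (- a * real d powr \<epsilon>) + exp (- real d)"
    using eventually_bernoulli_percolation[OF assms] by blast
  \<comment> \<open>With \<open>s = (\<epsilon>/2) sqrt (2 log d)\<close> and variance at most
    \<open>C / d\<close>, the Gaussian exponent equals \<open>b d log d\<close>, which beats the at
    most \<open>5 * 2^d\<close> vertices.\<close>
  define b where "b = \<epsilon>\<^sup>2 / (4 * C)"
  have b: "b > 0" using assms C by (simp add: b_def)
  have ev_tail: "\<forall>\<^sub>F d::nat in sequentially. 5 * 2 ^ d * exp (- (b * ln (real d) * real d)) \<le> exp (- real d)"
    using b by real_asymp
  have "\<forall>\<^sub>F d in sequentially. \<forall>(M :: ((nat \<Rightarrow> int) \<Rightarrow> real) measure) \<phi>. is_GFF d M \<phi> \<longrightarrow>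
       measure M {\<omega> \<in> space M. G0 d (h_as d * (1 - 8 * \<epsilon>)) (\<lambda>x. \<phi> x \<omega>)}
         \<ge> 1 - 3 * exp (- a * real d powr \<epsilon>)"
    using evC ev_perc ev_tail eventually_level_probability[OF assms C] eventually_ge_at_top[of 6]
  proof eventually_elim
    case (elim d)
    show ?case
    proof (intro allI impI)
      fix M :: "((nat \<Rightarrow> int) \<Rightarrow> real) measure" and \<phi>
      assume gff: "is_GFF d M \<phi>"
      define h where "h = h_as d * (1 - 8 * \<epsilon>)"
      define s where "s = \<epsilon> / 2 * sqrt (2 * ln (real d))"
      define p where "p = measure std_normal_distribution {max 0 h + s..}"
      define D where "D = Pi_pmf (boxes d) False (\<lambda>_. bernoulli_pmf p)"
      have d: "real d \<ge> 6" using elim by simp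
      have s: "s > 0" using d assms by (simp add: s_def)
      interpret N: prob_space std_normal_distribution by (rule prob_space_normal_density) simp
      have "(\<lambda>_. 0) \<in> lattice d" by (simp add: lattice_def)
      then have p: "real d powr (2 * \<epsilon> - 1) \<le> p" "p \<le> 1"
        using elim(1,4) unfolding p_def h_def s_def by auto
      have V: "finite (boxes d)" "real (card (boxes d)) \<le> 5 * 2 ^ d"
      proof -
        show "finite (boxes d)" using elim by (intro finite_boxes) simp
        have "real (card (boxes d)) \<le> real (5 * 2 ^ d)" using elim by (intro of_nat_mono card_boxes_le) simp
        then show "real (card (boxes d)) \<le> 5 * 2 ^ d" by simp
      qed
      have "measure M {\<omega> \<in> space M. open_good d {x \<in> boxes d. \<phi> x \<omega> \<ge> h}}
        \<ge> measure_pmf.prob D {f. open_good d {x \<in> boxes d. f x}} - real (card (boxes d)) * exp (- s\<^sup>2 / (2 * (C / real d)))"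
        unfolding D_def p_def
      proof (rule gff_dominates_bernoulli[OF gff _ V(1) boxes_lattice _ _ s])
        show "green d x x \<le> 1 + C / real d" if "x \<in> boxes d" for x
          using elim(1) that boxes_lattice by blast
        show "open_good d B" if "A \<subseteq> B" "open_good d A" for A B
          using open_good_mono[OF _ that(2,1)] elim by simp
      qed (use elim C in auto)
      moreover have "real (card (boxes d)) * exp (- s\<^sup>2 / (2 * (C / real d))) \<le> exp (- real d)"
      proof -
        have "- s\<^sup>2 / (2 * (C / real d)) = - (b * ln (real d) * real d)"
          using d C by (simp add: s_def b_def power_mult_distrib power_divide field_simps)
        then have "real (card (boxes d)) * exp (- s\<^sup>2 / (2 * (C / real d))) \<le> 5 * 2 ^ d * exp (- (b * ln (real d) * real d))"
          using V(2) by (simp add: mult_right_mono)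
        then show ?thesis using elim(3) by linarith
      qed
      moreover have "measure_pmf.prob D {f. open_good d {x \<in> boxes d. f x}} \<ge> 1 - (exp (- a * real d powr \<epsilon>) + exp (- real d))"
      proof -
        have "measure_pmf.prob D {f. \<not> open_good d {z \<in> boxes d. f z}} \<le> exp (- a * real d powr \<epsilon>) + exp (- real d)"
          using elim(2) p unfolding D_def by blast
        moreover have "measure_pmf.prob D {f. \<not> open_good d {z \<in> boxes d. f z}} = 1 - measure_pmf.prob D {f. open_good d {z \<in> boxes d. f z}}"
          using measure_pmf.prob_compl[of "{f. open_good d {z \<in> boxes d. f z}}" D]
          by (simp add: Compl_eq_Diff_UNIV[symmetric] Collect_neg_eq[symmetric])
        ultimately show ?thesis by linarith
      qed
      moreover have "exp (- real d) \<le> exp (- a * real d powr \<epsilon>)"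
      proof -
        have "a * real d powr \<epsilon> \<le> 1 * real d powr 1"
          using a d assms by (intro mult_mono powr_mono) auto
        then show ?thesis using d by simp
      qed
      ultimately have "measure M {\<omega> \<in> space M. open_good d {x \<in> boxes d. \<phi> x \<omega> \<ge> h}} \<ge> 1 - 3 * exp (- a * real d powr \<epsilon>)"
        by linarith
      then show "measure M {\<omega> \<in> space M. G0 d (h_as d * (1 - 8 * \<epsilon>)) (\<lambda>x. \<phi> x \<omega>)} \<ge> 1 - 3 * exp (- a * real d powr \<epsilon>)"
        by (simp add: G0_eq_open_good h_def)
    qed
  qed
  then obtain d0 where d0: "\<And>d (M :: ((nat \<Rightarrow> int) \<Rightarrow> real) measure) \<phi>. d \<ge> d0 \<Longrightarrow> is_GFF d M \<phi> \<Longrightarrow>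
       measure M {\<omega> \<in> space M. G0 d (h_as d * (1 - 8 * \<epsilon>)) (\<lambda>x. \<phi> x \<omega>)} \<ge> 1 - 3 * exp (- a * real d powr \<epsilon>)"
    unfolding eventually_sequentially by blast
  \<comment> \<open>For \<open>d < d0\<close> the second summand makes
    \<open>c * exp (- a * d powr \<epsilon>)\<close> at least 1, so the claimed lower bound is
    nonpositive there.\<close>
  define c where "c = 3 + exp (a * real d0 powr \<epsilon>)"
  have c: "c \<ge> 3" "c \<ge> exp (a * real d0 powr \<epsilon>)" by (auto simp: c_def)
  have "measure M {\<omega> \<in> space M. G0 d (h_as d * (1 - 8 * \<epsilon>)) (\<lambda>x. \<phi> x \<omega>)} \<ge> 1 - c * exp (- a * real d powr \<epsilon>)"
    if gff: "is_GFF d M \<phi>" for d :: nat and M :: "((nat \<Rightarrow> int) \<Rightarrow> real) measure" and \<phi>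
  proof (cases "d \<ge> d0")
    case True
    have "3 * exp (- a * real d powr \<epsilon>) \<le> c * exp (- a * real d powr \<epsilon>)" using c by (intro mult_right_mono) auto
    then show ?thesis using d0[OF True gff] by linarith
  next
    case False
    then have "real d powr \<epsilon> \<le> real d0 powr \<epsilon>" using assms by (intro powr_mono2) auto
    then have "exp (a * real d powr \<epsilon>) \<le> exp (a * real d0 powr \<epsilon>)" using a by simp
    then have "exp (a * real d powr \<epsilon>) \<le> c" using c(2) by (rule order_trans)
    then have "exp (a * real d powr \<epsilon>) * exp (- a * real d powr \<epsilon>) \<le> c * exp (- a * real d powr \<epsilon>)"
      by (intro mult_right_mono) auto
    then have "1 \<le> c * exp (- a * real d powr \<epsilon>)" by (simp add: exp_minus)
    then show ?thesis using measure_nonneg[of M] by (meson diff_le_0_iff_le order_trans)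
  qed
  then show ?thesis using a c by (intro exI[of _ c] exI[of _ a]) auto
qed

end
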